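(* Let $G$ and $G'$ be connected directed graphs (nodeless loops allowed). A map $\varphi\colon G\to G'$ in the wheeled properadic graphical category is the same thing as a pair $(\bar\varphi_0,\hat\varphi)$ consisting of a function $\bar\varphi_0\colon E_G\to E_{G'}$ and a function $\hat\varphi\colon\mathrm{Emb}(G)\to\mathrm{Emb}(G')$ such that (1) $\hat\varphi$ sends edges to edges; (2) $\hat\varphi$ preserves unions: if $[\ell]$ is a union of $[h]$ and $[k]$ in $\mathrm{Emb}(G)$, then $\hat\varphi[\ell]$ is a union of $\hat\varphi[h]$ and $\hat\varphi[k]$; (3) $\hat\varphi$ takes vertex disjoint pairs to vertex disjoint pairs; (4) $\mathrm{in}(\hat\varphi[h])=(\mathbb N\bar\varphi_0)(\mathrm{in}[h])$ and $\mathrm{out}(\hat\varphi[h])=(\mathbb N\bar\varphi_0)(\mathrm{out}[h])$ in $\mathbb NE_{G'}$ for all $[h]\in\mathrm{Emb}(G)$. Precisely, there is a bijection between the set of morphisms $G\to G'$ of the wheeled properadic graphical category and the set of such pairs, which keeps the function on edges unchanged; under these bijections composition is given by composition of pairs of functions. The same holds for the version of the wheeled properadic graphical category whose objects exclude the nodeless loop.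
   Context: **Directed graphs.** A directed graph $G$ consists of finite sets $E_G,I_G,V_G,O_G$, injections $I_G\hookrightarrow E_G$, $O_G\hookrightarrow E_G$ (treated as inclusions) and functions $I_G\to V_G$, $O_G\to V_G$, together with subsets $\mathrm{in}(G),\mathrm{out}(G)\subseteq E_G$ with $I_G\setminus O_G\subseteq\mathrm{in}(G)\subseteq E_G\setminus O_G$, $O_G\setminus I_G\subseteq\mathrm{out}(G)\subseteq E_G\setminus I_G$ and $\mathrm{in}(G)\setminus I_G=\mathrm{out}(G)\setminus O_G$. For $v\in V_G$, $\mathrm{in}(v)\subseteq I_G$ and $\mathrm{out}(v)\subseteq O_G$ are the preimages of $v$. $G$ is connected if the diagram $(E,I,V,O)$ is non-empty and is not a disjoint union of two non-empty such diagrams. A connected directed graph either has $\mathrm{in}(G)=E_G\setminus O_G$ and $\mathrm{out}(G)=E_G\setminus I_G$ (the ordinary case), or is a nodeless loop: $E_G$ is a point and $I_G=V_G=O_G=\mathrm{in}(G)=\mathrm{out}(G)=\varnothing$. The edge graph has $E=\mathrm{in}=\mathrm{out}$ a point and $I=V=O=\varnothing$. A *local map* $H\to G$ is a natural transformation of the diagrams $(E,I,V,O)$ such that the squares for $I\to V$ and for $O\to V$ are pullbacks. An embedding is a local map $H\to G$ between connected directed graphs which is injective on vertices and such that, if $H$ is a nodeless loop, then so is $G$. $\mathrm{Emb}(G)$ is the set of isomorphism classes $[f]$ of embeddings with codomain $G$ ($f\sim h$ iff $f=hz$ for an isomorphism $z$), ordered by $[h]\le[k]$ iff $h=kj$ for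 an embedding $j$. A class $[f\colon H\to G]$ is an edge if $H$ is isomorphic to the edge graph. $\ell\colon L\to G$ is a union of $h\colon H\to G$ and $k\colon K\to G$ if $[h],[k]\le[\ell]$ and $\ell(V_L)=h(V_H)\cup k(V_K)$; $h,k$ are vertex disjoint if $h(V_H)\cap k(V_K)=\varnothing$. $\mathbb NS$ is the free commutative monoid on $S$; $\mathrm{in}([f])=\sum_{e\in\mathrm{in}(H)}f(e)$ and $\mathrm{out}([f])=\sum_{e\in\mathrm{out}(H)}f(e)$ in $\mathbb NE_G$. **Graph substitution.** Given a connected directed graph $H$ and, for each $v\in V_H$, a connected directed graph $K_v$ with bijections $\mathrm{in}(K_v)\cong\mathrm{in}(v)$ and $\mathrm{out}(K_v)\cong\mathrm{out}(v)$, the graph $H\{K_v\}$ has $V=\coprod V_{K_v}$, $I=\coprod I_{K_v}$, $O=\coprod O_{K_v}$, $E$ the quotient of $E_H\amalg\coprod_vE_{K_v}$ identifying each input (resp. output) edge of $K_v$ with the corresponding edge in $\mathrm{in}(v)$ (resp. $\mathrm{out}(v)$), and $\mathrm{in}$, $\mathrm{out}$ the images of $\mathrm{in}(H)$, $\mathrm{out}(H)$. It may be a nodeless loop. **Wheeled properadic graphical category.** Its objects are all connected directed graphs (no listings or passage to isomorphism classes). For a directed graph $G$ let $F(G)$ be the free $E_G$-coloured wheeled properad with one generator for each $v\in V_G$, with inputs $\mathrm{in}(v)$ and outputs $\mathrm{out}(v)$. A map of wheeled properads $f\colon F(G)\to F(G')$ amounts to a function $f_0\colon E_G\to E_{G'}$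 and, for each $v\in V_G$, an isomorphism class $f_1(v)$ of a connected directed graph $K_v$ (possibly a nodeless loop) with a local map $\kappa_v\colon K_v\to G'$ and bijections $\mathrm{in}(K_v)\cong\mathrm{in}(v)$, $\mathrm{out}(K_v)\cong\mathrm{out}(v)$ under which $\kappa_v$ on $\mathrm{in}(K_v)$ and $\mathrm{out}(K_v)$ agrees with $f_0$. For an embedding $h\colon H\to G$ the maps $f_0h$ and $\kappa_{h(v)}$ induce a local map $H\{K_{h(v)}\}_{v\in V_H}\to G'$. A morphism $G\to G'$ in the wheeled properadic graphical category is a map of wheeled properads $f\colon F(G)\to F(G')$ such that for every embedding $h\colon H\to G$ this induced local map is an embedding. Composition is that of wheeled properad maps: $(gf)_0=g_0f_0$, and $(gf)_1(v)$ is the induced map $K_v\{L_{\kappa_v(w)}\}_{w\in V_{K_v}}\to G''$, where $g_1(u)$ is represented by $L_u\to G''$. The version excluding the nodeless loop is the full subcategory on the connected directed graphs that are not nodeless loops. *)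

theory Defs
  imports Main "HOL-Library.FuncSet" "HOL-Library.Multiset" "HOL-Library.Infinite_Typeclass"
begin

text \<open>
  An edge in \<open>gI G\<close> is an input of the vertex \<open>tgt G e\<close>; an edge in \<open>gO G\<close> is an output of the
  vertex \<open>src G e\<close>. All functions with a carrier as domain are extensional in the sense of
  \<^theory>\<open>HOL-Library.FuncSet\<close>, so that equality in HOL is equality of the mathematical objects.
\<close>

record ('e, 'v) dgraph =
  gE :: "'e set"
  gI :: "'e set"
  gV :: "'v set"
  gO :: "'e set"
  tgt :: "'e \<Rightarrow> 'v"
  src :: "'e \<Rightarrow> 'v"
  gin :: "'e set"
  gout :: "'e set"

definition directed_graph :: "('e, 'v) dgraph \<Rightarrow> bool" where
  "directed_graph G \<longleftrightarrow>
     finite (gE G) \<and> finite (gV G) \<and> gI G \<subseteq> gE G \<and> gO G \<subseteq> gE G \<and>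
     tgt G \<in> gI G \<rightarrow>\<^sub>E gV G \<and> src G \<in> gO G \<rightarrow>\<^sub>E gV G \<and>
     gI G - gO G \<subseteq> gin G \<and> gin G \<subseteq> gE G - gO G \<and>
     gO G - gI G \<subseteq> gout G \<and> gout G \<subseteq> gE G - gI G \<and>
     gin G - gI G = gout G - gO G"

definition in_at :: "('e, 'v) dgraph \<Rightarrow> 'v \<Rightarrow> 'e set" where
  "in_at G v = {e \<in> gI G. tgt G e = v}"

definition out_at :: "('e, 'v) dgraph \<Rightarrow> 'v \<Rightarrow> 'e set" where
  "out_at G v = {e \<in> gO G. src G e = v}"

definition connected_graph :: "('e, 'v) dgraph \<Rightarrow> bool" where
  "connected_graph G \<longleftrightarrow> directed_graph G \<and> (gE G \<noteq> {} \<or> gV G \<noteq> {}) \<and>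
     \<not> (\<exists>E1 E2 V1 V2.
          E1 \<union> E2 = gE G \<and> E1 \<inter> E2 = {} \<and> V1 \<union> V2 = gV G \<and> V1 \<inter> V2 = {} \<and>
          (E1 \<noteq> {} \<or> V1 \<noteq> {}) \<and> (E2 \<noteq> {} \<or> V2 \<noteq> {}) \<and>
          tgt G ` (gI G \<inter> E1) \<subseteq> V1 \<and> tgt G ` (gI G \<inter> E2) \<subseteq> V2 \<and>
          src G ` (gO G \<inter> E1) \<subseteq> V1 \<and> src G ` (gO G \<inter> E2) \<subseteq> V2)"

definition nodeless_loop :: "('e, 'v) dgraph \<Rightarrow> bool" where
  "nodeless_loop G \<longleftrightarrow> directed_graph G \<and> (\<exists>e. gE G = {e}) \<and>
     gI G = {} \<and> gV G = {} \<and> gO G = {} \<and> gin G = {} \<and> gout G = {}"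

definition edge_graph :: "('e, 'v) dgraph \<Rightarrow> bool" where
  "edge_graph G \<longleftrightarrow> directed_graph G \<and> (\<exists>e. gE G = {e} \<and> gin G = {e} \<and> gout G = {e}) \<and>
     gI G = {} \<and> gV G = {} \<and> gO G = {}"

text \<open>
  A natural transformation of the diagrams is given by its components on edges and vertices,
  as the components on \<open>gI\<close> and \<open>gO\<close> are restrictions of the one on edges.
\<close>

type_synonym ('e, 'v, 'a, 'b) gmap = "('e \<Rightarrow> 'a) \<times> ('v \<Rightarrow> 'b)"

definition gcomp ::
  "('e, 'v) dgraph \<Rightarrow> ('a, 'b, 'c, 'd) gmap \<Rightarrow> ('e, 'v, 'a, 'b) gmap \<Rightarrow> ('e, 'v, 'c, 'd) gmap" where
  "gcomp H g f = (compose (gE H) (fst g) (fst f), compose (gV H) (snd g) (snd f))"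

text \<open>The two bijections say that the squares commute and are pullbacks.\<close>

definition local_map :: "('e, 'v) dgraph \<Rightarrow> ('a, 'b) dgraph \<Rightarrow> ('e, 'v, 'a, 'b) gmap \<Rightarrow> bool" where
  "local_map H G f \<longleftrightarrow> directed_graph H \<and> directed_graph G \<and>
     fst f \<in> gE H \<rightarrow>\<^sub>E gE G \<and> snd f \<in> gV H \<rightarrow>\<^sub>E gV G \<and>
     bij_betw (\<lambda>e. (fst f e, tgt H e)) (gI H) {(i, v) \<in> gI G \<times> gV H. tgt G i = snd f v} \<and>
     bij_betw (\<lambda>e. (fst f e, src H e)) (gO H) {(i, v) \<in> gO G \<times> gV H. src G i = snd f v}"

text \<open>
  Isomorphisms preserve \<open>gin\<close> and \<open>gout\<close>: the edge graph and the nodeless loop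
  differ only in these.
\<close>

definition graph_iso :: "('e, 'v) dgraph \<Rightarrow> ('a, 'b) dgraph \<Rightarrow> ('e, 'v, 'a, 'b) gmap \<Rightarrow> bool" where
  "graph_iso H K z \<longleftrightarrow> local_map H K z \<and>
     bij_betw (fst z) (gE H) (gE K) \<and> bij_betw (snd z) (gV H) (gV K) \<and>
     fst z ` gI H = gI K \<and> fst z ` gO H = gO K \<and>
     fst z ` gin H = gin K \<and> fst z ` gout H = gout K"

definition embedding :: "('e, 'v) dgraph \<Rightarrow> ('a, 'b) dgraph \<Rightarrow> ('e, 'v, 'a, 'b) gmap \<Rightarrow> bool" where
  "embedding H G f \<longleftrightarrow> connected_graph H \<and> connected_graph G \<and> local_map H G f \<and>
     inj_on (snd f) (gV H) \<and> (nodeless_loop H \<longrightarrow> nodeless_loop G)"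

text \<open>
  The domains of the embeddings range over the graphs with edges in \<open>'e\<close> and vertices in \<open>'v\<close>.
  For infinite \<open>'e\<close> and \<open>'v\<close>, every finite graph is isomorphic to one of these.
\<close>

type_synonym ('e, 'v) emb = "('e, 'v) dgraph \<times> ('e, 'v, 'e, 'v) gmap"

definition emb_rel :: "('e, 'v) dgraph \<Rightarrow> (('e, 'v) emb \<times> ('e, 'v) emb) set" where
  "emb_rel G = {((H, f), (K, h)). embedding H G f \<and> embedding K G h \<and>
     (\<exists>z. graph_iso H K z \<and> f = gcomp H h z)}"

definition Emb :: "('e, 'v) dgraph \<Rightarrow> ('e, 'v) emb set set" where
  "Emb G = {(H, f). embedding H G f} // emb_rel G"

definition emb_le :: "('e, 'v) emb set \<Rightarrow> ('e, 'v) emb set \<Rightarrow> bool" where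
  "emb_le X Y \<longleftrightarrow> (\<exists>(H, h) \<in> X. \<exists>(K, k) \<in> Y. \<exists>j. embedding H K j \<and> h = gcomp H k j)"

definition emb_is_edge :: "('e, 'v) emb set \<Rightarrow> bool" where
  "emb_is_edge X \<longleftrightarrow> (\<exists>(H, f) \<in> X. \<exists>P :: ('e, 'v) dgraph. edge_graph P \<and> (\<exists>z. graph_iso H P z))"

text \<open>
  The next three functions are applied to classes, on which the value of the mapped function
  does not depend on the representative.
\<close>

definition emb_verts :: "('e, 'v) emb set \<Rightarrow> 'v set" where
  "emb_verts X = the_elem ((\<lambda>(H, f). snd f ` gV H) ` X)"

definition emb_in :: "('e, 'v) emb set \<Rightarrow> 'e multiset" where
  "emb_in X = the_elem ((\<lambda>(H, f). image_mset (fst f) (mset_set (gin H))) ` X)"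

definition emb_out :: "('e, 'v) emb set \<Rightarrow> 'e multiset" where
  "emb_out X = the_elem ((\<lambda>(H, f). image_mset (fst f) (mset_set (gout H))) ` X)"

definition emb_union :: "('e, 'v) emb set \<Rightarrow> ('e, 'v) emb set \<Rightarrow> ('e, 'v) emb set \<Rightarrow> bool" where
  "emb_union L H K \<longleftrightarrow> emb_le H L \<and> emb_le K L \<and> emb_verts L = emb_verts H \<union> emb_verts K"

definition emb_disjoint :: "('e, 'v) emb set \<Rightarrow> ('e, 'v) emb set \<Rightarrow> bool" where
  "emb_disjoint H K \<longleftrightarrow> emb_verts H \<inter> emb_verts K = {}"

type_synonym ('e, 'v) fpair = "('e \<Rightarrow> 'e) \<times> (('e, 'v) emb set \<Rightarrow> ('e, 'v) emb set)"

definition pair_maps :: "('e, 'v) dgraph \<Rightarrow> ('e, 'v) dgraph \<Rightarrow> ('e, 'v) fpair set" where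
  "pair_maps G G' = {(p0, p).
     p0 \<in> gE G \<rightarrow>\<^sub>E gE G' \<and> p \<in> Emb G \<rightarrow>\<^sub>E Emb G' \<and>
     (\<forall>X\<in>Emb G. emb_is_edge X \<longrightarrow> emb_is_edge (p X)) \<and>
     (\<forall>L\<in>Emb G. \<forall>H\<in>Emb G. \<forall>K\<in>Emb G. emb_union L H K \<longrightarrow> emb_union (p L) (p H) (p K)) \<and>
     (\<forall>H\<in>Emb G. \<forall>K\<in>Emb G. emb_disjoint H K \<longrightarrow> emb_disjoint (p H) (p K)) \<and>
     (\<forall>H\<in>Emb G. emb_in (p H) = image_mset p0 (emb_in H) \<and>
                  emb_out (p H) = image_mset p0 (emb_out H))}"

definition pair_comp ::
  "('e, 'v) dgraph \<Rightarrow> ('e, 'v) fpair \<Rightarrow> ('e, 'v) fpair \<Rightarrow> ('e, 'v) fpair" where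
  "pair_comp G q p = (compose (gE G) (fst q) (fst p), compose (Emb G) (snd q) (snd p))"

text \<open>
  \<open>H\<close> is the outer graph, \<open>K v\<close> the graph substituted at \<open>v\<close>, and \<open>a v\<close>, \<open>b v\<close> are the
  bijections \<open>gin (K v) \<cong> in_at H v\<close>, \<open>gout (K v) \<cong> out_at H v\<close>. Edges of the result are
  equivalence classes of elements \<open>Inl e\<close> (an edge of \<open>H\<close>) and \<open>Inr (v, x)\<close> (an edge of \<open>K v\<close>).
\<close>

definition subst_edges ::
  "('e, 'v) dgraph \<Rightarrow> ('v \<Rightarrow> ('k, 'w) dgraph) \<Rightarrow> ('e + 'v \<times> 'k) set" where
  "subst_edges H K = gE H <+> (SIGMA v : gV H. gE (K v))"

definition subst_glue ::
  "('e, 'v) dgraph \<Rightarrow> ('v \<Rightarrow> ('k, 'w) dgraph) \<Rightarrow> ('v \<Rightarrow> 'k \<Rightarrow> 'e) \<Rightarrow> ('v \<Rightarrow> 'k \<Rightarrow> 'e) \<Rightarrow>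
     ('e + 'v \<times> 'k) rel" where
  "subst_glue H K a b =
     {(Inr (v, x), Inl (a v x)) | v x. v \<in> gV H \<and> x \<in> gin (K v)} \<union>
     {(Inr (v, x), Inl (b v x)) | v x. v \<in> gV H \<and> x \<in> gout (K v)}"

definition subst_rel ::
  "('e, 'v) dgraph \<Rightarrow> ('v \<Rightarrow> ('k, 'w) dgraph) \<Rightarrow> ('v \<Rightarrow> 'k \<Rightarrow> 'e) \<Rightarrow> ('v \<Rightarrow> 'k \<Rightarrow> 'e) \<Rightarrow>
     ('e + 'v \<times> 'k) rel" where
  "subst_rel H K a b =
     (subst_glue H K a b \<union> (subst_glue H K a b)\<inverse>)\<^sup>* \<inter> (subst_edges H K \<times> subst_edges H K)"

definition subst_class ::
  "('e, 'v) dgraph \<Rightarrow> ('v \<Rightarrow> ('k, 'w) dgraph) \<Rightarrow> ('v \<Rightarrow> 'k \<Rightarrow> 'e) \<Rightarrow> ('v \<Rightarrow> 'k \<Rightarrow> 'e) \<Rightarrow>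
     'e + 'v \<times> 'k \<Rightarrow> ('e + 'v \<times> 'k) set" where
  "subst_class H K a b y = subst_rel H K a b `` {y}"

definition subst_graph ::
  "('e, 'v) dgraph \<Rightarrow> ('v \<Rightarrow> ('k, 'w) dgraph) \<Rightarrow> ('v \<Rightarrow> 'k \<Rightarrow> 'e) \<Rightarrow> ('v \<Rightarrow> 'k \<Rightarrow> 'e) \<Rightarrow>
     (('e + 'v \<times> 'k) set, 'v \<times> 'w) dgraph" where
  "subst_graph H K a b =
     (let q = subst_class H K a b;
          I = (\<lambda>p. q (Inr p)) ` (SIGMA v : gV H. gI (K v));
          O' = (\<lambda>p. q (Inr p)) ` (SIGMA v : gV H. gO (K v))
      in \<lparr> gE = subst_edges H K // subst_rel H K a b,
           gI = I,
           gV = (SIGMA v : gV H. gV (K v)),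
           gO = O',
           tgt = (\<lambda>c\<in>I. the_elem ((\<lambda>(v, x). (v, tgt (K v) x)) `
                         {(v, x). v \<in> gV H \<and> x \<in> gI (K v) \<and> q (Inr (v, x)) = c})),
           src = (\<lambda>c\<in>O'. the_elem ((\<lambda>(v, x). (v, src (K v) x)) `
                         {(v, x). v \<in> gV H \<and> x \<in> gO (K v) \<and> q (Inr (v, x)) = c})),
           gin = (\<lambda>e. q (Inl e)) ` gin H,
           gout = (\<lambda>e. q (Inl e)) ` gout H \<rparr>)"

text \<open>
  A representative of \<open>f\<^sub>1(v)\<close>: a connected graph \<open>K\<close>, a local map \<open>\<kappa>\<close> from \<open>K\<close> to the codomain, and
  the bijections \<open>gin K \<cong> in_at G v\<close>, \<open>gout K \<cong> out_at G v\<close>. Here \<open>'k\<close>, \<open>'w\<close> are the types of edges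
  and vertices of \<open>K\<close>, \<open>'e\<close> that of edges of the domain \<open>G\<close>, and \<open>'a\<close>, \<open>'b\<close> those of the codomain.
\<close>

record ('k, 'w, 'e, 'a, 'b) gen_image =
  gi_graph :: "('k, 'w) dgraph"
  gi_map :: "('k, 'w, 'a, 'b) gmap"
  gi_in :: "'k \<Rightarrow> 'e"
  gi_out :: "'k \<Rightarrow> 'e"

definition gen_image_at ::
  "('e, 'v) dgraph \<Rightarrow> ('a, 'b) dgraph \<Rightarrow> ('e \<Rightarrow> 'a) \<Rightarrow> 'v \<Rightarrow> ('k, 'w, 'e, 'a, 'b) gen_image \<Rightarrow> bool" where
  "gen_image_at G G' f0 v r \<longleftrightarrow>
     connected_graph (gi_graph r) \<and> local_map (gi_graph r) G' (gi_map r) \<and>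
     gi_in r \<in> extensional (gin (gi_graph r)) \<and>
     bij_betw (gi_in r) (gin (gi_graph r)) (in_at G v) \<and>
     gi_out r \<in> extensional (gout (gi_graph r)) \<and>
     bij_betw (gi_out r) (gout (gi_graph r)) (out_at G v) \<and>
     (\<forall>x\<in>gin (gi_graph r). fst (gi_map r) x = f0 (gi_in r x)) \<and>
     (\<forall>x\<in>gout (gi_graph r). fst (gi_map r) x = f0 (gi_out r x))"

definition gen_image_iso ::
  "('k, 'w, 'e, 'a, 'b) gen_image \<Rightarrow> ('l, 'u, 'e, 'a, 'b) gen_image \<Rightarrow> bool" where
  "gen_image_iso r s \<longleftrightarrow> (\<exists>z. graph_iso (gi_graph r) (gi_graph s) z \<and>
     gi_map r = gcomp (gi_graph r) (gi_map s) z \<and>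
     gi_in r = compose (gin (gi_graph r)) (gi_in s) (fst z) \<and>
     gi_out r = compose (gout (gi_graph r)) (gi_out s) (fst z))"

definition gen_image_rel ::
  "('e, 'v) dgraph \<Rightarrow> ('a, 'b) dgraph \<Rightarrow> ('e \<Rightarrow> 'a) \<Rightarrow> 'v \<Rightarrow> ('k, 'w, 'e, 'a, 'b) gen_image rel" where
  "gen_image_rel G G' f0 v =
     {(r, s). gen_image_at G G' f0 v r \<and> gen_image_at G G' f0 v s \<and> gen_image_iso r s}"

type_synonym ('e, 'v) wp_map = "('e \<Rightarrow> 'e) \<times> ('v \<Rightarrow> ('e, 'v, 'e, 'e, 'v) gen_image set)"

definition wp_maps :: "('e, 'v) dgraph \<Rightarrow> ('e, 'v) dgraph \<Rightarrow> ('e, 'v) wp_map set" where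
  "wp_maps G G' = {(f0, f1).
     f0 \<in> gE G \<rightarrow>\<^sub>E gE G' \<and>
     f1 \<in> (\<Pi>\<^sub>E v\<in>gV G. {r. gen_image_at G G' f0 v r} // gen_image_rel G G' f0 v)}"

text \<open>
  Given a local map \<open>h\<close> from \<open>H\<close> to \<open>G\<close>, a function \<open>f0\<close> on the edges of \<open>G\<close>, and a family \<open>r\<close> of
  representatives indexed by the vertices of \<open>G\<close>, the graph \<open>K\<close> of \<open>r (h v)\<close> is substituted at \<open>v\<close>
  along \<open>gin K \<cong> in_at G (h v) \<cong> in_at H v\<close>, where the second bijection is the inverse of \<open>h\<close>.
\<close>

definition ind_graph_of ::
  "('e, 'v, 'c, 'd) gmap \<Rightarrow> ('d \<Rightarrow> ('k, 'w, 'c, 'a, 'b) gen_image) \<Rightarrow> 'v \<Rightarrow> ('k, 'w) dgraph" where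
  "ind_graph_of h r v = gi_graph (r (snd h v))"

definition ind_in ::
  "('e, 'v) dgraph \<Rightarrow> ('e, 'v, 'c, 'd) gmap \<Rightarrow> ('d \<Rightarrow> ('k, 'w, 'c, 'a, 'b) gen_image) \<Rightarrow>
     'v \<Rightarrow> 'k \<Rightarrow> 'e" where
  "ind_in H h r v x = inv_into (in_at H v) (fst h) (gi_in (r (snd h v)) x)"

definition ind_out ::
  "('e, 'v) dgraph \<Rightarrow> ('e, 'v, 'c, 'd) gmap \<Rightarrow> ('d \<Rightarrow> ('k, 'w, 'c, 'a, 'b) gen_image) \<Rightarrow>
     'v \<Rightarrow> 'k \<Rightarrow> 'e" where
  "ind_out H h r v x = inv_into (out_at H v) (fst h) (gi_out (r (snd h v)) x)"

definition ind_class ::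
  "('e, 'v) dgraph \<Rightarrow> ('e, 'v, 'c, 'd) gmap \<Rightarrow> ('d \<Rightarrow> ('k, 'w, 'c, 'a, 'b) gen_image) \<Rightarrow>
     'e + 'v \<times> 'k \<Rightarrow> ('e + 'v \<times> 'k) set" where
  "ind_class H h r = subst_class H (ind_graph_of h r) (ind_in H h r) (ind_out H h r)"

definition ind_graph ::
  "('e, 'v) dgraph \<Rightarrow> ('e, 'v, 'c, 'd) gmap \<Rightarrow> ('d \<Rightarrow> ('k, 'w, 'c, 'a, 'b) gen_image) \<Rightarrow>
     (('e + 'v \<times> 'k) set, 'v \<times> 'w) dgraph" where
  "ind_graph H h r = subst_graph H (ind_graph_of h r) (ind_in H h r) (ind_out H h r)"

definition ind_map ::
  "('e, 'v) dgraph \<Rightarrow> ('e, 'v, 'c, 'd) gmap \<Rightarrow> ('c \<Rightarrow> 'a) \<Rightarrow>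
     ('d \<Rightarrow> ('k, 'w, 'c, 'a, 'b) gen_image) \<Rightarrow> (('e + 'v \<times> 'k) set, 'v \<times> 'w, 'a, 'b) gmap" where
  "ind_map H h f0 r =
     (\<lambda>c\<in>gE (ind_graph H h r).
        the_elem (case_sum (\<lambda>e. f0 (fst h e)) (\<lambda>(v, x). fst (gi_map (r (snd h v))) x) ` c),
      \<lambda>(v, w)\<in>gV (ind_graph H h r). snd (gi_map (r (snd h v))) w)"

definition graphical_maps :: "('e, 'v) dgraph \<Rightarrow> ('e, 'v) dgraph \<Rightarrow> ('e, 'v) wp_map set" where
  "graphical_maps G G' = {(f0, f1) \<in> wp_maps G G'.
     \<forall>(H :: ('e, 'v) dgraph) h r. embedding H G h \<longrightarrow> (\<forall>v\<in>gV G. r v \<in> f1 v) \<longrightarrow>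
       embedding (ind_graph H h r) G' (ind_map H h f0 r)}"

text \<open>
  A representative of \<open>(gf)\<^sub>1(v)\<close>, from a representative \<open>k\<close> of \<open>f\<^sub>1(v)\<close> and representatives
  \<open>r u\<close> of \<open>g\<^sub>1(u)\<close>.
\<close>

definition comp_rep ::
  "('c \<Rightarrow> 'a) \<Rightarrow> ('d \<Rightarrow> ('l, 'u, 'c, 'a, 'b) gen_image) \<Rightarrow> ('k, 'w, 'e, 'c, 'd) gen_image \<Rightarrow>
     (('k + 'w \<times> 'l) set, 'w \<times> 'u, 'e, 'a, 'b) gen_image" where
  "comp_rep g0 r k =
     (let K = gi_graph k; S = ind_graph K (gi_map k) r; q = ind_class K (gi_map k) r
      in \<lparr> gi_graph = S,
           gi_map = ind_map K (gi_map k) g0 r,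
           gi_in = (\<lambda>c\<in>gin S. the_elem (gi_in k ` {e \<in> gin K. q (Inl e) = c})),
           gi_out = (\<lambda>c\<in>gout S. the_elem (gi_out k ` {e \<in> gout K. q (Inl e) = c})) \<rparr>)"

text \<open>
  The graph of \<open>comp_rep\<close> lives on other types; its isomorphism class consists of the isomorphic
  data with edges in \<open>'e\<close> and vertices in \<open>'v\<close>, and does not depend on the representatives.
\<close>

definition wp_comp ::
  "('e, 'v) dgraph \<Rightarrow> ('e, 'v) dgraph \<Rightarrow> ('e, 'v) dgraph \<Rightarrow> ('e, 'v) wp_map \<Rightarrow> ('e, 'v) wp_map \<Rightarrow>
     ('e, 'v) wp_map" where
  "wp_comp G G' G'' g f =
     (compose (gE G) (fst g) (fst f),
      \<lambda>v\<in>gV G. {s. gen_image_at G G'' (compose (gE G) (fst g) (fst f)) v s \<and>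
         (\<exists>k\<in>snd f v. \<exists>r. (\<forall>u\<in>gV G'. r u \<in> snd g u) \<and> gen_image_iso s (comp_rep (fst g) r k))})"

end

theory Submission
  imports Defs
begin

text \<open>
  An embedding is determined up to isomorphism by its vertices together with its inputs. The
  inputs of \<open>H{K\<^sub>v}\<close> are those of \<open>H\<close> and its vertices are those of the \<open>K\<^sub>v\<close>, so a graphical map is
  determined by its function on edges and by the vertex sets of the images of the generators,
  that is, by what the associated pair does to edges and stars. Conversely, a pair sends stars to
  embeddings on which (4) yields the bijections on inputs and outputs. Every embedding is
  obtained from stars and edges by adding one vertex at a time through unions, so by (2) the
  vertices of \<open>\<phi>[h]\<close> are those of \<open>H{K\<^sub>v}\<close>; by (4) both have the same inputs, hence they agree.
\<close>

section \<open>Connected graphs and local maps\<close>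

text \<open>Substituted graphs are quotients and awkward to compare up to isomorphism, so
  comparisons are replaced by equality of two invariants of an embedding: its vertices and its
  inputs. Outputs come along because the members of a class are isomorphic. Thus composition never
  needs associativity of substitution: both candidates are embedded images with the same vertices.
  The invariants give no criterion for the order on \<open>Emb\<close>, however, so (2) for the pair
  of a graphical map takes an actual embedding between substituted graphs. Nor do they help before a
  map is known to be an embedding: for a map built from a pair, injectivity on vertices and the
  condition on nodeless loops are shown by hand, the former using (3). That \<open>H{K}\<close> is a
  directed graph at all rests on finiteness: gluing may close edges up into cycles, and an edge of
  the result that has an end must be shown to have a beginning. Nodeless loops are the recurrent
  exception, since they share their diagram with the edge graph and only the boundary separates the
  two.\<close>

lemma connected_graph_iff:
  "connected_graph G \<longleftrightarrow> directed_graph G \<and> (gE G \<noteq> {} \<or> gV G \<noteq> {}) \<and>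
    (\<forall>P Q. (\<forall>e\<in>gI G. P e = Q (tgt G e)) \<longrightarrow> (\<forall>e\<in>gO G. P e = Q (src G e)) \<longrightarrow>
       (\<forall>e\<in>gE G. P e) \<and> (\<forall>v\<in>gV G. Q v) \<or> (\<forall>e\<in>gE G. \<not> P e) \<and> (\<forall>v\<in>gV G. \<not> Q v))"
  (is "_ \<longleftrightarrow> _ \<and> _ \<and> ?col")
proof (cases "directed_graph G \<and> (gE G \<noteq> {} \<or> gV G \<noteq> {})")
  case True
  then have dg: "directed_graph G" by simp
  have sub: "gI G \<subseteq> gE G" "gO G \<subseteq> gE G"
    and V: "\<And>e. e \<in> gI G \<Longrightarrow> tgt G e \<in> gV G" "\<And>e. e \<in> gO G \<Longrightarrow> src G e \<in> gV G"
    using dg by (auto simp: directed_graph_def)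
  let ?split = "\<lambda>E1 E2 V1 V2. E1 \<union> E2 = gE G \<and> E1 \<inter> E2 = {} \<and> V1 \<union> V2 = gV G \<and> V1 \<inter> V2 = {} \<and>
          (E1 \<noteq> {} \<or> V1 \<noteq> {}) \<and> (E2 \<noteq> {} \<or> V2 \<noteq> {}) \<and>
          tgt G ` (gI G \<inter> E1) \<subseteq> V1 \<and> tgt G ` (gI G \<inter> E2) \<subseteq> V2 \<and>
          src G ` (gO G \<inter> E1) \<subseteq> V1 \<and> src G ` (gO G \<inter> E2) \<subseteq> V2"
  have "(\<exists>E1 E2 V1 V2. ?split E1 E2 V1 V2) \<longleftrightarrow> \<not> ?col"
  proof
    assume "\<exists>E1 E2 V1 V2. ?split E1 E2 V1 V2"
    then obtain E1 E2 V1 V2 where s: "?split E1 E2 V1 V2" by (elim exE)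
    then have u: "E1 \<union> E2 = gE G" "E1 \<inter> E2 = {}" "V1 \<union> V2 = gV G" "V1 \<inter> V2 = {}"
      and n: "E1 \<noteq> {} \<or> V1 \<noteq> {}" "E2 \<noteq> {} \<or> V2 \<noteq> {}"
      and i: "\<And>e. e \<in> gI G \<Longrightarrow> e \<in> E1 \<Longrightarrow> tgt G e \<in> V1" "\<And>e. e \<in> gI G \<Longrightarrow> e \<in> E2 \<Longrightarrow> tgt G e \<in> V2"
      and o: "\<And>e. e \<in> gO G \<Longrightarrow> e \<in> E1 \<Longrightarrow> src G e \<in> V1" "\<And>e. e \<in> gO G \<Longrightarrow> e \<in> E2 \<Longrightarrow> src G e \<in> V2"
      by (simp_all add: image_subset_iff)
    have "\<And>e. e \<in> gI G \<Longrightarrow> (e \<in> E1) = (tgt G e \<in> V1)" using u i sub by blast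
    moreover have "\<And>e. e \<in> gO G \<Longrightarrow> (e \<in> E1) = (src G e \<in> V1)" using u o sub by blast
    moreover have "\<not> ((\<forall>e\<in>gE G. e \<in> E1) \<and> (\<forall>v\<in>gV G. v \<in> V1))"
      "\<not> ((\<forall>e\<in>gE G. e \<notin> E1) \<and> (\<forall>v\<in>gV G. v \<notin> V1))"
      using u n by blast+
    ultimately show "\<not> ?col"
      by (intro notI) (drule spec[of _ "\<lambda>e. e \<in> E1"], drule spec[of _ "\<lambda>v. v \<in> V1"], auto)
  next
    assume "\<not> ?col"
    then obtain P Q where PQ: "\<forall>e\<in>gI G. P e = Q (tgt G e)" "\<forall>e\<in>gO G. P e = Q (src G e)"
      "\<not> ((\<forall>e\<in>gE G. P e) \<and> (\<forall>v\<in>gV G. Q v))" "\<not> ((\<forall>e\<in>gE G. \<not> P e) \<and> (\<forall>v\<in>gV G. \<not> Q v))"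
      unfolding not_all not_imp de_Morgan_disj by (elim exE conjE) (rule that; assumption)
    have "?split {e\<in>gE G. P e} {e\<in>gE G. \<not> P e} {v\<in>gV G. Q v} {v\<in>gV G. \<not> Q v}"
    proof (intro conjI)
      show "{e\<in>gE G. P e} \<noteq> {} \<or> {v\<in>gV G. Q v} \<noteq> {}" using PQ(4) by auto
      show "{e\<in>gE G. \<not> P e} \<noteq> {} \<or> {v\<in>gV G. \<not> Q v} \<noteq> {}" using PQ(3) by auto
      show "tgt G ` (gI G \<inter> {e\<in>gE G. P e}) \<subseteq> {v\<in>gV G. Q v}"
        "tgt G ` (gI G \<inter> {e\<in>gE G. \<not> P e}) \<subseteq> {v\<in>gV G. \<not> Q v}"
        using PQ(1) V(1) by auto
      show "src G ` (gO G \<inter> {e\<in>gE G. P e}) \<subseteq> {v\<in>gV G. Q v}"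
        "src G ` (gO G \<inter> {e\<in>gE G. \<not> P e}) \<subseteq> {v\<in>gV G. \<not> Q v}"
        using PQ(2) V(2) by auto
    qed auto
    then show "\<exists>E1 E2 V1 V2. ?split E1 E2 V1 V2" by - (rule exI)+
  qed
  then show ?thesis unfolding connected_graph_def by (simp only: True dg simp_thms)
next
  case False
  then show ?thesis unfolding connected_graph_def by blast
qed

lemma connected_graph_directed: "connected_graph G \<Longrightarrow> directed_graph G"
  by (simp add: connected_graph_def)

text \<open>A disjoint decomposition amounts to two-colourings \<open>P\<close> of the edges and
  \<open>Q\<close> of the vertices that agree along the flags; connectedness makes them constant.
  Uses of connectedness below come down to a choice of \<open>P\<close> and
  \<open>Q\<close>.\<close>

lemma connected_graph_colour:
  assumes "connected_graph G"
    and "\<And>e. e \<in> gI G \<Longrightarrow> P e = Q (tgt G e)" "\<And>e. e \<in> gO G \<Longrightarrow> P e = Q (src G e)"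
  shows "(\<forall>e\<in>gE G. P e) \<and> (\<forall>v\<in>gV G. Q v) \<or> (\<forall>e\<in>gE G. \<not> P e) \<and> (\<forall>v\<in>gV G. \<not> Q v)"
  using assms unfolding connected_graph_iff by blast

lemma directed_graphD:
  assumes "directed_graph G"
  shows "finite (gE G)" "finite (gV G)" "gI G \<subseteq> gE G" "gO G \<subseteq> gE G"
    "\<And>e. e \<in> gI G \<Longrightarrow> tgt G e \<in> gV G" "\<And>e. e \<in> gO G \<Longrightarrow> src G e \<in> gV G"
    "gI G - gO G \<subseteq> gin G" "gin G \<subseteq> gE G - gO G"
    "gO G - gI G \<subseteq> gout G" "gout G \<subseteq> gE G - gI G" "gin G - gI G = gout G - gO G"
    "finite (gin G)" "finite (gout G)"
proof -
  show *: "finite (gE G)" "finite (gV G)" "gI G \<subseteq> gE G" "gO G \<subseteq> gE G"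
    "\<And>e. e \<in> gI G \<Longrightarrow> tgt G e \<in> gV G" "\<And>e. e \<in> gO G \<Longrightarrow> src G e \<in> gV G"
    "gI G - gO G \<subseteq> gin G" "gin G \<subseteq> gE G - gO G"
    "gO G - gI G \<subseteq> gout G" "gout G \<subseteq> gE G - gI G" "gin G - gI G = gout G - gO G"
    using assms by (auto simp: directed_graph_def)
  show "finite (gin G)" "finite (gout G)"
    using * by (meson finite_subset Diff_subset order_trans)+
qed

text \<open>Without vertices there are no flags, so singling out one edge is an admissible colouring
  and a second edge cannot exist. The boundary then leaves just two cases, the edge graph and the
  nodeless loop.\<close>

lemma connected_graph_no_vertices:
  assumes c: "connected_graph G" and V: "gV G = {}"
  obtains e where "gE G = {e}" "gI G = {}" "gO G = {}" "gout G = gin G"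
proof -
  note d = directed_graphD[OF connected_graph_directed[OF c]]
  have I: "gI G = {}" "gO G = {}" using d(5,6) V by auto
  have "gE G \<noteq> {}" using c V by (simp add: connected_graph_def)
  then obtain e where e: "e \<in> gE G" by blast
  have "\<forall>x\<in>gE G. x = e"
    using connected_graph_colour[OF c, of "\<lambda>x. x = e" "\<lambda>_. True"] I e by auto
  then have "gE G = {e}" using e by blast
  then show thesis using that I d(11) by blast
qed

text \<open>Give all vertices one colour and the same colour to the edges touching a vertex; an edge
  touching none would have the other colour. The inclusions in \<open>directed_graph\<close> then
  fix the boundary.\<close>

lemma connected_graph_vertices:
  assumes c: "connected_graph G" and V: "gV G \<noteq> {}"
  shows "gE G = gI G \<union> gO G" "gin G = gI G - gO G" "gout G = gO G - gI G"
proof -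
  note d = directed_graphD[OF connected_graph_directed[OF c]]
  have "\<forall>x\<in>gE G. x \<in> gI G \<union> gO G"
    using connected_graph_colour[OF c, of "\<lambda>x. x \<in> gI G \<union> gO G" "\<lambda>_. True"] V by auto
  then show E: "gE G = gI G \<union> gO G" using d(3,4) by blast
  show "gin G = gI G - gO G" "gout G = gO G - gI G" using E d(7-10) by auto
qed

text \<open>Together with \<open>edge_graph_iff\<close> this reduces both exceptional graphs to the
  vertices and the inputs, so that they can be recognised from the invariants of an
  embedding.\<close>

lemma nodeless_loop_iff:
  "connected_graph G \<Longrightarrow> nodeless_loop G \<longleftrightarrow> gV G = {} \<and> gin G = {}"
  by (rule iffI, simp add: nodeless_loop_def)
    (auto simp: nodeless_loop_def connected_graph_directed elim: connected_graph_no_vertices)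

lemma edge_graph_iff:
  assumes c: "connected_graph G"
  shows "edge_graph G \<longleftrightarrow> gV G = {} \<and> gin G \<noteq> {}"
proof
  show "edge_graph G \<Longrightarrow> gV G = {} \<and> gin G \<noteq> {}" by (auto simp: edge_graph_def)
next
  assume *: "gV G = {} \<and> gin G \<noteq> {}"
  then obtain e where e: "gE G = {e}" "gI G = {}" "gO G = {}" "gout G = gin G"
    using connected_graph_no_vertices[OF c] by metis
  have "gin G = {e}" using * e directed_graphD(8)[OF connected_graph_directed[OF c]] by auto
  then show "edge_graph G"
    using e * connected_graph_directed[OF c] by (auto simp: edge_graph_def)
qed

lemma connected_graph_in_out:
  assumes c: "connected_graph G" and n: "\<not> nodeless_loop G"
  shows "gin G = gE G - gO G" "gout G = gE G - gI G"
proof -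
  note d = directed_graphD[OF connected_graph_directed[OF c]]
  have "gin G = gE G - gO G \<and> gout G = gE G - gI G"
  proof (cases "gV G = {}")
    case True
    then have "gin G \<noteq> {}" using n nodeless_loop_iff[OF c] by blast
    moreover obtain e where "gE G = {e}" "gI G = {}" "gO G = {}" "gout G = gin G"
      using connected_graph_no_vertices[OF c True] .
    ultimately show ?thesis using d(8) by auto
  next
    case False
    then show ?thesis using connected_graph_vertices[OF c False] by blast
  qed
  then show "gin G = gE G - gO G" "gout G = gE G - gI G" by auto
qed

lemma edge_graph_connected: "edge_graph G \<Longrightarrow> connected_graph G"
  unfolding connected_graph_iff edge_graph_def by auto

text \<open>A square is a pullback exactly if it is bijective on fibres. This turns the definition
  of local maps into bijections between the inputs, and between the outputs, at corresponding
  vertices.\<close>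

lemma pullback_iff:
  assumes "t \<in> I \<rightarrow> V"
  shows "bij_betw (\<lambda>e. (f e, t e)) I {(i, v) \<in> I' \<times> V. t' i = g v} \<longleftrightarrow>
    (\<forall>v\<in>V. bij_betw f {e \<in> I. t e = v} {i \<in> I'. t' i = g v})" (is "?L \<longleftrightarrow> ?R")
proof
  assume L: ?L
  then have inj: "inj_on (\<lambda>e. (f e, t e)) I"
    and im: "(\<lambda>e. (f e, t e)) ` I = {(i, v) \<in> I' \<times> V. t' i = g v}" by (auto simp: bij_betw_def)
  show ?R
  proof
    fix v assume v: "v \<in> V"
    have "inj_on f {e \<in> I. t e = v}" using inj by (auto simp: inj_on_def)
    moreover have "f ` {e \<in> I. t e = v} = {i \<in> I'. t' i = g v}"
    proof (intro equalityI subsetI)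
      fix i assume "i \<in> f ` {e \<in> I. t e = v}"
      then obtain e where e: "e \<in> I" "t e = v" "i = f e" by blast
      then have "(i, v) \<in> {(i, v) \<in> I' \<times> V. t' i = g v}" unfolding im[symmetric] by blast
      then show "i \<in> {i \<in> I'. t' i = g v}" by simp
    next
      fix i assume "i \<in> {i \<in> I'. t' i = g v}"
      then have "(i, v) \<in> (\<lambda>e. (f e, t e)) ` I" unfolding im using v by simp
      then show "i \<in> f ` {e \<in> I. t e = v}" by blast
    qed
    ultimately show "bij_betw f {e \<in> I. t e = v} {i \<in> I'. t' i = g v}" by (simp add: bij_betw_def)
  qed
next
  assume R: ?R
  have inj: "\<And>v. v \<in> V \<Longrightarrow> inj_on f {e \<in> I. t e = v}"
    and im: "\<And>v. v \<in> V \<Longrightarrow> f ` {e \<in> I. t e = v} = {i \<in> I'. t' i = g v}"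
    using R by (auto simp: bij_betw_def)
  have "inj_on (\<lambda>e. (f e, t e)) I" using inj assms unfolding inj_on_def by blast
  moreover have "(\<lambda>e. (f e, t e)) ` I \<subseteq> {(i, v) \<in> I' \<times> V. t' i = g v}"
  proof
    fix p assume "p \<in> (\<lambda>e. (f e, t e)) ` I"
    then obtain e where e: "e \<in> I" "p = (f e, t e)" by blast
    then have "f e \<in> {i \<in> I'. t' i = g (t e)}" using im[of "t e"] assms by blast
    then show "p \<in> {(i, v) \<in> I' \<times> V. t' i = g v}" using e assms by auto
  qed
  moreover have "{(i, v) \<in> I' \<times> V. t' i = g v} \<subseteq> (\<lambda>e. (f e, t e)) ` I"
  proof (clarify)
    fix i v assume "i \<in> I'" "v \<in> V" "t' i = g v"
    then have "i \<in> f ` {e \<in> I. t e = v}" using im by simp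
    then show "(i, v) \<in> (\<lambda>e. (f e, t e)) ` I" by auto
  qed
  ultimately show ?L unfolding bij_betw_def by blast
qed

lemma local_map_iff:
  "local_map H G f \<longleftrightarrow> directed_graph H \<and> directed_graph G \<and>
     fst f \<in> gE H \<rightarrow>\<^sub>E gE G \<and> snd f \<in> gV H \<rightarrow>\<^sub>E gV G \<and>
     (\<forall>v\<in>gV H. bij_betw (fst f) (in_at H v) (in_at G (snd f v))) \<and>
     (\<forall>v\<in>gV H. bij_betw (fst f) (out_at H v) (out_at G (snd f v)))"
proof (cases "directed_graph H")
  case True
  then have "tgt H \<in> gI H \<rightarrow> gV H" "src H \<in> gO H \<rightarrow> gV H"
    by (auto simp: directed_graph_def)
  then show ?thesis unfolding local_map_def in_at_def out_at_def by (simp only: pullback_iff)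
next
  case False
  then show ?thesis unfolding local_map_def by blast
qed

lemma local_mapD:
  assumes "local_map H G f"
  shows "directed_graph H" "directed_graph G"
    "\<And>e. e \<in> gE H \<Longrightarrow> fst f e \<in> gE G" "\<And>v. v \<in> gV H \<Longrightarrow> snd f v \<in> gV G"
    "fst f \<in> extensional (gE H)" "snd f \<in> extensional (gV H)"
    "\<And>v. v \<in> gV H \<Longrightarrow> bij_betw (fst f) (in_at H v) (in_at G (snd f v))"
    "\<And>v. v \<in> gV H \<Longrightarrow> bij_betw (fst f) (out_at H v) (out_at G (snd f v))"
  using assms by (auto simp: local_map_iff PiE_iff)

lemma local_map_tgt:
  assumes f: "local_map H G f" and e: "e \<in> gI H"
  shows "fst f e \<in> gI G" "tgt G (fst f e) = snd f (tgt H e)"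
proof -
  have "tgt H e \<in> gV H" using directed_graphD(5)[OF local_mapD(1)[OF f] e] .
  moreover have "e \<in> in_at H (tgt H e)" using e by (simp add: in_at_def)
  ultimately have "fst f e \<in> in_at G (snd f (tgt H e))"
    using local_mapD(7)[OF f] by (meson bij_betwE)
  then show "fst f e \<in> gI G" "tgt G (fst f e) = snd f (tgt H e)" by (auto simp: in_at_def)
qed

lemma local_map_src:
  assumes f: "local_map H G f" and e: "e \<in> gO H"
  shows "fst f e \<in> gO G" "src G (fst f e) = snd f (src H e)"
proof -
  have "src H e \<in> gV H" using directed_graphD(6)[OF local_mapD(1)[OF f] e] .
  moreover have "e \<in> out_at H (src H e)" using e by (simp add: out_at_def)
  ultimately have "fst f e \<in> out_at G (snd f (src H e))"
    using local_mapD(8)[OF f] by (meson bij_betwE)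
  then show "fst f e \<in> gO G" "src G (fst f e) = snd f (src H e)" by (auto simp: out_at_def)
qed

lemma gcomp_apply [simp]:
  "e \<in> gE H \<Longrightarrow> fst (gcomp H g f) e = fst g (fst f e)"
  "v \<in> gV H \<Longrightarrow> snd (gcomp H g f) v = snd g (snd f v)"
  by (simp_all add: gcomp_def compose_def)

lemma in_at_subset: "directed_graph H \<Longrightarrow> in_at H v \<subseteq> gE H"
  and out_at_subset: "directed_graph H \<Longrightarrow> out_at H v \<subseteq> gE H"
  by (auto simp: in_at_def out_at_def directed_graph_def)

lemma local_map_gcomp:
  assumes f: "local_map H K f" and g: "local_map K G g"
  shows "local_map H G (gcomp H g f)"
proof -
  note F = local_mapD[OF f] and G = local_mapD[OF g]
  have "fst (gcomp H g f) \<in> gE H \<rightarrow>\<^sub>E gE G" "snd (gcomp H g f) \<in> gV H \<rightarrow>\<^sub>E gV G"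
    using F(3,4) G(3,4) by (auto simp: gcomp_def compose_def)
  moreover have "bij_betw (fst (gcomp H g f)) (in_at H v) (in_at G (snd (gcomp H g f) v))"
    "bij_betw (fst (gcomp H g f)) (out_at H v) (out_at G (snd (gcomp H g f) v))"
    if v: "v \<in> gV H" for v
  proof -
    have "bij_betw (fst g \<circ> fst f) (in_at H v) (in_at G (snd g (snd f v)))"
      using bij_betw_trans[OF F(7)[OF v] G(7)[OF F(4)[OF v]]] .
    moreover have "fst (gcomp H g f) e = (fst g \<circ> fst f) e" if "e \<in> in_at H v" for e
      using that in_at_subset[OF F(1), of v] by (simp add: subset_iff)
    ultimately show "bij_betw (fst (gcomp H g f)) (in_at H v) (in_at G (snd (gcomp H g f) v))"
      unfolding gcomp_apply(2)[OF v] by (simp cong: bij_betw_cong)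
    have "bij_betw (fst g \<circ> fst f) (out_at H v) (out_at G (snd g (snd f v)))"
      using bij_betw_trans[OF F(8)[OF v] G(8)[OF F(4)[OF v]]] .
    moreover have "fst (gcomp H g f) e = (fst g \<circ> fst f) e" if "e \<in> out_at H v" for e
      using that out_at_subset[OF F(1), of v] by (simp add: subset_iff)
    ultimately show "bij_betw (fst (gcomp H g f)) (out_at H v) (out_at G (snd (gcomp H g f) v))"
      unfolding gcomp_apply(2)[OF v] by (simp cong: bij_betw_cong)
  qed
  ultimately show ?thesis using F(1) G(2) by (simp add: local_map_iff)
qed

lemma gmap_eqI:
  assumes "fst f \<in> extensional (gE H)" "fst g \<in> extensional (gE H)"
    "snd f \<in> extensional (gV H)" "snd g \<in> extensional (gV H)"
    "\<And>e. e \<in> gE H \<Longrightarrow> fst f e = fst g e" "\<And>v. v \<in> gV H \<Longrightarrow> snd f v = snd g v"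
  shows "f = g"
  using assms by (meson extensionalityI prod_eqI)

lemma local_map_eqI:
  assumes "local_map H G f" "local_map H G' g"
    "\<And>e. e \<in> gE H \<Longrightarrow> fst f e = fst g e" "\<And>v. v \<in> gV H \<Longrightarrow> snd f v = snd g v"
  shows "f = g"
  using gmap_eqI[OF local_mapD(5)[OF assms(1)] local_mapD(5)[OF assms(2)]
    local_mapD(6)[OF assms(1)] local_mapD(6)[OF assms(2)]] assms(3,4) by blast

lemma embeddingD:
  assumes "embedding H G f"
  shows "connected_graph H" "connected_graph G" "local_map H G f" "inj_on (snd f) (gV H)"
    "nodeless_loop H \<Longrightarrow> nodeless_loop G"
  using assms by (auto simp: embedding_def)

lemma embedding_gcomp:
  assumes f: "embedding H K f" and g: "embedding K G g"
  shows "embedding H G (gcomp H g f)"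
proof -
  note F = embeddingD[OF f] and G = embeddingD[OF g]
  have "inj_on (snd (gcomp H g f)) (gV H)"
    using F(4) G(4) local_mapD(4)[OF F(3)] by (simp add: inj_on_def)
  then show ?thesis using F G local_map_gcomp[OF F(3) G(3)] by (auto simp: embedding_def)
qed

lemma graph_isoD:
  assumes "graph_iso H K z"
  shows "local_map H K z" "bij_betw (fst z) (gE H) (gE K)" "bij_betw (snd z) (gV H) (gV K)"
    "fst z ` gI H = gI K" "fst z ` gO H = gO K" "fst z ` gin H = gin K" "fst z ` gout H = gout K"
  using assms by (auto simp: graph_iso_def)

text \<open>A colouring of \<open>H\<close> is carried to \<open>K\<close> along the inverse
  bijections; it stays admissible because every flag of \<open>K\<close> is the image of a flag of
  \<open>H\<close>.\<close>

lemma graph_iso_connected: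
  assumes z: "graph_iso H K z" and c: "connected_graph K"
  shows "connected_graph H"
  unfolding connected_graph_iff
proof (intro conjI allI impI)
  note Z = graph_isoD[OF z]
  show dH: "directed_graph H" using local_mapD(1)[OF Z(1)] .
  show "gE H \<noteq> {} \<or> gV H \<noteq> {}" using Z(2,3) c by (auto simp: bij_betw_def connected_graph_def)
  fix P :: "_ \<Rightarrow> bool" and Q assume PQ: "\<forall>e\<in>gI H. P e = Q (tgt H e)" "\<forall>e\<in>gO H. P e = Q (src H e)"
  define e' where "e' = inv_into (gE H) (fst z)"
  define v' where "v' = inv_into (gV H) (snd z)"
  have e': "e' (fst z e) = e" if "e \<in> gE H" for e
    using that Z(2) by (auto simp: e'_def bij_betw_def)
  have v': "v' (snd z v) = v" if "v \<in> gV H" for v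
    using that Z(3) by (auto simp: v'_def bij_betw_def)
  have zE: "fst z e \<in> gE K" if "e \<in> gE H" for e using Z(2) that by (rule bij_betwE[THEN bspec])
  have zV: "snd z v \<in> gV K" if "v \<in> gV H" for v using Z(3) that by (rule bij_betwE[THEN bspec])
  note d = directed_graphD[OF dH]
  have tgt: "P (e' e) = Q (v' (tgt K e))" if e: "e \<in> gI K" for e
  proof -
    obtain x where x: "x \<in> gI H" "e = fst z x" using e Z(4) by blast
    then show ?thesis
      using PQ(1) e'[of x] v'[OF d(5)[OF x(1)]] local_map_tgt(2)[OF Z(1) x(1)] d(3) by auto
  qed
  have src: "P (e' e) = Q (v' (src K e))" if e: "e \<in> gO K" for e
  proof -
    obtain x where x: "x \<in> gO H" "e = fst z x" using e Z(5) by blast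
    then show ?thesis
      using PQ(2) e'[of x] v'[OF d(6)[OF x(1)]] local_map_src(2)[OF Z(1) x(1)] d(4) by auto
  qed
  have "(\<forall>e\<in>gE K. P (e' e)) \<and> (\<forall>v\<in>gV K. Q (v' v)) \<or>
      (\<forall>e\<in>gE K. \<not> P (e' e)) \<and> (\<forall>v\<in>gV K. \<not> Q (v' v))"
    by (rule connected_graph_colour[OF c, of "\<lambda>e. P (e' e)" "\<lambda>v. Q (v' v)"]) (fact tgt src)+
  moreover have "P e = P (e' (fst z e))" if "e \<in> gE H" for e using e' that by simp
  moreover have "Q v = Q (v' (snd z v))" if "v \<in> gV H" for v using v' that by simp
  ultimately show "(\<forall>e\<in>gE H. P e) \<and> (\<forall>v\<in>gV H. Q v) \<or> (\<forall>e\<in>gE H. \<not> P e) \<and> (\<forall>v\<in>gV H. \<not> Q v)"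
    using zE zV by blast
qed

lemma graph_iso_embedding:
  assumes z: "graph_iso H K z" and c: "connected_graph K"
  shows "embedding H K z"
proof -
  note Z = graph_isoD[OF z]
  have H: "connected_graph H" using graph_iso_connected[OF z c] .
  have "nodeless_loop H \<Longrightarrow> nodeless_loop K"
    using Z(3,6) by (auto simp: nodeless_loop_iff[OF H] nodeless_loop_iff[OF c] bij_betw_def)
  then show ?thesis using Z H c by (auto simp: embedding_def bij_betw_def)
qed

section \<open>Rigidity of embeddings\<close>

text \<open>Cancellation for pullbacks: on each fibre the composite and the second factor are
  bijective, hence so is the first. So a natural map between graphs that are local over
  \<open>G\<close> needs no separate check of the pullback condition.\<close>

lemma local_map_cancel:
  assumes h: "local_map H G h" and k: "local_map K G k"
    and j: "fst j \<in> gE H \<rightarrow>\<^sub>E gE K" "snd j \<in> gV H \<rightarrow>\<^sub>E gV K"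
    and tgt: "\<And>e. e \<in> gI H \<Longrightarrow> fst j e \<in> gI K \<and> tgt K (fst j e) = snd j (tgt H e)"
    and src: "\<And>e. e \<in> gO H \<Longrightarrow> fst j e \<in> gO K \<and> src K (fst j e) = snd j (src H e)"
    and kj: "\<And>e. e \<in> gE H \<Longrightarrow> fst k (fst j e) = fst h e"
      "\<And>v. v \<in> gV H \<Longrightarrow> snd k (snd j v) = snd h v"
  shows "local_map H K j"
proof -
  note dH = local_mapD(1)[OF h]
  have "bij_betw (fst j) (in_at H v) (in_at K (snd j v))"
    "bij_betw (fst j) (out_at H v) (out_at K (snd j v))" if v: "v \<in> gV H" for v
  proof -
    have w: "snd j v \<in> gV K" using j(2) v by blast
    have "bij_betw (fst k \<circ> fst j) (in_at H v) (in_at G (snd k (snd j v)))"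
      using local_mapD(7)[OF h v] kj(1) in_at_subset[OF dH, of v] unfolding kj(2)[OF v]
      by (subst bij_betw_cong[where g = "fst h"]) (auto simp: subset_iff)
    then show "bij_betw (fst j) (in_at H v) (in_at K (snd j v))"
      by (subst bij_betw_comp_iff2[OF local_mapD(7)[OF k w]]) (auto simp: in_at_def tgt)
    have "bij_betw (fst k \<circ> fst j) (out_at H v) (out_at G (snd k (snd j v)))"
      using local_mapD(8)[OF h v] kj(1) out_at_subset[OF dH, of v] unfolding kj(2)[OF v]
      by (subst bij_betw_cong[where g = "fst h"]) (auto simp: subset_iff)
    then show "bij_betw (fst j) (out_at H v) (out_at K (snd j v))"
      by (subst bij_betw_comp_iff2[OF local_mapD(8)[OF k w]]) (auto simp: out_at_def src)
  qed
  then show ?thesis using dH local_mapD(1)[OF k] j by (simp add: local_map_iff)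
qed

text \<open>Fibres are mapped bijectively and vertices injectively, hence so are the flags. The same
  cannot be said of \<open>gE H\<close>: an edge of \<open>G\<close> that gets cut appears in
  \<open>H\<close> as an input and as an output with the same image.\<close>

lemma embedding_image_in:
  assumes h: "embedding H G h"
  shows "inj_on (fst h) (gI H)" "fst h ` gI H = {i \<in> gI G. tgt G i \<in> snd h ` gV H}"
proof -
  note l = embeddingD(3)[OF h] and i = embeddingD(4)[OF h]
  note d = directed_graphD[OF local_mapD(1)[OF l]]
  show "inj_on (fst h) (gI H)"
  proof (rule inj_onI)
    fix x y assume x: "x \<in> gI H" and y: "y \<in> gI H" and xy: "fst h x = fst h y"
    have "snd h (tgt H x) = snd h (tgt H y)"
      using local_map_tgt(2)[OF l x] local_map_tgt(2)[OF l y] xy by simp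
    then have "tgt H x = tgt H y" using inj_onD[OF i _ d(5)[OF x] d(5)[OF y]] by blast
    then have "x \<in> in_at H (tgt H x)" "y \<in> in_at H (tgt H x)" using x y by (simp_all add: in_at_def)
    then show "x = y"
      using local_mapD(7)[OF l d(5)[OF x]] xy by (auto simp: bij_betw_def inj_on_def)
  qed
  show "fst h ` gI H = {i \<in> gI G. tgt G i \<in> snd h ` gV H}"
  proof (intro equalityI subsetI)
    fix i assume "i \<in> fst h ` gI H"
    then show "i \<in> {i \<in> gI G. tgt G i \<in> snd h ` gV H}"
      using local_map_tgt[OF l] d(5) by auto
  next
    fix i assume "i \<in> {i \<in> gI G. tgt G i \<in> snd h ` gV H}"
    then obtain v where v: "v \<in> gV H" "i \<in> in_at G (snd h v)" by (auto simp: in_at_def)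
    then have "i \<in> fst h ` in_at H v" using local_mapD(7)[OF l v(1)] by (simp add: bij_betw_def)
    then show "i \<in> fst h ` gI H" by (auto simp: in_at_def)
  qed
qed

lemma embedding_image_out:
  assumes h: "embedding H G h"
  shows "inj_on (fst h) (gO H)" "fst h ` gO H = {i \<in> gO G. src G i \<in> snd h ` gV H}"
proof -
  note l = embeddingD(3)[OF h] and i = embeddingD(4)[OF h]
  note d = directed_graphD[OF local_mapD(1)[OF l]]
  show "inj_on (fst h) (gO H)"
  proof (rule inj_onI)
    fix x y assume x: "x \<in> gO H" and y: "y \<in> gO H" and xy: "fst h x = fst h y"
    have "snd h (src H x) = snd h (src H y)"
      using local_map_src(2)[OF l x] local_map_src(2)[OF l y] xy by simp
    then have "src H x = src H y" using inj_onD[OF i _ d(6)[OF x] d(6)[OF y]] by blast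
    then have "x \<in> out_at H (src H x)" "y \<in> out_at H (src H x)" using x y by (simp_all add: out_at_def)
    then show "x = y"
      using local_mapD(8)[OF l d(6)[OF x]] xy by (auto simp: bij_betw_def inj_on_def)
  qed
  show "fst h ` gO H = {i \<in> gO G. src G i \<in> snd h ` gV H}"
  proof (intro equalityI subsetI)
    fix i assume "i \<in> fst h ` gO H"
    then show "i \<in> {i \<in> gO G. src G i \<in> snd h ` gV H}"
      using local_map_src[OF l] d(6) by auto
  next
    fix i assume "i \<in> {i \<in> gO G. src G i \<in> snd h ` gV H}"
    then obtain v where v: "v \<in> gV H" "i \<in> out_at G (snd h v)" by (auto simp: out_at_def)
    then have "i \<in> fst h ` out_at H v" using local_mapD(8)[OF l v(1)] by (simp add: bij_betw_def)
    then show "i \<in> fst h ` gO H" by (auto simp: out_at_def)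
  qed
qed

lemma embedding_inj_gin:
  assumes h: "embedding H G h"
  shows "inj_on (fst h) (gin H)" "inj_on (fst h) (gout H)"
proof -
  note c = embeddingD(1)[OF h]
  note d = directed_graphD[OF connected_graph_directed[OF c]]
  have "inj_on (fst h) (gin H) \<and> inj_on (fst h) (gout H)"
  proof (cases "gV H = {}")
    case True
    obtain e where "gE H = {e}" using connected_graph_no_vertices[OF c True] .
    then have "inj_on (fst h) (gE H)" by simp
    then show ?thesis using d(8,10) by (auto elim: inj_on_subset)
  next
    case False
    then show ?thesis
      using connected_graph_vertices[OF c False] embedding_image_in(1)[OF h]
        embedding_image_out(1)[OF h] by (auto intro: inj_on_diff)
  qed
  then show "inj_on (fst h) (gin H)" "inj_on (fst h) (gout H)" by auto
qed

text \<open>In the application \<open>I\<close> and \<open>J\<close> are the flags of a graph, and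
  \<open>I \<inter> J\<close> consists of its internal edges. The bijections on \<open>I\<close> and
  on \<open>J\<close> are forced by \<open>h\<close> and \<open>k\<close>; the last image condition
  makes them agree on the overlap and nowhere else.\<close>

lemma glue_bijections:
  assumes h: "inj_on h I" "inj_on h J" and k: "inj_on k I'" "inj_on k J'"
    and im: "h ` I = k ` I'" "h ` J = k ` J'" "h ` (I - J) = k ` (I' - J')"
  obtains z where "bij_betw z (I \<union> J) (I' \<union> J')" "z ` I = I'" "z ` J = J'"
    "\<And>e. e \<in> I \<union> J \<Longrightarrow> k (z e) = h e"
proof -
  define zI where "zI = (\<lambda>e. inv_into I' k (h e))"
  define zJ where "zJ = (\<lambda>e. inv_into J' k (h e))"
  define z where "z = (\<lambda>e. if e \<in> I then zI e else zJ e)"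
  have zI: "zI e \<in> I'" "k (zI e) = h e" if "e \<in> I" for e
  proof -
    have "h e \<in> k ` I'" using im(1) that by blast
    then show "zI e \<in> I'" "k (zI e) = h e" by (simp_all add: zI_def inv_into_into f_inv_into_f)
  qed
  have zJ: "zJ e \<in> J'" "k (zJ e) = h e" if "e \<in> J" for e
  proof -
    have "h e \<in> k ` J'" using im(2) that by blast
    then show "zJ e \<in> J'" "k (zJ e) = h e" by (simp_all add: zJ_def inv_into_into f_inv_into_f)
  qed
  \<comment> \<open>Internal edges correspond to internal edges; this is what the condition on
    \<open>I - J\<close> is for.\<close>
  have IJ: "e \<in> I - J \<longleftrightarrow> zI e \<in> I' - J'" if e: "e \<in> I" for e
  proof
    assume "e \<in> I - J"
    then have "h e \<in> k ` (I' - J')" using im(3) by blast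
    then show "zI e \<in> I' - J'" using zI[OF e] k(1) by (metis DiffD1 imageE inj_onD)
  next
    assume "zI e \<in> I' - J'"
    then have "h e \<in> h ` (I - J)" using im(3) zI(2)[OF e] by (metis image_eqI)
    then show "e \<in> I - J" using e h(1) by (metis DiffD1 imageE inj_onD)
  qed
  have z_I: "z e = zI e" if "e \<in> I" for e using that by (simp add: z_def)
  have z_J: "z e = zJ e" if e: "e \<in> J" for e
  proof (cases "e \<in> I")
    case True
    then have "zI e \<in> J'" using IJ[OF True] zI(1)[OF True] e by blast
    moreover have "k (zI e) = k (zJ e)" using zI(2)[OF True] zJ(2)[OF e] by simp
    ultimately show ?thesis using k(2) zJ(1)[OF e] z_I[OF True] by (metis inj_onD)
  qed (simp add: z_def)
  have kz: "k (z e) = h e" if "e \<in> I \<union> J" for e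
    using that z_I z_J zI(2) zJ(2) by (metis UnE)
  have zI_im: "z ` I = I'"
  proof
    show "z ` I \<subseteq> I'" using z_I zI(1) by auto
    show "I' \<subseteq> z ` I"
    proof
      fix y assume y: "y \<in> I'"
      then obtain e where e: "e \<in> I" "k y = h e" using im(1) by (metis image_iff)
      then have "y = zI e" using zI[OF e(1)] k(1) y by (metis inj_onD)
      then show "y \<in> z ` I" using e(1) z_I by (metis imageI)
    qed
  qed
  have zJ_im: "z ` J = J'"
  proof
    show "z ` J \<subseteq> J'" using z_J zJ(1) by auto
    show "J' \<subseteq> z ` J"
    proof
      fix y assume y: "y \<in> J'"
      then obtain e where e: "e \<in> J" "k y = h e" using im(2) by (metis image_iff)
      then have "y = zJ e" using zJ[OF e(1)] k(2) y by (metis inj_onD)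
      then show "y \<in> z ` J" using e(1) z_J by (metis imageI)
    qed
  qed
  have "inj_on z (I \<union> J)"
  proof (rule inj_onI)
    fix x y assume x: "x \<in> I \<union> J" and y: "y \<in> I \<union> J" and xy: "z x = z y"
    have hh: "h x = h y" using kz[OF x] kz[OF y] xy by simp
    \<comment> \<open>If an element of \<open>I\<close> collides with one of \<open>J\<close>, their
      common image is in \<open>I' \<inter> J'\<close>, so both lie in \<open>J\<close>, where
      \<open>h\<close> is injective.\<close>
    have J: "e \<in> J" if "e \<in> I" "e' \<in> J" "z e = z e'" for e e'
      using IJ[OF that(1)] that z_I z_J zJ(1) by auto
    consider "x \<in> I" "y \<in> I" | "x \<in> J" "y \<in> J" using x y xy J by (metis UnE)
    then show "x = y" using hh h by cases (auto dest: inj_onD)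
  qed
  moreover have "z ` (I \<union> J) = I' \<union> J'" using zI_im zJ_im by (simp add: image_Un)
  ultimately show thesis using that zI_im zJ_im kz by (simp add: bij_betw_def)
qed

lemma bij_betw_image_Diff:
  "bij_betw z (A \<union> B) C \<Longrightarrow> z ` (A - B) = z ` A - z ` B"
  by (auto simp: bij_betw_def inj_on_def)

text \<open>With vertices present, the boundary tells which edges between them have been cut;
  without vertices it tells the edge from the nodeless loop.\<close>

lemma embedding_unique:
  assumes h: "embedding H G h" and k: "embedding K G k"
    and verts: "snd h ` gV H = snd k ` gV K" and "in": "fst h ` gin H = fst k ` gin K"
  obtains z where "graph_iso H K z" "h = gcomp H k z"
proof -
  note ch = embeddingD(1)[OF h] and ck = embeddingD(1)[OF k]
  note lh = embeddingD(3)[OF h] and lk = embeddingD(3)[OF k]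
  note dH = directed_graphD[OF connected_graph_directed[OF ch]]
  note dK = directed_graphD[OF connected_graph_directed[OF ck]]
  show thesis
  proof (cases "gV H = {}")
    case True
    then have True': "gV K = {}" using verts by auto
    obtain e where e: "gE H = {e}" "gI H = {}" "gO H = {}" "gout H = gin H"
      using connected_graph_no_vertices[OF ch True] .
    obtain e' where e': "gE K = {e'}" "gI K = {}" "gO K = {}" "gout K = gin K"
      using connected_graph_no_vertices[OF ck True'] .
    define z where "z = ((\<lambda>x\<in>gE H. e'), (\<lambda>v\<in>gV H. undefined) :: 'b \<Rightarrow> 'f)"
    have inH: "gin H \<subseteq> {e}" and inK: "gin K \<subseteq> {e'}" using e e' dH(8) dK(8) by auto
    \<comment> \<open>If \<open>H\<close> is a nodeless loop, then so is \<open>G\<close>, which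
      leaves a single possible value. Otherwise the edge is an input and its image is known.\<close>
    have he: "fst h e = fst k e'"
    proof (cases "gin H = {}")
      case True
      then have "nodeless_loop G" using embeddingD(5)[OF h] nodeless_loop_iff[OF ch] \<open>gV H = {}\<close> by blast
      then show ?thesis using local_mapD(3)[OF lh, of e] local_mapD(3)[OF lk, of e'] e e'
        by (auto simp: nodeless_loop_def)
    next
      case False
      then have "gin H = {e}" "gin K = {e'}" using "in" inH inK by auto
      then show ?thesis using "in" by simp
    qed
    have inz: "fst z ` gin H = gin K"
    proof (cases "gin H = {}")
      case True
      then show ?thesis using "in" by auto
    next
      case False
      then have "gin H = {e}" "gin K = {e'}" using "in" inH inK by auto
      then show ?thesis using e by (simp add: z_def)
    qed
    have "local_map H K z"
      using ch ck e e' True by (simp add: local_map_iff connected_graph_directed z_def)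
    then have "graph_iso H K z"
      using e e' True True' inz by (simp add: graph_iso_def z_def bij_betw_def)
    moreover have "h = gcomp H k z"
      using he e(1) True local_mapD(5,6)[OF lh] 
      by (intro gmap_eqI) (auto simp: gcomp_def z_def compose_def)
    ultimately show ?thesis using that by blast
  next
    case False
    then have False': "gV K \<noteq> {}" using verts by auto
    note sH = connected_graph_vertices[OF ch False] and sK = connected_graph_vertices[OF ck False']
    note iH = embedding_image_in[OF h] embedding_image_out[OF h]
    note iK = embedding_image_in[OF k] embedding_image_out[OF k]
    \<comment> \<open>The first two equations depend on the vertices alone. The third uses the
      inputs, as \<open>gin\<close> is \<open>gI - gO\<close> when there are vertices.\<close>
    have "fst h ` gI H = fst k ` gI K" "fst h ` gO H = fst k ` gO K"
      "fst h ` (gI H - gO H) = fst k ` (gI K - gO K)"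
      using iH(2,4) iK(2,4) verts "in" sH sK by simp_all
    then obtain z0 where z0: "bij_betw z0 (gE H) (gE K)" "z0 ` gI H = gI K" "z0 ` gO H = gO K"
      "\<And>e. e \<in> gE H \<Longrightarrow> fst k (z0 e) = fst h e"
      using glue_bijections[OF iH(1,3) iK(1,3)] sH(1) sK(1) by metis
    define z1 where "z1 = (\<lambda>v. inv_into (gV K) (snd k) (snd h v))"
    have z1: "bij_betw z1 (gV H) (gV K)"
      using bij_betw_trans[of "snd h" "gV H" "snd k ` gV K" "inv_into (gV K) (snd k)" "gV K"]
        embeddingD(4)[OF h] embeddingD(4)[OF k] verts
      by (simp add: z1_def comp_def bij_betw_def inj_on_inv_into)
    have kz1: "snd k (z1 v) = snd h v" if "v \<in> gV H" for v
    proof -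
      have "snd h v \<in> snd k ` gV K" using that verts by blast
      then show ?thesis by (simp add: z1_def f_inv_into_f)
    qed
    have z1_eq: "w = z1 v" if "w \<in> gV K" "v \<in> gV H" "snd k w = snd h v" for v w
      using that embeddingD(4)[OF k] by (simp add: z1_def inv_into_f_eq)
    define z where "z = (restrict z0 (gE H), restrict z1 (gV H))"
    have zE: "fst z e = z0 e" if "e \<in> gE H" for e using that by (simp add: z_def)
    have zV: "snd z v = z1 v" if "v \<in> gV H" for v using that by (simp add: z_def)
    have zI: "fst z ` gI H = gI K" and zO: "fst z ` gO H = gO K"
      using z0(2,3) zE dH(3,4) by (simp_all add: subset_iff cong: image_cong)
    have bE: "bij_betw (fst z) (gE H) (gE K)" and bV: "bij_betw (snd z) (gV H) (gV K)"
      using z0(1) z1 zE zV by (simp_all cong: bij_betw_cong)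
    have "local_map H K z"
    proof (rule local_map_cancel[OF lh lk])
      show "fst z \<in> gE H \<rightarrow>\<^sub>E gE K" "snd z \<in> gV H \<rightarrow>\<^sub>E gV K"
        using z0(1) z1 by (auto simp: z_def bij_betw_def)
      show "fst k (fst z e) = fst h e" if "e \<in> gE H" for e using z0(4) zE that by simp
      show "snd k (snd z v) = snd h v" if "v \<in> gV H" for v using kz1 zV that by simp
      show "fst z e \<in> gI K \<and> tgt K (fst z e) = snd z (tgt H e)" if e: "e \<in> gI H" for e
      proof
        show i: "fst z e \<in> gI K" using zI e by blast
        have eE: "e \<in> gE H" using e dH(3) by blast
        have "snd k (tgt K (fst z e)) = snd h (tgt H e)"
          using local_map_tgt(2)[OF lk i] local_map_tgt(2)[OF lh e] z0(4)[OF eE] zE[OF eE] by simp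
        then show "tgt K (fst z e) = snd z (tgt H e)"
          using z1_eq[OF dK(5)[OF i] dH(5)[OF e]] zV[OF dH(5)[OF e]] by simp
      qed
      show "fst z e \<in> gO K \<and> src K (fst z e) = snd z (src H e)" if e: "e \<in> gO H" for e
      proof
        show i: "fst z e \<in> gO K" using zO e by blast
        have eE: "e \<in> gE H" using e dH(4) by blast
        have "snd k (src K (fst z e)) = snd h (src H e)"
          using local_map_src(2)[OF lk i] local_map_src(2)[OF lh e] z0(4)[OF eE] zE[OF eE] by simp
        then show "src K (fst z e) = snd z (src H e)"
          using z1_eq[OF dK(6)[OF i] dH(6)[OF e]] zV[OF dH(6)[OF e]] by simp
      qed
    qed
    moreover have "fst z ` gin H = gin K" "fst z ` gout H = gout K"
      using bij_betw_image_Diff[of "fst z" "gI H" "gO H"] bij_betw_image_Diff[of "fst z" "gO H" "gI H"]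
        bE sH sK zI zO by (simp_all add: Un_commute)
    ultimately have "graph_iso H K z" using bE bV zI zO by (simp add: graph_iso_def)
    moreover have "h = gcomp H k z"
      using z0(4) kz1 zE zV local_mapD(5,6)[OF lh]
      by (intro gmap_eqI) (auto simp: gcomp_def compose_def)
    ultimately show ?thesis using that by blast
  qed
qed

section \<open>Copies of finite graphs on given infinite types\<close>

lemma finite_inj_infinite:
  assumes "finite A"
  obtains f :: "'a \<Rightarrow> 'b::infinite" where "inj_on f A"
proof -
  obtain B :: "'b set" where "finite B" "card B = card A"
    using infinite_arbitrarily_large[OF infinite_UNIV] by metis
  then obtain f where "bij_betw f A B" using finite_same_card_bij[OF assms] by metis
  then show thesis using that by (auto simp: bij_betw_def)
qed

text \<open>Stars and substituted graphs live on sum, product and set types, while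
  \<open>Emb\<close> only sees graphs on the types of \<open>G\<close>. A copy along arbitrary
  injections of the finite carriers brings them back.\<close>

lemma graph_copy:
  fixes H :: "('a, 'b) dgraph"
  assumes d: "directed_graph H"
  obtains H' :: "('e::infinite, 'v::infinite) dgraph" and z where "graph_iso H' H z"
proof -
  note dH = directed_graphD[OF d]
  obtain p :: "'a \<Rightarrow> 'e" where p: "inj_on p (gE H)" using finite_inj_infinite[OF dH(1)] .
  obtain q :: "'b \<Rightarrow> 'v" where q: "inj_on q (gV H)" using finite_inj_infinite[OF dH(2)] .
  define p' where "p' = inv_into (gE H) p"
  define q' where "q' = inv_into (gV H) q"
  have p': "p' (p e) = e" if "e \<in> gE H" for e using p that by (simp add: p'_def)
  have q': "q' (q v) = v" if "v \<in> gV H" for v using q that by (simp add: q'_def)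
  define H' where "H' = \<lparr>gE = p ` gE H, gI = p ` gI H, gV = q ` gV H, gO = p ` gO H,
    tgt = (\<lambda>e\<in>p ` gI H. q (tgt H (p' e))), src = (\<lambda>e\<in>p ` gO H. q (src H (p' e))),
    gin = p ` gin H, gout = p ` gout H\<rparr>"
  define z where "z = (restrict p' (p ` gE H), restrict q' (q ` gV H))"
  have sub: "gin H \<subseteq> gE H" "gout H \<subseteq> gE H" using dH(8,10) by auto
  have diff: "p ` A - p ` B = p ` (A - B)" if "A \<subseteq> gE H" "B \<subseteq> gE H" for A B
    using p that by (metis inj_on_image_set_diff Diff_subset order_trans)
  have dH': "directed_graph H'"
    unfolding directed_graph_def
  proof (intro conjI)
    show "tgt H' \<in> gI H' \<rightarrow>\<^sub>E gV H'"
      using dH(5) p' subsetD[OF dH(3)] by (auto simp: H'_def)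
    show "src H' \<in> gO H' \<rightarrow>\<^sub>E gV H'"
      using dH(6) p' subsetD[OF dH(4)] by (auto simp: H'_def)
  qed (simp_all add: H'_def diff[OF dH(3,4)] diff[OF dH(4,3)] diff[OF subset_refl dH(4)]
      diff[OF subset_refl dH(3)] diff[OF sub(1) dH(3)] diff[OF sub(2) dH(4)]
      dH(1-4,7-11) image_mono)
  have z: "fst z ` p ` A = A" if "A \<subseteq> gE H" for A
  proof -
    have "(\<lambda>e. fst z (p e)) ` A = (\<lambda>e. e) ` A"
      using that p' by (intro image_cong) (auto simp: z_def)
    then show ?thesis by (simp add: image_image)
  qed
  have tg: "tgt H' (p e) = q (tgt H e)" if "e \<in> gI H" for e
    using that p'[of e] dH(3) by (auto simp: H'_def)
  have sr: "src H' (p e) = q (src H e)" if "e \<in> gO H" for e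
    using that p'[of e] dH(4) by (auto simp: H'_def)
  have inv: "inj_on (fst z) (p ` A)" if "A \<subseteq> gE H" for A
    using p' that by (auto simp: inj_on_def z_def subset_iff)
  have ina: "in_at H' (q v) = p ` in_at H v" "out_at H' (q v) = p ` out_at H v" if v: "v \<in> gV H" for v
  proof -
    have "tgt H e = v" if "e \<in> gI H" "q (tgt H e) = q v" for e
      using inj_onD[OF q that(2) dH(5)[OF that(1)] v] .
    then show "in_at H' (q v) = p ` in_at H v" using tg by (auto simp: in_at_def H'_def)
    have "src H e = v" if "e \<in> gO H" "q (src H e) = q v" for e
      using inj_onD[OF q that(2) dH(6)[OF that(1)] v] .
    then show "out_at H' (q v) = p ` out_at H v" using sr by (auto simp: out_at_def H'_def)
  qed
  have "local_map H' H z"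
    unfolding local_map_iff
  proof (intro conjI ballI dH' d)
    show "fst z \<in> gE H' \<rightarrow>\<^sub>E gE H" "snd z \<in> gV H' \<rightarrow>\<^sub>E gV H"
      using p' q' by (auto simp: z_def H'_def)
    fix w assume "w \<in> gV H'"
    then obtain v where v: "v \<in> gV H" "w = q v" by (auto simp: H'_def)
    then have "snd z w = v" using q' by (simp add: z_def)
    then show "bij_betw (fst z) (in_at H' w) (in_at H (snd z w))"
      "bij_betw (fst z) (out_at H' w) (out_at H (snd z w))"
      using v ina z inv in_at_subset[OF d] out_at_subset[OF d] by (simp_all add: bij_betw_def)
  qed
  moreover have "bij_betw (snd z) (gV H') (gV H)"
    by (rule bij_betw_byWitness[where f' = q]) (auto simp: z_def H'_def q')
  moreover have "bij_betw (fst z) (gE H') (gE H)" using z inv by (simp add: bij_betw_def H'_def)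
  ultimately have "graph_iso H' H z" using z dH(3,4) sub by (simp add: graph_iso_def H'_def)
  then show thesis using that by blast
qed

section \<open>Classes of embeddings\<close>

text \<open>This and the next two are the invariants behind \<open>emb_verts\<close>,
  \<open>emb_in\<close> and \<open>emb_out\<close>, taken on a single representative of arbitrary
  types.\<close>

definition map_verts :: "('e, 'v) dgraph \<Rightarrow> ('e, 'v, 'a, 'b) gmap \<Rightarrow> 'b set" where
  "map_verts H h = snd h ` gV H"

definition map_in :: "('e, 'v) dgraph \<Rightarrow> ('e, 'v, 'a, 'b) gmap \<Rightarrow> 'a multiset" where
  "map_in H h = image_mset (fst h) (mset_set (gin H))"

definition map_out :: "('e, 'v) dgraph \<Rightarrow> ('e, 'v, 'a, 'b) gmap \<Rightarrow> 'a multiset" where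
  "map_out H h = image_mset (fst h) (mset_set (gout H))"

lemma graph_iso_map_invariants:
  assumes z: "graph_iso H K z"
  shows "map_verts H (gcomp H k z) = map_verts K k" "map_in H (gcomp H k z) = map_in K k"
    "map_out H (gcomp H k z) = map_out K k"
proof -
  note Z = graph_isoD[OF z]
  note d = directed_graphD[OF local_mapD(1)[OF Z(1)]]
  have sub: "gin H \<subseteq> gE H" "gout H \<subseteq> gE H" using d(8,10) by auto
  have inj: "inj_on (fst z) A" if "A \<subseteq> gE H" for A
    using Z(2) that by (auto simp: bij_betw_def intro: inj_on_subset)
  have im: "image_mset (fst (gcomp H k z)) (mset_set A) = image_mset (fst k) (mset_set (fst z ` A))"
    if A: "A \<subseteq> gE H" for A
  proof -
    have "finite A" using A d(1) by (rule finite_subset)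
    then have "image_mset (fst (gcomp H k z)) (mset_set A)
        = image_mset (fst k) (image_mset (fst z) (mset_set A))"
      using A unfolding multiset.map_comp comp_def by (intro image_mset_cong) (auto simp: subset_iff)
    then show ?thesis by (simp add: image_mset_mset_set[OF inj[OF A]])
  qed
  have "snd (gcomp H k z) ` gV H = snd k ` snd z ` gV H" by (simp add: image_image cong: image_cong)
  then show "map_verts H (gcomp H k z) = map_verts K k"
    using Z(3) by (simp add: map_verts_def bij_betw_def)
  show "map_in H (gcomp H k z) = map_in K k" "map_out H (gcomp H k z) = map_out K k"
    using im[OF sub(1)] im[OF sub(2)] Z(6,7) by (simp_all add: map_in_def map_out_def)
qed

lemma set_mset_map_in: "directed_graph H \<Longrightarrow> set_mset (map_in H h) = fst h ` gin H"
  and set_mset_map_out: "directed_graph H \<Longrightarrow> set_mset (map_out H h) = fst h ` gout H"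
  by (simp_all add: map_in_def map_out_def directed_graphD(12,13))

lemma embedding_unique_mset:
  assumes h: "embedding H G h" and k: "embedding K G k"
    and "map_verts H h = map_verts K k" "map_in H h = map_in K k"
  obtains z where "graph_iso H K z" "h = gcomp H k z"
proof (rule embedding_unique[OF h k])
  show "snd h ` gV H = snd k ` gV K" using assms(3) by (simp add: map_verts_def)
  show "fst h ` gin H = fst k ` gin K"
    using assms(4) set_mset_map_in embeddingD(1)[OF h] embeddingD(1)[OF k]
    by (metis connected_graph_directed)
qed

lemma map_in_eq_empty_iff: "directed_graph H \<Longrightarrow> map_in H h = {#} \<longleftrightarrow> gin H = {}"
  by (simp add: map_in_def mset_set_empty_iff directed_graphD(12))

lemma map_verts_eq_empty_iff [simp]: "map_verts H h = {} \<longleftrightarrow> gV H = {}"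
  by (simp add: map_verts_def)

lemma nodeless_loop_iff_map:
  "connected_graph H \<Longrightarrow> nodeless_loop H \<longleftrightarrow> map_verts H h = {} \<and> map_in H h = {#}"
  by (simp add: nodeless_loop_iff map_in_eq_empty_iff connected_graph_directed)

text \<open>This description of the classes lets the domain of a representing embedding live on
  arbitrary types.\<close>

definition emb_with :: "('e, 'v) dgraph \<Rightarrow> 'v set \<Rightarrow> 'e multiset \<Rightarrow> ('e, 'v) emb set" where
  "emb_with G V M = {(H, h). embedding H G h \<and> map_verts H h = V \<and> map_in H h = M}"

definition emb_class :: "('e, 'v) dgraph \<Rightarrow> ('a, 'b) dgraph \<Rightarrow> ('a, 'b, 'e, 'v) gmap \<Rightarrow> ('e, 'v) emb set"
  where "emb_class G H h = emb_with G (map_verts H h) (map_in H h)"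

text \<open>Rigidity removes the existential quantifier over isomorphisms, so the relation is
  equality of invariants and visibly an equivalence.\<close>

lemma emb_rel_iff:
  "((H, f), (K, k)) \<in> emb_rel G \<longleftrightarrow> embedding H G f \<and> embedding K G k \<and>
     map_verts H f = map_verts K k \<and> map_in H f = map_in K k"
proof
  assume "((H, f), (K, k)) \<in> emb_rel G"
  then obtain z where z: "embedding H G f" "embedding K G k" "graph_iso H K z" "f = gcomp H k z"
    by (auto simp: emb_rel_def)
  then show "embedding H G f \<and> embedding K G k \<and>
     map_verts H f = map_verts K k \<and> map_in H f = map_in K k" by (simp add: graph_iso_map_invariants[OF z(3)])
next
  assume *: "embedding H G f \<and> embedding K G k \<and>
     map_verts H f = map_verts K k \<and> map_in H f = map_in K k"
  then obtain z where "graph_iso H K z" "f = gcomp H k z"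
    using embedding_unique_mset by blast
  then show "((H, f), (K, k)) \<in> emb_rel G" using * unfolding emb_rel_def by blast
qed

lemma emb_rel_Image: "embedding H G h \<Longrightarrow> emb_rel G `` {(H, h)} = emb_class G H h"
  by (auto simp: emb_rel_iff emb_class_def emb_with_def)

lemma emb_class_nonempty:
  fixes G :: "('e::infinite, 'v::infinite) dgraph"
  assumes h: "embedding H G h"
  obtains K k where "(K, k) \<in> emb_class G H h"
proof -
  obtain K :: "('e, 'v) dgraph" and z where z: "graph_iso K H z"
    using graph_copy[OF connected_graph_directed[OF embeddingD(1)[OF h]]] .
  have "embedding K G (gcomp K h z)"
    using embedding_gcomp[OF graph_iso_embedding[OF z embeddingD(1)[OF h]] h] .
  then have "(K, gcomp K h z) \<in> emb_class G H h"
    by (simp add: graph_iso_map_invariants[OF z] emb_class_def emb_with_def)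
  then show thesis using that by blast
qed

lemma mem_emb_class:
  "(K, k) \<in> emb_class G H h \<longleftrightarrow>
     embedding K G k \<and> map_verts K k = map_verts H h \<and> map_in K k = map_in H h"
  by (simp add: emb_class_def emb_with_def)

lemma emb_class_repr: "(K, k) \<in> emb_class G H h \<Longrightarrow> emb_class G H h = emb_class G K k"
  unfolding mem_emb_class by (simp add: emb_class_def)

lemma emb_class_eq:
  "map_verts H h = map_verts K k \<Longrightarrow> map_in H h = map_in K k \<Longrightarrow> emb_class G H h = emb_class G K k"
  by (simp add: emb_class_def)

lemma emb_class_in_Emb:
  fixes G :: "('e::infinite, 'v::infinite) dgraph"
  assumes h: "embedding H G h"
  shows "emb_class G H h \<in> Emb G"
proof -
  obtain K k where k: "(K, k) \<in> emb_class G H h" using emb_class_nonempty[OF h] .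
  then have "embedding K G k" "emb_class G H h = emb_class G K k"
    using emb_class_repr by (simp_all add: mem_emb_class)
  then have "emb_class G H h = emb_rel G `` {(K, k)}" "(K, k) \<in> {(H, f). embedding H G f}"
    using emb_rel_Image[of K G k] by simp_all
  then show ?thesis unfolding Emb_def by (simp only: quotientI)
qed

lemma EmbE:
  fixes G :: "('e, 'v) dgraph"
  assumes "X \<in> Emb G"
  obtains H :: "('e, 'v) dgraph" and h where "embedding H G h" "X = emb_class G H h"
proof -
  obtain H h where "embedding H G h" "X = emb_rel G `` {(H, h)}"
    using assms by (auto simp: Emb_def quotient_def)
  then show thesis using that[of H h] emb_rel_Image[of H G h] by simp
qed

lemma Emb_repr:
  fixes G :: "('e, 'v) dgraph"
  assumes X: "X \<in> Emb G" and h: "(H, h) \<in> X"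
  shows "embedding H G h" "X = emb_class G H h"
proof -
  obtain K :: "('e, 'v) dgraph" and k where "X = emb_class G K k" using EmbE[OF X] .
  then show "embedding H G h" "X = emb_class G H h"
    using h emb_class_repr[of H h G K k] by (simp_all add: mem_emb_class)
qed

lemma
  fixes G :: "('e::infinite, 'v::infinite) dgraph"
  assumes h: "embedding H G h"
  shows emb_verts_class: "emb_verts (emb_class G H h) = map_verts H h"
    and emb_in_class: "emb_in (emb_class G H h) = map_in H h"
    and emb_out_class: "emb_out (emb_class G H h) = map_out H h"
proof -
  obtain K k where k: "(K, k) \<in> emb_class G H h" using emb_class_nonempty[OF h] .
  \<comment> \<open>\<open>map_out\<close> is not prescribed by \<open>emb_with\<close>; it agrees
    because rigidity makes all members isomorphic to \<open>H\<close> over \<open>G\<close>.\<close>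
  have inv: "map_verts K k = map_verts H h" "map_in K k = map_in H h" "map_out K k = map_out H h"
    if "(K, k) \<in> emb_class G H h" for K k
  proof -
    show *: "map_verts K k = map_verts H h" "map_in K k = map_in H h"
      using that by (simp_all add: mem_emb_class)
    have "embedding K G k" using that by (simp add: mem_emb_class)
    then obtain z where "graph_iso K H z" "k = gcomp K h z"
      using embedding_unique_mset[OF _ h *] by blast
    then show "map_out K k = map_out H h" using graph_iso_map_invariants(3) by simp
  qed
  have ne: "emb_class G H h \<noteq> {}" using k by blast
  have "the_elem (case_prod map_verts ` emb_class G H h) = case_prod map_verts (K, k)"
    "the_elem (case_prod map_in ` emb_class G H h) = case_prod map_in (K, k)"
    "the_elem (case_prod map_out ` emb_class G H h) = case_prod map_out (K, k)"
    by (rule the_elem_image_unique[OF ne]; auto simp: inv inv[OF k])+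
  then show "emb_verts (emb_class G H h) = map_verts H h" "emb_in (emb_class G H h) = map_in H h"
    "emb_out (emb_class G H h) = map_out H h"
    by (simp_all add: emb_verts_def emb_in_def emb_out_def map_verts_def[abs_def, symmetric]
        map_in_def[abs_def, symmetric] map_out_def[abs_def, symmetric] inv[OF k])
qed

lemma Emb_eqI:
  fixes G :: "('e::infinite, 'v::infinite) dgraph"
  assumes "X \<in> Emb G" "Y \<in> Emb G" "emb_verts X = emb_verts Y" "emb_in X = emb_in Y"
  shows "X = Y"
proof -
  obtain H :: "('e, 'v) dgraph" and h where h: "embedding H G h" "X = emb_class G H h" using EmbE[OF assms(1)] .
  obtain K :: "('e, 'v) dgraph" and k where k: "embedding K G k" "Y = emb_class G K k" using EmbE[OF assms(2)] .
  show ?thesis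
    using assms(3,4) unfolding h(2) k(2) emb_verts_class[OF h(1)] emb_verts_class[OF k(1)]
      emb_in_class[OF h(1)] emb_in_class[OF k(1)] by (rule emb_class_eq)
qed

lemma graph_iso_edge_graph:
  assumes z: "graph_iso H P z" and P: "edge_graph P"
  shows "edge_graph H"
proof -
  have "connected_graph H" using graph_iso_connected[OF z edge_graph_connected[OF P]] .
  then show ?thesis
    using graph_isoD(3,6)[OF z] P edge_graph_iff[OF edge_graph_connected[OF P]]
    by (auto simp: edge_graph_iff bij_betw_def)
qed

lemma emb_is_edge_iff:
  fixes G :: "('e::infinite, 'v::infinite) dgraph"
  assumes X: "X \<in> Emb G"
  shows "emb_is_edge X \<longleftrightarrow> emb_verts X = {} \<and> emb_in X \<noteq> {#}"
proof
  assume "emb_is_edge X"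
  then obtain H h P z where h: "(H, h) \<in> X" and P: "edge_graph (P :: ('e, 'v) dgraph)" "graph_iso H P z"
    by (auto simp: emb_is_edge_def)
  note eh = Emb_repr(1)[OF X h] and Xh = Emb_repr(2)[OF X h]
  have "edge_graph H" using graph_iso_edge_graph P by blast
  then show "emb_verts X = {} \<and> emb_in X \<noteq> {#}"
    unfolding Xh emb_verts_class[OF eh] emb_in_class[OF eh] edge_graph_iff[OF embeddingD(1)[OF eh]]
    by (simp add: map_in_eq_empty_iff connected_graph_directed[OF embeddingD(1)[OF eh]])
next
  assume *: "emb_verts X = {} \<and> emb_in X \<noteq> {#}"
  obtain H :: "('e, 'v) dgraph" and h where h: "embedding H G h" "X = emb_class G H h" using EmbE[OF X] .
  note c = embeddingD(1)[OF h(1)]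
  have e: "edge_graph H"
    using * unfolding h(2) emb_verts_class[OF h(1)] emb_in_class[OF h(1)] edge_graph_iff[OF c]
    by (simp add: map_in_eq_empty_iff[OF connected_graph_directed[OF c]])
  \<comment> \<open>Since \<open>H\<close> is itself an edge graph, any automorphism is a sufficient
    witness; rigidity of \<open>h\<close> against itself provides one.\<close>
  obtain z where "graph_iso H H z" using embedding_unique[OF h(1) h(1)] by blast
  then show "emb_is_edge X"
    using e h(1) mem_emb_class[of H h G H h] unfolding emb_is_edge_def h(2) by blast
qed

lemma gcomp_assoc:
  assumes "local_map H K f" "local_map K L g"
  shows "gcomp H h (gcomp H g f) = gcomp H (gcomp K h g) f"
  using local_mapD(3,4)[OF assms(1)] by (auto simp: gcomp_def compose_def)

text \<open>\<open>emb_le\<close> asks for representatives on the types of \<open>G\<close>. They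
  exist as copies, and \<open>j\<close> is conjugated by the isomorphisms \<open>y\<close> and
  \<open>z\<close> that compare the copies with \<open>H\<close> and \<open>K\<close>.\<close>

lemma emb_leI:
  fixes G :: "('e::infinite, 'v::infinite) dgraph"
  assumes h: "embedding H G h" and k: "embedding K G k" and j: "embedding H K j" "h = gcomp H k j"
  shows "emb_le (emb_class G H h) (emb_class G K k)"
proof -
  obtain H' h' where h': "(H', h') \<in> emb_class G H h" using emb_class_nonempty[OF h] .
  obtain K' k' where k': "(K', k') \<in> emb_class G K k" using emb_class_nonempty[OF k] .
  have eh': "embedding H' G h'" "map_verts H' h' = map_verts H h" "map_in H' h' = map_in H h"
    and ek': "embedding K' G k'" "map_verts K k = map_verts K' k'" "map_in K k = map_in K' k'"
    using h' k' by (simp_all add: mem_emb_class)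
  obtain y where y: "graph_iso H' H y" "h' = gcomp H' h y"
    using embedding_unique_mset[OF eh'(1) h eh'(2,3)] .
  obtain z where z: "graph_iso K K' z" "k = gcomp K k' z"
    using embedding_unique_mset[OF k ek'] .
  note ey = graph_iso_embedding[OF y(1) embeddingD(1)[OF h]]
  note ez = graph_iso_embedding[OF z(1) embeddingD(1)[OF ek'(1)]]
  note ejy = embedding_gcomp[OF ey j(1)]
  have "embedding H' K' (gcomp H' z (gcomp H' j y))" using embedding_gcomp[OF ejy ez] .
  moreover have "h' = gcomp H' k' (gcomp H' z (gcomp H' j y))"
    unfolding y(2) j(2) gcomp_assoc[OF embeddingD(3)[OF ejy] embeddingD(3)[OF ez]] z(2)[symmetric]
    by (rule gcomp_assoc[OF embeddingD(3)[OF ey] embeddingD(3)[OF j(1)], symmetric])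
  ultimately show ?thesis unfolding emb_le_def using h' k' by blast
qed

lemma emb_leD:
  fixes G :: "('e, 'v) dgraph"
  assumes "emb_le X Y" "X \<in> Emb G" "Y \<in> Emb G"
  obtains H K :: "('e, 'v) dgraph" and h k j where "embedding H G h" "X = emb_class G H h" "embedding K G k" "Y = emb_class G K k"
    "embedding H K j" "h = gcomp H k j"
proof -
  obtain H h K k j where *: "(H, h) \<in> X" "(K, k) \<in> Y" "embedding H K j" "h = gcomp H k j"
    using assms(1) by (auto simp: emb_le_def)
  show thesis
    using that[OF Emb_repr[OF assms(2) *(1)] Emb_repr[OF assms(3) *(2)] *(3,4)] .
qed

section \<open>Graph substitution\<close>

text \<open>The orbits of a partial injection are paths or cycles, so of two points in one orbit one
  reaches the other. In the induction, a walk that turns round can only retrace its last step,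
  because predecessors and successors are unique.\<close>

lemma rtrancl_Un_converse_comparable:
  assumes R: "single_valued R" "single_valued (R\<inverse>)" and xy: "(x, y) \<in> (R \<union> R\<inverse>)\<^sup>*"
  shows "(x, y) \<in> R\<^sup>* \<or> (y, x) \<in> R\<^sup>*"
  using xy
proof (induction rule: rtrancl_induct)
  case (step y z)
  from step.IH show ?case
  proof
    assume xy: "(x, y) \<in> R\<^sup>*"
    show ?thesis
    proof (cases "(y, z) \<in> R")
      case True
      then show ?thesis using xy by (meson rtrancl.rtrancl_into_rtrancl)
    next
      case False
      then have zy: "(z, y) \<in> R" using step.hyps(2) by blast
      from xy show ?thesis
      proof (cases rule: rtranclE)
        case base
        then show ?thesis using zy by blast
      next
        case (step p)
        then have "p = z" using zy R(2) by (auto simp: single_valued_def)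
        then show ?thesis using step by blast
      qed
    qed
  next
    assume yx: "(y, x) \<in> R\<^sup>*"
    show ?thesis
    proof (cases "(z, y) \<in> R")
      case True
      then show ?thesis using yx by (meson converse_rtrancl_into_rtrancl)
    next
      case False
      then have yz: "(y, z) \<in> R" using step.hyps(2) by blast
      from yx show ?thesis
      proof (cases rule: converse_rtranclE)
        case base
        then show ?thesis using yz by blast
      next
        case (step p)
        then have "p = z" using yz R(1) by (auto simp: single_valued_def)
        then show ?thesis using step by blast
      qed
    qed
  qed
qed simp

lemma sink_unique:
  assumes R: "single_valued R" "single_valued (R\<inverse>)" and "(x, y) \<in> (R \<union> R\<inverse>)\<^sup>*"
    and "x \<notin> Domain R" "y \<notin> Domain R"
  shows "x = y"
  using rtrancl_Un_converse_comparable[OF assms(1-3)] assms(4,5)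
  by - (elim disjE; erule converse_rtranclE; blast)

lemma source_unique:
  assumes R: "single_valued R" "single_valued (R\<inverse>)" and "(x, y) \<in> (R \<union> R\<inverse>)\<^sup>*"
    and "x \<notin> Range R" "y \<notin> Range R"
  shows "x = y"
  using rtrancl_Un_converse_comparable[OF assms(1-3)] assms(4,5)
  by - (elim disjE; erule rtranclE; blast)

text \<open>Going backwards from \<open>y\<close> in a finite partial injection either stops or runs
  into a cycle through \<open>y\<close>; the latter is impossible as \<open>y\<close> has no
  successor.\<close>

lemma source_exists:
  assumes R: "single_valued R" and fin: "finite R" and y: "y \<notin> Domain R"
  obtains x where "x \<notin> Range R" "(x, y) \<in> R\<^sup>*"
proof -
  define A where "A = {x. (x, y) \<in> R\<^sup>*}"
  have "A \<subseteq> insert y (Domain R)" unfolding A_def by (auto elim: converse_rtranclE)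
  then have finA: "finite A" using fin by (meson finite_Domain finite.insertI finite_subset)
  \<comment> \<open>Otherwise predecessors define an injective self-map of the finite set
    \<open>A\<close>. It is then onto, so \<open>y\<close> is a predecessor, against
    \<open>y \<notin> Domain R\<close>.\<close>
  have "\<exists>x\<in>A. x \<notin> Range R"
  proof (rule ccontr)
    assume "\<not> (\<exists>x\<in>A. x \<notin> Range R)"
    then have "\<forall>x\<in>A. \<exists>p. (p, x) \<in> R" by blast
    then obtain p where p: "\<And>x. x \<in> A \<Longrightarrow> (p x, x) \<in> R" by metis
    have "p ` A \<subseteq> A" using p by (auto simp: A_def intro: converse_rtrancl_into_rtrancl)
    moreover have "inj_on p A" using p R unfolding inj_on_def single_valued_def by metis
    ultimately have "p ` A = A" using finA by (simp add: endo_inj_surj)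
    moreover have "y \<in> A" by (simp add: A_def)
    ultimately obtain x where "x \<in> A" "y = p x" by blast
    then show False using p y by blast
  qed
  then show thesis using that by (auto simp: A_def)
qed

lemma sink_exists:
  assumes R: "single_valued (R\<inverse>)" and fin: "finite R" and y: "y \<notin> Range R"
  obtains x where "x \<notin> Domain R" "(y, x) \<in> R\<^sup>*"
  using source_exists[of "R\<inverse>" y] R fin y by (auto simp: rtrancl_converse)

section \<open>The substituted graph, with its edges as orbits of the gluing\<close>

locale substitution =
  fixes H :: "('e, 'v) dgraph" and K :: "'v \<Rightarrow> ('k, 'w) dgraph"
    and a b :: "'v \<Rightarrow> 'k \<Rightarrow> 'e"
  assumes conn_H: "connected_graph H"
    and conn_K: "\<And>v. v \<in> gV H \<Longrightarrow> connected_graph (K v)"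
    and bij_a: "\<And>v. v \<in> gV H \<Longrightarrow> bij_betw (a v) (gin (K v)) (in_at H v)"
    and bij_b: "\<And>v. v \<in> gV H \<Longrightarrow> bij_betw (b v) (gout (K v)) (out_at H v)"
begin

abbreviation "X \<equiv> subst_edges H K"
abbreviation "q \<equiv> subst_class H K a b"
abbreviation "S \<equiv> subst_graph H K a b"

text \<open>The gluing relation, oriented along the direction of the edges. It is a partial injection,
  so its orbits are paths or cycles, and an edge of the substituted graph is such an orbit.\<close>

definition flow :: "('e + 'v \<times> 'k) rel" where
  "flow = {(Inl (a v x), Inr (v, x)) | v x. v \<in> gV H \<and> x \<in> gin (K v)} \<union>
     {(Inr (v, x), Inl (b v x)) | v x. v \<in> gV H \<and> x \<in> gout (K v)}"

lemma dH: "directed_graph H" using conn_H by (rule connected_graph_directed)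

lemma dK: "v \<in> gV H \<Longrightarrow> directed_graph (K v)" using conn_K by (rule connected_graph_directed)

lemma a_at: "v \<in> gV H \<Longrightarrow> x \<in> gin (K v) \<Longrightarrow> a v x \<in> gI H \<and> tgt H (a v x) = v"
  using bij_betwE[OF bij_a] by (auto simp: in_at_def)

lemma b_at: "v \<in> gV H \<Longrightarrow> x \<in> gout (K v) \<Longrightarrow> b v x \<in> gO H \<and> src H (b v x) = v"
  using bij_betwE[OF bij_b] by (auto simp: out_at_def)

lemma a_surj: "e \<in> gI H \<Longrightarrow> \<exists>x\<in>gin (K (tgt H e)). e = a (tgt H e) x"
  using bij_a[OF directed_graphD(5)[OF dH]] by (auto simp: bij_betw_def in_at_def)

lemma b_surj: "e \<in> gO H \<Longrightarrow> \<exists>x\<in>gout (K (src H e)). e = b (src H e) x"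
  using bij_b[OF directed_graphD(6)[OF dH]] by (auto simp: bij_betw_def out_at_def)

lemma Inl_in_X [simp]: "Inl e \<in> X \<longleftrightarrow> e \<in> gE H"
  and Inr_in_X [simp]: "Inr (v, x) \<in> X \<longleftrightarrow> v \<in> gV H \<and> x \<in> gE (K v)"
  by (auto simp: subst_edges_def)

lemma X_cases:
  assumes "y \<in> X"
  obtains e where "y = Inl e" "e \<in> gE H" | v x where "y = Inr (v, x)" "v \<in> gV H" "x \<in> gE (K v)"
  using assms by (auto simp: subst_edges_def)

lemma finite_X: "finite X"
  using directed_graphD(1,2)[OF dH] directed_graphD(1)[OF dK] by (simp add: subst_edges_def)

lemma K_subset:
  assumes "v \<in> gV H"
  shows "x \<in> gin (K v) \<Longrightarrow> x \<in> gE (K v)" "x \<in> gout (K v) \<Longrightarrow> x \<in> gE (K v)"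
    "x \<in> gI (K v) \<Longrightarrow> x \<in> gE (K v)" "x \<in> gO (K v) \<Longrightarrow> x \<in> gE (K v)"
    "x \<in> gin (K v) \<Longrightarrow> x \<notin> gO (K v)" "x \<in> gout (K v) \<Longrightarrow> x \<notin> gI (K v)"
  using directed_graphD[OF dK[OF assms]] by auto

lemma H_subset:
  "e \<in> gin H \<Longrightarrow> e \<in> gE H" "e \<in> gout H \<Longrightarrow> e \<in> gE H" "e \<in> gI H \<Longrightarrow> e \<in> gE H" "e \<in> gO H \<Longrightarrow> e \<in> gE H"
  "e \<in> gin H \<Longrightarrow> e \<notin> gO H" "e \<in> gout H \<Longrightarrow> e \<notin> gI H"
  using directed_graphD[OF dH] by auto

lemma flow_subset: "flow \<subseteq> X \<times> X"
  using a_at b_at K_subset H_subset by (fastforce simp: flow_def)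

lemma finite_flow: "finite flow"
  using finite_subset[OF flow_subset] finite_X by simp

lemma single_valued_flow: "single_valued flow"
  unfolding single_valued_def
proof (intro allI impI)
  have inj: "v = v' \<and> x = x'" if "v \<in> gV H" "x \<in> gin (K v)" "v' \<in> gV H" "x' \<in> gin (K v')" "a v x = a v' x'"
    for v x v' x'
  proof -
    have v: "v = v'" using a_at that by metis
    then show ?thesis using bij_a[OF that(1)] that by (auto simp: bij_betw_def inj_on_def)
  qed
  fix x y z assume "(x, y) \<in> flow" "(x, z) \<in> flow"
  then show "y = z" using inj by (auto simp: flow_def)
qed

lemma single_valued_flow_converse: "single_valued (flow\<inverse>)"
  unfolding single_valued_def
proof (intro allI impI)
  have inj: "v = v' \<and> x = x'" if "v \<in> gV H" "x \<in> gout (K v)" "v' \<in> gV H" "x' \<in> gout (K v')" "b v x = b v' x'"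
    for v x v' x'
  proof -
    have v: "v = v'" using b_at that by metis
    then show ?thesis using bij_b[OF that(1)] that by (auto simp: bij_betw_def inj_on_def)
  qed
  fix x y z assume "(x, y) \<in> flow\<inverse>" "(x, z) \<in> flow\<inverse>"
  then show "y = z" using inj by (auto simp: flow_def)
qed

lemma Domain_flow:
  "Inl e \<in> Domain flow \<longleftrightarrow> e \<in> gI H"
  "Inr (v, x) \<in> Domain flow \<longleftrightarrow> v \<in> gV H \<and> x \<in> gout (K v)"
proof -
  show "Inl e \<in> Domain flow \<longleftrightarrow> e \<in> gI H"
    using a_at a_surj[of e] directed_graphD(5)[OF dH, of e] by (fastforce simp: flow_def Domain_iff)
qed (auto simp: flow_def Domain_iff)

lemma Range_flow:
  "Inl e \<in> Range flow \<longleftrightarrow> e \<in> gO H"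
  "Inr (v, x) \<in> Range flow \<longleftrightarrow> v \<in> gV H \<and> x \<in> gin (K v)"
proof -
  show "Inl e \<in> Range flow \<longleftrightarrow> e \<in> gO H"
    using b_at b_surj[of e] directed_graphD(6)[OF dH, of e] by (fastforce simp: flow_def Range_iff)
qed (auto simp: flow_def Range_iff)

lemma subst_rel_flow: "subst_rel H K a b = (flow \<union> flow\<inverse>)\<^sup>* \<inter> (X \<times> X)"
proof -
  have "subst_glue H K a b \<union> (subst_glue H K a b)\<inverse> = flow \<union> flow\<inverse>"
    by (auto simp: subst_glue_def flow_def)
  then show ?thesis by (simp add: subst_rel_def)
qed

lemma equiv_subst_rel: "equiv X (subst_rel H K a b)"
proof (rule equivI)
  have "sym ((flow \<union> flow\<inverse>)\<^sup>*)" by (rule sym_rtrancl) (auto simp: sym_def)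
  then show "sym (subst_rel H K a b)" unfolding subst_rel_flow by (auto simp: sym_def)
  show "trans (subst_rel H K a b)" unfolding subst_rel_flow by (auto intro!: transI)
  show "refl_on X (subst_rel H K a b)" unfolding subst_rel_flow by (auto simp: refl_on_def)
  show "subst_rel H K a b \<subseteq> X \<times> X" unfolding subst_rel_flow by blast
qed

lemma q_eq_iff: "y \<in> X \<Longrightarrow> y' \<in> X \<Longrightarrow> q y = q y' \<longleftrightarrow> (y, y') \<in> (flow \<union> flow\<inverse>)\<^sup>*"
  unfolding subst_class_def using eq_equiv_class_iff[OF equiv_subst_rel] by (auto simp: subst_rel_flow)

lemma q_self: "y \<in> X \<Longrightarrow> y \<in> q y"
  unfolding subst_class_def using equiv_class_self[OF equiv_subst_rel] .

lemma q_mem: "y \<in> X \<Longrightarrow> y' \<in> q y \<Longrightarrow> y' \<in> X \<and> q y' = q y"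
  unfolding subst_class_def using equiv_class_eq[OF equiv_subst_rel] equiv_subst_rel
  by (metis Image_singleton_iff equiv_class_eq_iff)

lemma q_flow: "(y, y') \<in> flow \<Longrightarrow> q y = q y'"
  using q_eq_iff[of y y'] flow_subset by blast

lemma q_a: "v \<in> gV H \<Longrightarrow> x \<in> gin (K v) \<Longrightarrow> q (Inr (v, x)) = q (Inl (a v x))"
  by (rule q_flow[symmetric]) (auto simp: flow_def)

lemma q_b: "v \<in> gV H \<Longrightarrow> x \<in> gout (K v) \<Longrightarrow> q (Inr (v, x)) = q (Inl (b v x))"
  by (rule q_flow) (auto simp: flow_def)

lemma q_sink_inj:
  "y \<in> X \<Longrightarrow> y' \<in> X \<Longrightarrow> y \<notin> Domain flow \<Longrightarrow> y' \<notin> Domain flow \<Longrightarrow> q y = q y' \<Longrightarrow> y = y'"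
  using sink_unique[OF single_valued_flow single_valued_flow_converse] q_eq_iff by blast

lemma q_source_inj:
  "y \<in> X \<Longrightarrow> y' \<in> X \<Longrightarrow> y \<notin> Range flow \<Longrightarrow> y' \<notin> Range flow \<Longrightarrow> q y = q y' \<Longrightarrow> y = y'"
  using source_unique[OF single_valued_flow single_valued_flow_converse] q_eq_iff by blast

lemma flow_rtrancl_X: "(y, y') \<in> flow\<^sup>* \<Longrightarrow> y \<in> X \<Longrightarrow> y' \<in> X \<and> q y = q y'"
  by (induction rule: rtrancl_induct) (use flow_subset q_flow in blast)+

lemma flow_rtrancl_X': "(y, y') \<in> flow\<^sup>* \<Longrightarrow> y' \<in> X \<Longrightarrow> y \<in> X \<and> q y = q y'"
  by (induction rule: converse_rtrancl_induct) (use flow_subset q_flow in blast)+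

lemma q_eq_lift:
  assumes F: "\<And>y y'. (y, y') \<in> flow \<Longrightarrow> F y = F y'" and y: "y \<in> X" "y' \<in> X" "q y = q y'"
  shows "F y = F y'"
proof -
  have "(y, y') \<in> (flow \<union> flow\<inverse>)\<^sup>*" using q_eq_iff y by blast
  then show ?thesis by (induction rule: rtrancl_induct) (use F in force)+
qed

text \<open>Maps out of the quotient are encoded as \<open>the_elem\<close> of an image of the
  class. For a function that is constant along \<open>flow\<close> this value can be computed at any
  member.\<close>

lemma the_elem_lift:
  assumes F: "\<And>y y'. (y, y') \<in> flow \<Longrightarrow> F y = F y'" and y: "y \<in> X"
  shows "the_elem (F ` q y) = F y"
proof (rule the_elem_image_unique)
  show "q y \<noteq> {}" using q_self[OF y] by blast
  show "F y' = F y" if "y' \<in> q y" for y'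
    using q_eq_lift[of F, OF F] q_mem[OF y that] y by blast
qed

text \<open>These are the first points of the orbits that begin properly, either at an input of
  \<open>H\<close> or at a vertex of some \<open>K v\<close>. The isolated edge of a nodeless loop
  has no predecessor either, but is left out.\<close>

definition sources :: "('e + 'v \<times> 'k) set" where
  "sources = Inl ` gin H \<union> Inr ` (SIGMA v : gV H. gO (K v))"

definition sinks :: "('e + 'v \<times> 'k) set" where
  "sinks = Inl ` gout H \<union> Inr ` (SIGMA v : gV H. gI (K v))"

lemma sources_X: "y \<in> sources \<Longrightarrow> y \<in> X \<and> y \<notin> Range flow"
  using K_subset H_subset by (auto simp: sources_def Range_flow del: RangeE)

lemma sinks_X: "y \<in> sinks \<Longrightarrow> y \<in> X \<and> y \<notin> Domain flow"
  using K_subset H_subset by (auto simp: sinks_def Domain_flow del: DomainE)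

text \<open>In a connected graph other than the nodeless loop every edge either is an input or comes
  out of a vertex. So a point without predecessor fails to be in \<open>sources\<close> only if it
  is the edge of a nodeless loop, and there nothing is glued.\<close>

lemma source_cases:
  assumes y: "y \<in> X" "y \<notin> Range flow"
  shows "y \<in> sources \<or> y \<notin> Domain flow \<and> y \<notin> sinks"
  using y(1)
proof (cases rule: X_cases)
  case (1 e)
  show ?thesis
  proof (cases "nodeless_loop H")
    case True
    then show ?thesis using 1 by (auto simp: nodeless_loop_def Domain_flow sinks_def)
  next
    case False
    then show ?thesis
      using 1 y(2) connected_graph_in_out(1)[OF conn_H] by (auto simp: Range_flow sources_def)
  qed
next
  case (2 v x)
  show ?thesis
  proof (cases "nodeless_loop (K v)")
    case True
    then show ?thesis using 2 by (auto simp: nodeless_loop_def Domain_flow sinks_def)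
  next
    case False
    then show ?thesis
      using 2 y(2) connected_graph_in_out(1)[OF conn_K] by (auto simp: Range_flow sources_def)
  qed
qed

lemma sink_cases:
  assumes y: "y \<in> X" "y \<notin> Domain flow"
  shows "y \<in> sinks \<or> y \<notin> Range flow \<and> y \<notin> sources"
  using y(1)
proof (cases rule: X_cases)
  case (1 e)
  show ?thesis
  proof (cases "nodeless_loop H")
    case True
    then show ?thesis using 1 by (auto simp: nodeless_loop_def Range_flow sources_def)
  next
    case False
    then show ?thesis
      using 1 y(2) connected_graph_in_out(2)[OF conn_H] by (auto simp: Domain_flow sinks_def)
  qed
next
  case (2 v x)
  show ?thesis
  proof (cases "nodeless_loop (K v)")
    case True
    then show ?thesis using 2 by (auto simp: nodeless_loop_def Range_flow sources_def)
  next
    case False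
    then show ?thesis
      using 2 y(2) connected_graph_in_out(2)[OF conn_K] by (auto simp: Domain_flow sinks_def)
  qed
qed

lemma sink_to_source:
  assumes t: "t \<in> sinks"
  obtains s where "s \<in> sources" "q s = q t"
proof -
  have tX: "t \<in> X" "t \<notin> Domain flow" using sinks_X[OF t] by auto
  obtain s where s: "s \<notin> Range flow" "(s, t) \<in> flow\<^sup>*"
    using source_exists[OF single_valued_flow finite_flow tX(2)] .
  have sX: "s \<in> X" "q s = q t" using flow_rtrancl_X'[OF s(2) tX(1)] by auto
  \<comment> \<open>Either way \<open>s\<close> is not the isolated edge of a nodeless loop: it has
    a successor or it belongs to \<open>sinks\<close>.\<close>
  have "s \<in> Domain flow \<or> s = t" using s(2) by (meson Domain.DomainI converse_rtranclE)
  then show thesis using source_cases[OF sX(1) s(1)] t that sX(2) by blast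
qed

lemma source_to_sink:
  assumes s: "s \<in> sources"
  obtains t where "t \<in> sinks" "q s = q t"
proof -
  have sX: "s \<in> X" "s \<notin> Range flow" using sources_X[OF s] by auto
  obtain t where t: "t \<notin> Domain flow" "(s, t) \<in> flow\<^sup>*"
    using sink_exists[OF single_valued_flow_converse finite_flow sX(2)] .
  have tX: "t \<in> X" "q s = q t" using flow_rtrancl_X[OF t(2) sX(1)] by auto
  have "t \<in> Range flow \<or> s = t" using t(2) by (meson Range.RangeI rtranclE)
  then show thesis using sink_cases[OF tX(1) t(1)] s that tX(2) by blast
qed

lemma sources_inj: "s \<in> sources \<Longrightarrow> s' \<in> sources \<Longrightarrow> q s = q s' \<Longrightarrow> s = s'"
  using sources_X q_source_inj by blast

lemma sinks_inj: "s \<in> sinks \<Longrightarrow> s' \<in> sinks \<Longrightarrow> q s = q s' \<Longrightarrow> s = s'"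
  using sinks_X q_sink_inj by blast

lemma inj_gin: "inj_on (\<lambda>e. q (Inl e)) (gin H)"
  using sources_inj[of "Inl _" "Inl _"] by (auto simp: inj_on_def sources_def)

lemma inj_gout: "inj_on (\<lambda>e. q (Inl e)) (gout H)"
  using sinks_inj[of "Inl _" "Inl _"] by (auto simp: inj_on_def sinks_def)

lemma q_I_inj:
  assumes "v \<in> gV H" "x \<in> gI (K v)" "v' \<in> gV H" "x' \<in> gI (K v')" "q (Inr (v, x)) = q (Inr (v', x'))"
  shows "v = v' \<and> x = x'"
  using sinks_inj[of "Inr (v, x)" "Inr (v', x')"] assms by (auto simp: sinks_def)

lemma q_O_inj:
  assumes "v \<in> gV H" "x \<in> gO (K v)" "v' \<in> gV H" "x' \<in> gO (K v')" "q (Inr (v, x)) = q (Inr (v', x'))"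
  shows "v = v' \<and> x = x'"
  using sources_inj[of "Inr (v, x)" "Inr (v', x')"] assms by (auto simp: sources_def)

lemma S_simps:
  "gE S = q ` X" "gV S = (SIGMA v : gV H. gV (K v))"
  "gI S = (\<lambda>p. q (Inr p)) ` (SIGMA v : gV H. gI (K v))"
  "gO S = (\<lambda>p. q (Inr p)) ` (SIGMA v : gV H. gO (K v))"
  "gin S = (\<lambda>e. q (Inl e)) ` gin H" "gout S = (\<lambda>e. q (Inl e)) ` gout H"
  by (auto simp: subst_graph_def Let_def quotient_def subst_class_def)

text \<open>An orbit has at most one last point, so a class contains at most one edge entering a
  vertex, and the \<open>the_elem\<close> in the definition of \<open>tgt S\<close> is well
  defined.\<close>

lemma tgt_S:
  assumes v: "v \<in> gV H" and x: "x \<in> gI (K v)"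
  shows "tgt S (q (Inr (v, x))) = (v, tgt (K v) x)"
proof -
  have "{(v', x'). v' \<in> gV H \<and> x' \<in> gI (K v') \<and> q (Inr (v', x')) = q (Inr (v, x))} = {(v, x)}"
    using q_I_inj v x by auto
  moreover have "q (Inr (v, x)) \<in> (\<lambda>p. q (Inr p)) ` (SIGMA v : gV H. gI (K v))" using v x by blast
  ultimately show ?thesis by (simp add: subst_graph_def Let_def)
qed

lemma src_S:
  assumes v: "v \<in> gV H" and x: "x \<in> gO (K v)"
  shows "src S (q (Inr (v, x))) = (v, src (K v) x)"
proof -
  have "{(v', x'). v' \<in> gV H \<and> x' \<in> gO (K v') \<and> q (Inr (v', x')) = q (Inr (v, x))} = {(v, x)}"
    using q_O_inj v x by auto
  moreover have "q (Inr (v, x)) \<in> (\<lambda>p. q (Inr p)) ` (SIGMA v : gV H. gO (K v))" using v x by blast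
  ultimately show ?thesis by (simp add: subst_graph_def Let_def)
qed

lemma S_ext: "tgt S \<in> extensional (gI S)" "src S \<in> extensional (gO S)"
  by (simp_all add: subst_graph_def Let_def)

lemma q_sources: "q ` sources = gin S \<union> gO S" and q_sinks: "q ` sinks = gout S \<union> gI S"
  by (auto simp: sources_def sinks_def S_simps)

lemma gin_gO_disjoint: "gin S \<inter> gO S = {}"
proof -
  have "q (Inl e) \<noteq> q (Inr (v, x))" if "e \<in> gin H" "v \<in> gV H" "x \<in> gO (K v)" for e v x
    using sources_inj[of "Inl e" "Inr (v, x)"] that by (auto simp: sources_def)
  then show ?thesis by (auto simp: S_simps)
qed

lemma gout_gI_disjoint: "gout S \<inter> gI S = {}"
proof -
  have "q (Inl e) \<noteq> q (Inr (v, x))" if "e \<in> gout H" "v \<in> gV H" "x \<in> gI (K v)" for e v x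
    using sinks_inj[of "Inl e" "Inr (v, x)"] that by (auto simp: sinks_def)
  then show ?thesis by (auto simp: S_simps)
qed

text \<open>The boundary axioms follow from
  \<open>gin S \<union> gO S = gout S \<union> gI S\<close>, both unions being disjoint: the left
  side consists of the orbits with a first point in \<open>sources\<close>, the right side of those
  with a last point in \<open>sinks\<close>, and these are the same orbits.\<close>

lemma directed_S: "directed_graph S"
  unfolding directed_graph_def
proof (intro conjI)
  have ss: "q ` sources = q ` sinks"
  proof (intro equalityI image_subsetI)
    fix y assume "y \<in> sources"
    then obtain t where "t \<in> sinks" "q y = q t" by (rule source_to_sink)
    then show "q y \<in> q ` sinks" by simp
  next
    fix y assume "y \<in> sinks"
    then obtain s where "s \<in> sources" "q s = q y" by (rule sink_to_source)
    then show "q y \<in> q ` sources" by (metis imageI)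
  qed
  show "finite (gE S)" "finite (gV S)"
    using finite_X directed_graphD(2)[OF dH] directed_graphD(2)[OF dK] by (simp_all add: S_simps)
  show "gI S \<subseteq> gE S" "gO S \<subseteq> gE S" using K_subset by (auto simp: S_simps)
  show "tgt S \<in> gI S \<rightarrow>\<^sub>E gV S"
    using S_ext(1) tgt_S directed_graphD(5)[OF dK] by (auto simp: PiE_def S_simps)
  show "src S \<in> gO S \<rightarrow>\<^sub>E gV S"
    using S_ext(2) src_S directed_graphD(6)[OF dK] by (auto simp: PiE_def S_simps)
  have "gin S \<union> gO S = gout S \<union> gI S" using ss q_sources q_sinks by simp
  then show "gI S - gO S \<subseteq> gin S" "gO S - gI S \<subseteq> gout S" "gin S - gI S = gout S - gO S"
    using gin_gO_disjoint gout_gI_disjoint by auto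
  have "gin S \<subseteq> gE S" "gout S \<subseteq> gE S" using H_subset by (auto simp: S_simps)
  then show "gin S \<subseteq> gE S - gO S" "gout S \<subseteq> gE S - gI S"
    using gin_gO_disjoint gout_gI_disjoint by auto
qed

text \<open>A colouring of \<open>S\<close> is constant on each \<open>K v\<close>. These constants
  colour the vertices of \<open>H\<close> compatibly with its edges, since each flag of
  \<open>H\<close> is glued to an edge of some \<open>K v\<close>; connectedness of \<open>H\<close>
  finishes the argument.\<close>

lemma connected_S: "connected_graph S"
  unfolding connected_graph_iff
proof (intro conjI allI impI directed_S)
  show "gE S \<noteq> {} \<or> gV S \<noteq> {}"
  proof (cases "gE H = {}")
    case True
    then obtain v where v: "v \<in> gV H" using conn_H by (auto simp: connected_graph_def)
    then have "gE (K v) \<noteq> {} \<or> gV (K v) \<noteq> {}" using conn_K[OF v] by (simp add: connected_graph_def)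
    then show ?thesis using v by (auto simp: S_simps subst_edges_def)
  next
    case False
    then show ?thesis by (auto simp: S_simps subst_edges_def)
  qed
  fix P :: "_ \<Rightarrow> bool" and Q
  assume t: "\<forall>e\<in>gI S. P e = Q (tgt S e)" and s: "\<forall>e\<in>gO S. P e = Q (src S e)"
  have "\<exists>c. (\<forall>x\<in>gE (K v). P (q (Inr (v, x))) = c) \<and> (\<forall>w\<in>gV (K v). Q (v, w) = c)"
    if v: "v \<in> gV H" for v
  proof -
    have "P (q (Inr (v, x))) = Q (v, tgt (K v) x)" if "x \<in> gI (K v)" for x
      using t tgt_S[OF v that] v that by (auto simp: S_simps)
    moreover have "P (q (Inr (v, x))) = Q (v, src (K v) x)" if "x \<in> gO (K v)" for x
      using s src_S[OF v that] v that by (auto simp: S_simps)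
    ultimately show ?thesis
      using connected_graph_colour[OF conn_K[OF v], of "\<lambda>x. P (q (Inr (v, x)))" "\<lambda>w. Q (v, w)"] by blast
  qed
  then obtain c where c: "\<And>v x. v \<in> gV H \<Longrightarrow> x \<in> gE (K v) \<Longrightarrow> P (q (Inr (v, x))) = c v"
    "\<And>v w. v \<in> gV H \<Longrightarrow> w \<in> gV (K v) \<Longrightarrow> Q (v, w) = c v" by metis
  have "P (q (Inl e)) = c (tgt H e)" if e: "e \<in> gI H" for e
    using a_surj[OF e] q_a c(1) K_subset(1) directed_graphD(5)[OF dH e] by metis
  moreover have "P (q (Inl e)) = c (src H e)" if e: "e \<in> gO H" for e
    using b_surj[OF e] q_b c(1) K_subset(2) directed_graphD(6)[OF dH e] by metis
  ultimately have "(\<forall>e\<in>gE H. P (q (Inl e))) \<and> (\<forall>v\<in>gV H. c v) \<or>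
      (\<forall>e\<in>gE H. \<not> P (q (Inl e))) \<and> (\<forall>v\<in>gV H. \<not> c v)"
    by (rule connected_graph_colour[OF conn_H, of "\<lambda>e. P (q (Inl e))" c])
  then obtain d where d: "\<And>e. e \<in> gE H \<Longrightarrow> P (q (Inl e)) = d" "\<And>v. v \<in> gV H \<Longrightarrow> c v = d" by metis
  have "P (q y) = d" if "y \<in> X" for y
    using that by (cases rule: X_cases) (simp_all add: c d)
  moreover have "Q p = d" if "p \<in> gV S" for p using that c(2) d(2) by (auto simp: S_simps)
  ultimately show "(\<forall>e\<in>gE S. P e) \<and> (\<forall>v\<in>gV S. Q v) \<or> (\<forall>e\<in>gE S. \<not> P e) \<and> (\<forall>v\<in>gV S. \<not> Q v)"
    by (cases d) (simp_all add: S_simps(1))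
qed

lemma S_at:
  assumes v: "v \<in> gV H" "w \<in> gV (K v)"
  shows "bij_betw (\<lambda>x. q (Inr (v, x))) (in_at (K v) w) (in_at S (v, w))"
    "bij_betw (\<lambda>x. q (Inr (v, x))) (out_at (K v) w) (out_at S (v, w))"
proof -
  have "inj_on (\<lambda>x. q (Inr (v, x))) (in_at (K v) w)" "inj_on (\<lambda>x. q (Inr (v, x))) (out_at (K v) w)"
    using q_I_inj[OF v(1) _ v(1)] q_O_inj[OF v(1) _ v(1)] by (auto simp: inj_on_def in_at_def out_at_def)
  moreover have "(\<lambda>x. q (Inr (v, x))) ` in_at (K v) w = in_at S (v, w)"
    using v tgt_S by (fastforce simp: in_at_def S_simps)
  moreover have "(\<lambda>x. q (Inr (v, x))) ` out_at (K v) w = out_at S (v, w)"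
    using v src_S by (fastforce simp: out_at_def S_simps)
  ultimately show "bij_betw (\<lambda>x. q (Inr (v, x))) (in_at (K v) w) (in_at S (v, w))"
    "bij_betw (\<lambda>x. q (Inr (v, x))) (out_at (K v) w) (out_at S (v, w))" by (simp_all add: bij_betw_def)
qed

end

section \<open>Induced maps\<close>

definition gi_verts :: "('k, 'w, 'e, 'a, 'b) gen_image \<Rightarrow> 'b set" where
  "gi_verts s = map_verts (gi_graph s) (gi_map s)"

locale induced =
  fixes H :: "('e, 'v) dgraph" and h :: "('e, 'v, 'c, 'd) gmap" and G :: "('c, 'd) dgraph"
    and G' :: "('a, 'b) dgraph" and f0 :: "'c \<Rightarrow> 'a"
    and r :: "'d \<Rightarrow> ('k, 'w, 'c, 'a, 'b) gen_image"
  assumes connected_H: "connected_graph H" and h: "local_map H G h" and dG': "directed_graph G'"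
    and f0: "\<And>e. e \<in> gE G \<Longrightarrow> f0 e \<in> gE G'"
    and r: "\<And>u. u \<in> gV G \<Longrightarrow> gen_image_at G G' f0 u (r u)"
begin

lemma h_vert: "v \<in> gV H \<Longrightarrow> snd h v \<in> gV G" using local_mapD(4)[OF h] .

lemma r_at:
  assumes v: "v \<in> gV H"
  shows "connected_graph (gi_graph (r (snd h v)))"
    "local_map (gi_graph (r (snd h v))) G' (gi_map (r (snd h v)))"
    "bij_betw (gi_in (r (snd h v))) (gin (gi_graph (r (snd h v)))) (in_at G (snd h v))"
    "bij_betw (gi_out (r (snd h v))) (gout (gi_graph (r (snd h v)))) (out_at G (snd h v))"
    "\<And>x. x \<in> gin (gi_graph (r (snd h v))) \<Longrightarrow>
       fst (gi_map (r (snd h v))) x = f0 (gi_in (r (snd h v)) x)"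
    "\<And>x. x \<in> gout (gi_graph (r (snd h v))) \<Longrightarrow>
       fst (gi_map (r (snd h v))) x = f0 (gi_out (r (snd h v)) x)"
  using r[OF h_vert[OF v]] by (auto simp: gen_image_at_def)

lemma bij_ind_in:
  assumes v: "v \<in> gV H"
  shows "bij_betw (ind_in H h r v) (gin (ind_graph_of h r v)) (in_at H v)"
  using bij_betw_trans[OF r_at(3)[OF v] bij_betw_inv_into[OF local_mapD(7)[OF h v]]]
  by (simp add: ind_in_def[abs_def] ind_graph_of_def comp_def)

lemma bij_ind_out:
  assumes v: "v \<in> gV H"
  shows "bij_betw (ind_out H h r v) (gout (ind_graph_of h r v)) (out_at H v)"
  using bij_betw_trans[OF r_at(4)[OF v] bij_betw_inv_into[OF local_mapD(8)[OF h v]]]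
  by (simp add: ind_out_def[abs_def] ind_graph_of_def comp_def)

sublocale substitution H "ind_graph_of h r" "ind_in H h r" "ind_out H h r"
  by unfold_locales (simp_all add: connected_H bij_ind_in bij_ind_out, simp add: ind_graph_of_def r_at(1))

lemma ind_graph_S: "ind_graph H h r = S"
  by (simp add: ind_graph_def)

lemma h_ind_in:
  assumes v: "v \<in> gV H" and x: "x \<in> gin (ind_graph_of h r v)"
  shows "fst h (ind_in H h r v x) = gi_in (r (snd h v)) x"
proof -
  have "gi_in (r (snd h v)) x \<in> in_at G (snd h v)"
    using bij_betwE[OF r_at(3)[OF v]] x by (auto simp: ind_graph_of_def)
  then show ?thesis
    using local_mapD(7)[OF h v] unfolding ind_in_def by (intro f_inv_into_f) (simp add: bij_betw_def)
qed

lemma h_ind_out: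
  assumes v: "v \<in> gV H" and x: "x \<in> gout (ind_graph_of h r v)"
  shows "fst h (ind_out H h r v x) = gi_out (r (snd h v)) x"
proof -
  have "gi_out (r (snd h v)) x \<in> out_at G (snd h v)"
    using bij_betwE[OF r_at(4)[OF v]] x by (auto simp: ind_graph_of_def)
  then show ?thesis
    using local_mapD(8)[OF h v] unfolding ind_out_def by (intro f_inv_into_f) (simp add: bij_betw_def)
qed

abbreviation "\<mu> \<equiv> case_sum (\<lambda>e. f0 (fst h e)) (\<lambda>(v, x). fst (gi_map (r (snd h v))) x)"

text \<open>The compatibility of \<open>gi_map\<close> with \<open>f0\<close> on the boundary is
  exactly what makes the two halves of the map agree on glued edges.\<close>

lemma \<mu>_flow: "(y, y') \<in> flow \<Longrightarrow> \<mu> y = \<mu> y'"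
  using h_ind_in h_ind_out r_at(5,6) by (auto simp: flow_def ind_graph_of_def)

lemma ind_map_q: "y \<in> X \<Longrightarrow> fst (ind_map H h f0 r) (q y) = \<mu> y"
  using the_elem_lift[of \<mu>, OF \<mu>_flow] by (simp add: ind_map_def ind_graph_S S_simps(1))

lemma ind_map_vert:
  "v \<in> gV H \<Longrightarrow> w \<in> gV (gi_graph (r (snd h v))) \<Longrightarrow>
     snd (ind_map H h f0 r) (v, w) = snd (gi_map (r (snd h v))) w"
  by (simp add: ind_map_def ind_graph_S S_simps(2) ind_graph_of_def)

text \<open>The flags of \<open>S\<close> at \<open>(v, w)\<close> are those of the substituted
  graph at \<open>w\<close>, and on these the induced map is the local map belonging to the
  generator.\<close>

lemma local_map_ind_map: "local_map S G' (ind_map H h f0 r)"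
  unfolding local_map_iff
proof (intro conjI ballI directed_S dG')
  have "\<mu> y \<in> gE G'" if "y \<in> X" for y
    using that by (cases rule: X_cases)
      (auto simp: f0 local_mapD(3)[OF h] local_mapD(3)[OF r_at(2)] ind_graph_of_def)
  then have "\<forall>c\<in>gE S. fst (ind_map H h f0 r) c \<in> gE G'" using ind_map_q by (simp add: S_simps(1))
  then show "fst (ind_map H h f0 r) \<in> gE S \<rightarrow>\<^sub>E gE G'"
    unfolding PiE_iff by (simp add: ind_map_def ind_graph_S)
  show "snd (ind_map H h f0 r) \<in> gV S \<rightarrow>\<^sub>E gV G'"
  proof -
    have "snd (ind_map H h f0 r) \<in> extensional (gV S)" by (simp add: ind_map_def ind_graph_S)
    moreover have "snd (ind_map H h f0 r) p \<in> gV G'" if "p \<in> gV S" for p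
      using that ind_map_vert local_mapD(4)[OF r_at(2)] by (auto simp: S_simps(2) ind_graph_of_def)
    ultimately show ?thesis by (simp add: PiE_iff)
  qed
  fix p assume "p \<in> gV S"
  then obtain v w where p: "p = (v, w)" and v: "v \<in> gV H" and w: "w \<in> gV (ind_graph_of h r v)"
    by (auto simp: S_simps(2))
  define K where "K = gi_graph (r (snd h v))"
  define k where "k = gi_map (r (snd h v))"
  have Kk: "ind_graph_of h r v = K" by (simp add: ind_graph_of_def K_def)
  have lk: "local_map K G' k" using r_at(2)[OF v] by (simp add: K_def k_def)
  have wK: "w \<in> gV K" using w Kk by simp
  have sp: "snd (ind_map H h f0 r) p = snd k w" using ind_map_vert[OF v] wK p by (simp add: K_def k_def)
  have comp: "fst (ind_map H h f0 r) (q (Inr (v, x))) = fst k x" if "x \<in> gE K" for x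
    using ind_map_q[of "Inr (v, x)"] v that Kk by (simp add: k_def)
  have "bij_betw (fst (ind_map H h f0 r) \<circ> (\<lambda>x. q (Inr (v, x)))) (in_at K w) (in_at G' (snd k w))"
    using local_mapD(7)[OF lk wK] comp in_at_subset[OF local_mapD(1)[OF lk], of w]
    by (subst bij_betw_cong[where g = "fst k"]) (auto simp: subset_iff)
  then show "bij_betw (fst (ind_map H h f0 r)) (in_at S p) (in_at G' (snd (ind_map H h f0 r) p))"
    unfolding sp unfolding p by (simp only: bij_betw_comp_iff[OF S_at(1)[OF v w], unfolded Kk])
  have "bij_betw (fst (ind_map H h f0 r) \<circ> (\<lambda>x. q (Inr (v, x)))) (out_at K w) (out_at G' (snd k w))"
    using local_mapD(8)[OF lk wK] comp out_at_subset[OF local_mapD(1)[OF lk], of w]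
    by (subst bij_betw_cong[where g = "fst k"]) (auto simp: subset_iff)
  then show "bij_betw (fst (ind_map H h f0 r)) (out_at S p) (out_at G' (snd (ind_map H h f0 r) p))"
    unfolding sp unfolding p by (simp only: bij_betw_comp_iff[OF S_at(2)[OF v w], unfolded Kk])
qed

lemma map_verts_ind: "map_verts S (ind_map H h f0 r) = (\<Union>u\<in>map_verts H h. gi_verts (r u))"
proof -
  have "map_verts S (ind_map H h f0 r) = (\<Union>v\<in>gV H. snd (gi_map (r (snd h v))) ` gV (gi_graph (r (snd h v))))"
    unfolding map_verts_def S_simps(2) ind_graph_of_def using ind_map_vert by (force simp: image_iff)
  then show ?thesis by (simp add: map_verts_def gi_verts_def)
qed

text \<open>Gluing never identifies two inputs of \<open>H\<close>, so multiplicities are kept. With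
  \<open>map_verts_ind\<close> this expresses the invariants of the induced map through those of
  \<open>h\<close>.\<close>

lemma map_in_ind: "map_in S (ind_map H h f0 r) = image_mset f0 (map_in H h)"
proof -
  have "mset_set (gin S) = image_mset (\<lambda>e. q (Inl e)) (mset_set (gin H))"
    using inj_gin by (simp add: S_simps(5) image_mset_mset_set)
  moreover have "fst (ind_map H h f0 r) (q (Inl e)) = f0 (fst h e)" if "e \<in> gin H" for e
    using ind_map_q[of "Inl e"] H_subset(1)[OF that] by simp
  ultimately show ?thesis
    using directed_graphD(12)[OF dH] by (auto simp: map_in_def multiset.map_comp intro!: image_mset_cong)
qed

lemma map_out_ind: "map_out S (ind_map H h f0 r) = image_mset f0 (map_out H h)"
proof -
  have "mset_set (gout S) = image_mset (\<lambda>e. q (Inl e)) (mset_set (gout H))"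
    using inj_gout by (simp add: S_simps(6) image_mset_mset_set)
  moreover have "fst (ind_map H h f0 r) (q (Inl e)) = f0 (fst h e)" if "e \<in> gout H" for e
    using ind_map_q[of "Inl e"] H_subset(2)[OF that] by simp
  ultimately show ?thesis
    using directed_graphD(13)[OF dH] by (auto simp: map_out_def multiset.map_comp intro!: image_mset_cong)
qed

end

text \<open>A subgraph with vertices and without boundary is closed under adjacency, so by
  connectedness it is all of \<open>K\<close>. Then every edge of \<open>K\<close> comes out of a
  vertex and none is an input. This handles nodeless loops in \<open>ind_map_mono\<close>.\<close>

lemma embedding_closed_image:
  assumes j: "embedding H K j" and V: "gV H \<noteq> {}" and io: "gin H = {}" "gout H = {}"
  shows "gin K = {}"
proof -
  note cH = embeddingD(1)[OF j] and cK = embeddingD(2)[OF j] and lj = embeddingD(3)[OF j]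
  note sH = connected_graph_vertices[OF cH V]
  note dH = directed_graphD[OF local_mapD(1)[OF lj]]
  have IO: "gI H = gE H" "gO H = gE H" using sH io by auto
  have "(e \<in> fst j ` gE H) = (tgt K e \<in> snd j ` gV H)" if "e \<in> gI K" for e
  proof
    assume "e \<in> fst j ` gE H"
    then show "tgt K e \<in> snd j ` gV H" using local_map_tgt[OF lj] dH(5) IO by auto
  next
    assume "tgt K e \<in> snd j ` gV H"
    then show "e \<in> fst j ` gE H" using embedding_image_in(2)[OF j] that IO by auto
  qed
  moreover have "(e \<in> fst j ` gE H) = (src K e \<in> snd j ` gV H)" if "e \<in> gO K" for e
  proof
    assume "e \<in> fst j ` gE H"
    then show "src K e \<in> snd j ` gV H" using local_map_src[OF lj] dH(6) IO by auto
  next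
    assume "src K e \<in> snd j ` gV H"
    then show "e \<in> fst j ` gE H" using embedding_image_out(2)[OF j] that IO by auto
  qed
  ultimately have "(\<forall>e\<in>gE K. e \<in> fst j ` gE H) \<and> (\<forall>v\<in>gV K. v \<in> snd j ` gV H) \<or>
      (\<forall>e\<in>gE K. e \<notin> fst j ` gE H) \<and> (\<forall>v\<in>gV K. v \<notin> snd j ` gV H)"
    by (rule connected_graph_colour[OF cK, of "\<lambda>e. e \<in> fst j ` gE H" "\<lambda>v. v \<in> snd j ` gV H"])
  then have "gE K \<subseteq> fst j ` gO H" using V IO local_mapD(4)[OF lj] by blast
  then have "gE K \<subseteq> gO K" using local_map_src(1)[OF lj] by auto
  then show ?thesis using directed_graphD(8)[OF local_mapD(2)[OF lj]] by auto
qed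

text \<open>The embedding \<open>i\<close> applies \<open>j\<close> to the outer graph and leaves
  the substituted graphs as they are, which is possible because \<open>h = k j\<close> puts the same
  graph at \<open>v\<close> and at \<open>j v\<close>.\<close>

lemma ind_map_mono:
  assumes H: "induced H h G G' f0 r" and K: "induced K k G G' f0 r"
    and j: "embedding H K j" and hj: "h = gcomp H k j"
    and embH: "embedding (ind_graph H h r) G' (ind_map H h f0 r)"
  obtains i where "embedding (ind_graph H h r) (ind_graph K k r) i"
    "ind_map H h f0 r = gcomp (ind_graph H h r) (ind_map K k f0 r) i"
proof -
  interpret H: induced H h G G' f0 r by (fact H)
  interpret K: induced K k G G' f0 r by (fact K)
  note lj = embeddingD(3)[OF j]
  have hV: "snd h v = snd k (snd j v)" if "v \<in> gV H" for v using hj that by simp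
  have hE: "fst h e = fst k (fst j e)" if "e \<in> gE H" for e using hj that by simp
  have jV: "snd j v \<in> gV K" if "v \<in> gV H" for v using local_mapD(4)[OF lj that] .
  have jE: "fst j e \<in> gE K" if "e \<in> gE H" for e using local_mapD(3)[OF lj that] .
  have gr: "ind_graph_of h r v = ind_graph_of k r (snd j v)" if "v \<in> gV H" for v
    using hV[OF that] by (simp add: ind_graph_of_def)
  have a: "fst j (ind_in H h r v x) = ind_in K k r (snd j v) x"
    if v: "v \<in> gV H" and x: "x \<in> gin (ind_graph_of h r v)" for v x
  proof -
    have 1: "ind_in H h r v x \<in> in_at H v" using bij_betwE[OF H.bij_ind_in[OF v]] x by blast
    have 2: "ind_in K k r (snd j v) x \<in> in_at K (snd j v)"
      using bij_betwE[OF K.bij_ind_in[OF jV[OF v]]] x gr[OF v] by auto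
    have 3: "fst j (ind_in H h r v x) \<in> in_at K (snd j v)"
      using bij_betwE[OF local_mapD(7)[OF lj v]] 1 by blast
    have "ind_in H h r v x \<in> gE H" using 1 in_at_subset[OF H.dH] by blast
    then have "fst k (fst j (ind_in H h r v x)) = fst k (ind_in K k r (snd j v) x)"
      using H.h_ind_in[OF v x] K.h_ind_in[OF jV[OF v], of x] x gr[OF v] hE hV[OF v] by simp
    then show ?thesis
      using local_mapD(7)[OF K.h jV[OF v]] 2 3 by (auto simp: bij_betw_def dest: inj_onD)
  qed
  have b: "fst j (ind_out H h r v x) = ind_out K k r (snd j v) x"
    if v: "v \<in> gV H" and x: "x \<in> gout (ind_graph_of h r v)" for v x
  proof -
    have 1: "ind_out H h r v x \<in> out_at H v" using bij_betwE[OF H.bij_ind_out[OF v]] x by blast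
    have 2: "ind_out K k r (snd j v) x \<in> out_at K (snd j v)"
      using bij_betwE[OF K.bij_ind_out[OF jV[OF v]]] x gr[OF v] by auto
    have 3: "fst j (ind_out H h r v x) \<in> out_at K (snd j v)"
      using bij_betwE[OF local_mapD(8)[OF lj v]] 1 by blast
    have "ind_out H h r v x \<in> gE H" using 1 out_at_subset[OF H.dH] by blast
    then have "fst k (fst j (ind_out H h r v x)) = fst k (ind_out K k r (snd j v) x)"
      using H.h_ind_out[OF v x] K.h_ind_out[OF jV[OF v], of x] x gr[OF v] hE hV[OF v] by simp
    then show ?thesis
      using local_mapD(8)[OF K.h jV[OF v]] 2 3 by (auto simp: bij_betw_def dest: inj_onD)
  qed
  \<comment> \<open>\<open>m\<close> is the map \<open>i\<close> before passing to gluing classes: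
    \<open>j\<close> on edges of \<open>H\<close> and on the index \<open>v\<close>, the identity
    inside the substituted graph.\<close>
  define m where "m = map_sum (fst j) (map_prod (snd j) (id :: 'g \<Rightarrow> 'g))"
  have m: "m (Inl e) = Inl (fst j e)" "m (Inr (v, x)) = Inr (snd j v, x)" for e v x
    by (simp_all add: m_def)
  have m_X: "m y \<in> K.X" if "y \<in> H.X" for y
    using that by (cases rule: H.X_cases) (auto simp: m jE jV gr)
  have m_flow: "K.q (m y) = K.q (m y')" if "(y, y') \<in> H.flow" for y y'
    using that K.q_a K.q_b jV by (auto simp: H.flow_def m a b gr)
  define i where "i = ((\<lambda>c\<in>gE H.S. the_elem ((\<lambda>y. K.q (m y)) ` c)), (\<lambda>(v, w)\<in>gV H.S. (snd j v, w)))"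
  have i_q: "fst i (H.q y) = K.q (m y)" if "y \<in> H.X" for y
    using H.the_elem_lift[of "\<lambda>y. K.q (m y)", OF m_flow that] that
    by (simp add: i_def H.S_simps(1))
  have i_v: "snd i (v, w) = (snd j v, w)" if "(v, w) \<in> gV H.S" for v w using that by (simp add: i_def)
  have i_ext: "fst i \<in> extensional (gE H.S)" "snd i \<in> extensional (gV H.S)" by (simp_all add: i_def)
  have kiE: "fst (ind_map K k f0 r) (fst i c) = fst (ind_map H h f0 r) c" if "c \<in> gE H.S" for c
  proof -
    obtain y where y: "y \<in> H.X" "c = H.q y" using \<open>c \<in> gE H.S\<close> by (auto simp: H.S_simps(1))
    have "K.\<mu> (m y) = H.\<mu> y"
      using y(1) by (cases rule: H.X_cases) (auto simp: m hE hV)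
    then show ?thesis using y i_q K.ind_map_q[OF m_X] H.ind_map_q by simp
  qed
  have kiV: "snd (ind_map K k f0 r) (snd i p) = snd (ind_map H h f0 r) p" if p: "p \<in> gV H.S" for p
    using p H.ind_map_vert K.ind_map_vert hV jV i_v
    by (auto simp: H.S_simps(2) ind_graph_of_def)
  \<comment> \<open>Locality is not checked on fibres: both graphs are local over \<open>G'\<close>
    and \<open>i\<close> commutes with the maps to it.\<close>
  have li: "local_map H.S K.S i"
  proof (rule local_map_cancel[OF H.local_map_ind_map K.local_map_ind_map _ _ _ _ kiE kiV])
    show "fst i \<in> gE H.S \<rightarrow>\<^sub>E gE K.S"
      using i_q m_X i_ext by (auto simp: PiE_iff H.S_simps(1) K.S_simps(1))
    show "snd i \<in> gV H.S \<rightarrow>\<^sub>E gV K.S"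
      using i_v i_ext jV gr by (auto simp: PiE_iff H.S_simps(2) K.S_simps(2))
    show "fst i c \<in> gI K.S \<and> tgt K.S (fst i c) = snd i (tgt H.S c)" if c: "c \<in> gI H.S" for c
    proof -
      obtain v x where vx: "v \<in> gV H" "x \<in> gI (ind_graph_of h r v)" "c = H.q (Inr (v, x))"
        using c by (auto simp: H.S_simps(3))
      have x: "x \<in> gI (ind_graph_of k r (snd j v))" using vx gr by simp
      have "(v, tgt (ind_graph_of h r v) x) \<in> gV H.S"
        using vx directed_graphD(5)[OF H.dK] by (simp add: H.S_simps(2))
      moreover have "fst i c = K.q (Inr (snd j v, x))"
        using i_q[of "Inr (v, x)"] vx H.K_subset(3) by (simp add: m)
      ultimately show ?thesis
        using x vx(1) jV K.tgt_S[OF jV x] H.tgt_S[OF vx(1,2)] i_v gr vx(3) by (auto simp: K.S_simps(3))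
    qed
    show "fst i c \<in> gO K.S \<and> src K.S (fst i c) = snd i (src H.S c)" if c: "c \<in> gO H.S" for c
    proof -
      obtain v x where vx: "v \<in> gV H" "x \<in> gO (ind_graph_of h r v)" "c = H.q (Inr (v, x))"
        using c by (auto simp: H.S_simps(4))
      have x: "x \<in> gO (ind_graph_of k r (snd j v))" using vx gr by simp
      have "(v, src (ind_graph_of h r v) x) \<in> gV H.S"
        using vx directed_graphD(6)[OF H.dK] by (simp add: H.S_simps(2))
      moreover have "fst i c = K.q (Inr (snd j v, x))"
        using i_q[of "Inr (v, x)"] vx H.K_subset(4) by (simp add: m)
      ultimately show ?thesis
        using x vx(1) jV K.src_S[OF jV x] H.src_S[OF vx(1,2)] i_v gr vx(3) by (auto simp: K.S_simps(4))
    qed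
  qed
  have inj: "inj_on (snd i) (gV H.S)"
    using embeddingD(4)[OF j] i_v by (auto simp: inj_on_def H.S_simps(2))
  \<comment> \<open>If the smaller result is a nodeless loop, so is \<open>G'\<close>, whence
    \<open>K.S\<close> has no vertices. It remains to exclude inputs of \<open>K\<close>:
    \<open>H\<close> has no boundary, so it is a nodeless loop or closed in
    \<open>K\<close>.\<close>
  have loop: "nodeless_loop K.S" if l: "nodeless_loop H.S"
  proof -
    have "nodeless_loop G'" using embeddingD(5)[OF embH] l by (simp add: H.ind_graph_S)
    then have VK: "gV K.S = {}" using local_mapD(4)[OF K.local_map_ind_map] by (auto simp: nodeless_loop_def)
    have io: "gin H = {}" "gout H = {}" using l by (auto simp: nodeless_loop_def H.S_simps(5,6))
    have "gin K = {}"
    proof (cases "gV H = {}")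
      case True
      then have "nodeless_loop H" using nodeless_loop_iff[OF H.connected_H] io by blast
      then show ?thesis using embeddingD(5)[OF j] by (auto simp: nodeless_loop_def)
    next
      case False
      then show ?thesis using embedding_closed_image[OF j _ io] by blast
    qed
    then show ?thesis using VK nodeless_loop_iff[OF K.connected_S] by (simp add: K.S_simps(5))
  qed
  have "embedding H.S K.S i"
    using li inj loop H.connected_S K.connected_S by (simp add: embedding_def)
  moreover have "ind_map H h f0 r = gcomp H.S (ind_map K k f0 r) i"
    using local_map_eqI[OF H.local_map_ind_map local_map_gcomp[OF li K.local_map_ind_map]] kiE kiV by simp
  ultimately show thesis using that by (simp add: H.ind_graph_S K.ind_graph_S)
qed

section \<open>From graphical maps to pairs\<close>

definition graph_id :: "('e, 'v) dgraph \<Rightarrow> ('e, 'v, 'e, 'v) gmap" where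
  "graph_id G = (\<lambda>e\<in>gE G. e, \<lambda>v\<in>gV G. v)"

lemma graph_iso_id:
  assumes d: "directed_graph G"
  shows "graph_iso G G (graph_id G)"
proof -
  note D = directed_graphD[OF d]
  have bij: "bij_betw (fst (graph_id G)) A A" if "A \<subseteq> gE G" for A
    using that by (intro bij_betw_byWitness[where f' = id]) (auto simp: graph_id_def)
  have bijV: "bij_betw (snd (graph_id G)) (gV G) (gV G)"
    by (rule bij_betw_byWitness[where f' = id]) (auto simp: graph_id_def)
  have "local_map G G (graph_id G)"
    unfolding local_map_iff
  proof (intro conjI ballI d)
    fix v assume "v \<in> gV G"
    then show "bij_betw (fst (graph_id G)) (in_at G v) (in_at G (snd (graph_id G) v))"
      "bij_betw (fst (graph_id G)) (out_at G v) (out_at G (snd (graph_id G) v))"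
      using bij[OF in_at_subset[OF d]] bij[OF out_at_subset[OF d]] by (simp_all add: graph_id_def)
  qed (simp_all add: graph_id_def)
  moreover have "gin G \<subseteq> gE G" "gout G \<subseteq> gE G" using D(8,10) by auto
  ultimately show ?thesis
    using bijV bij D(3,4) unfolding graph_iso_def by (simp add: bij_betw_imp_surj_on)
qed

lemma gcomp_graph_id: "local_map H G h \<Longrightarrow> gcomp H h (graph_id H) = h"
  by (rule local_map_eqI[OF local_map_gcomp[OF graph_isoD(1)[OF graph_iso_id]]])
    (auto simp: graph_id_def local_mapD(1))

lemma embedding_graph_id: "connected_graph G \<Longrightarrow> embedding G G (graph_id G)"
  by (rule graph_iso_embedding[OF graph_iso_id[OF connected_graph_directed]])

text \<open>The sum type keeps inputs and outputs apart: an edge of \<open>G\<close> that both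
  leaves and enters \<open>v\<close> is cut into two edges of the star, with the same image in
  \<open>G\<close>.\<close>

definition star :: "('e, 'v) dgraph \<Rightarrow> 'v \<Rightarrow> ('e + 'e, 'v) dgraph" where
  "star G v = \<lparr>gE = in_at G v <+> out_at G v, gI = Inl ` in_at G v, gV = {v}, gO = Inr ` out_at G v,
     tgt = (\<lambda>x\<in>Inl ` in_at G v. v), src = (\<lambda>x\<in>Inr ` out_at G v. v),
     gin = Inl ` in_at G v, gout = Inr ` out_at G v\<rparr>"

definition star_map :: "('e, 'v) dgraph \<Rightarrow> 'v \<Rightarrow> ('e + 'e, 'v, 'e, 'v) gmap" where
  "star_map G v = (\<lambda>x\<in>gE (star G v). case_sum id id x, \<lambda>u\<in>{v}. u)"

lemma embedding_star:
  assumes c: "connected_graph G" and v: "v \<in> gV G"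
  shows "embedding (star G v) G (star_map G v)"
proof -
  note d = connected_graph_directed[OF c]
  have fin: "finite (in_at G v)" "finite (out_at G v)"
    using in_at_subset[OF d] out_at_subset[OF d] directed_graphD(1)[OF d] by (meson finite_subset)+
  have ds: "directed_graph (star G v)" using fin by (auto simp: directed_graph_def star_def)
  then have cs: "connected_graph (star G v)" by (auto simp: connected_graph_iff star_def)
  have "in_at (star G v) v = Inl ` in_at G v" "out_at (star G v) v = Inr ` out_at G v"
    by (auto simp: in_at_def out_at_def star_def)
  moreover have "bij_betw (fst (star_map G v)) (Inl ` in_at G v) (in_at G v)"
    by (rule bij_betw_byWitness[where f' = Inl]) (auto simp: star_map_def star_def)
  moreover have "bij_betw (fst (star_map G v)) (Inr ` out_at G v) (out_at G v)"
    by (rule bij_betw_byWitness[where f' = Inr]) (auto simp: star_map_def star_def)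
  moreover have "fst (star_map G v) \<in> gE (star G v) \<rightarrow>\<^sub>E gE G" "snd (star_map G v) \<in> gV (star G v) \<rightarrow>\<^sub>E gV G"
    using v in_at_subset[OF d, of v] out_at_subset[OF d, of v]
    by (auto simp: star_map_def star_def)
  moreover have "gV (star G v) = {v}" "snd (star_map G v) v = v" by (simp_all add: star_def star_map_def)
  ultimately have "local_map (star G v) G (star_map G v)"
    using d ds by (simp add: local_map_iff)
  then show ?thesis using c cs by (auto simp: embedding_def nodeless_loop_def star_def)
qed

lemma star_invariants:
  assumes d: "directed_graph G"
  shows map_verts_star: "map_verts (star G v) (star_map G v) = {v}"
    and map_in_star: "map_in (star G v) (star_map G v) = mset_set (in_at G v)"
    and map_out_star: "map_out (star G v) (star_map G v) = mset_set (out_at G v)"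
proof -
  have fin: "finite (in_at G v)" "finite (out_at G v)"
    using in_at_subset[OF d] out_at_subset[OF d] directed_graphD(1)[OF d] by (meson finite_subset)+
  show "map_verts (star G v) (star_map G v) = {v}"
    by (auto simp: map_verts_def star_def star_map_def)
  have "image_mset (fst (star_map G v)) (image_mset Inl (mset_set (in_at G v))) = image_mset id (mset_set (in_at G v))"
    unfolding multiset.map_comp using fin by (intro image_mset_cong) (auto simp: star_map_def star_def)
  then show "map_in (star G v) (star_map G v) = mset_set (in_at G v)"
    by (simp add: map_in_def image_mset_mset_set) (simp add: star_def image_mset_mset_set)
  have "image_mset (fst (star_map G v)) (image_mset Inr (mset_set (out_at G v))) = image_mset id (mset_set (out_at G v))"
    unfolding multiset.map_comp using fin by (intro image_mset_cong) (auto simp: star_map_def star_def)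
  then show "map_out (star G v) (star_map G v) = mset_set (out_at G v)"
    by (simp add: map_out_def image_mset_mset_set) (simp add: star_def image_mset_mset_set)
qed

definition star_class :: "('e, 'v) dgraph \<Rightarrow> 'v \<Rightarrow> ('e, 'v) emb set" where
  "star_class G v = emb_class G (star G v) (star_map G v)"

lemma star_class:
  fixes G :: "('e::infinite, 'v::infinite) dgraph"
  assumes c: "connected_graph G" and v: "v \<in> gV G"
  shows "star_class G v \<in> Emb G" "emb_verts (star_class G v) = {v}"
    "emb_in (star_class G v) = mset_set (in_at G v)" "emb_out (star_class G v) = mset_set (out_at G v)"
  using embedding_star[OF c v] star_invariants[OF connected_graph_directed[OF c]]
  by (simp_all add: star_class_def emb_class_in_Emb emb_verts_class emb_in_class emb_out_class)

section \<open>Isomorphism classes of generator images\<close>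

lemma gen_image_atD:
  assumes "gen_image_at G G' f0 v s"
  shows "connected_graph (gi_graph s)" "local_map (gi_graph s) G' (gi_map s)"
    "gi_in s \<in> extensional (gin (gi_graph s))" "bij_betw (gi_in s) (gin (gi_graph s)) (in_at G v)"
    "gi_out s \<in> extensional (gout (gi_graph s))" "bij_betw (gi_out s) (gout (gi_graph s)) (out_at G v)"
    "\<And>x. x \<in> gin (gi_graph s) \<Longrightarrow> fst (gi_map s) x = f0 (gi_in s x)"
    "\<And>x. x \<in> gout (gi_graph s) \<Longrightarrow> fst (gi_map s) x = f0 (gi_out s x)"
  using assms by (auto simp: gen_image_at_def)

lemma gen_image_at_image:
  assumes "gen_image_at G G' f0 v s"
  shows "fst (gi_map s) ` gin (gi_graph s) = f0 ` in_at G v"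
    "fst (gi_map s) ` gout (gi_graph s) = f0 ` out_at G v"
proof -
  note D = gen_image_atD[OF assms]
  have "fst (gi_map s) ` gin (gi_graph s) = f0 ` gi_in s ` gin (gi_graph s)"
    "fst (gi_map s) ` gout (gi_graph s) = f0 ` gi_out s ` gout (gi_graph s)"
    using D(7,8) by (simp_all add: image_image)
  then show "fst (gi_map s) ` gin (gi_graph s) = f0 ` in_at G v"
    "fst (gi_map s) ` gout (gi_graph s) = f0 ` out_at G v"
    using D(4,6) by (simp_all add: bij_betw_def)
qed

text \<open>Inputs and outputs of an embedded graph are mapped injectively, so the bijections
  of a generator image are determined by its map.\<close>

lemma gen_image_iso_if_verts:
  assumes s: "gen_image_at G G' f0 v s" "embedding (gi_graph s) G' (gi_map s)"
    and t: "gen_image_at G G' f0 v t" "embedding (gi_graph t) G' (gi_map t)"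
    and verts: "gi_verts s = gi_verts t"
  shows "gen_image_iso s t"
proof -
  note S = gen_image_atD[OF s(1)] and T = gen_image_atD[OF t(1)]
  obtain z where z: "graph_iso (gi_graph s) (gi_graph t) z" "gi_map s = gcomp (gi_graph s) (gi_map t) z"
    using embedding_unique[OF s(2) t(2)] verts gen_image_at_image[OF s(1)] gen_image_at_image[OF t(1)]
    by (auto simp: gi_verts_def map_verts_def)
  note Z = graph_isoD[OF z(1)]
  note d = directed_graphD[OF local_mapD(1)[OF Z(1)]]
  have sub: "gin (gi_graph s) \<subseteq> gE (gi_graph s)" "gout (gi_graph s) \<subseteq> gE (gi_graph s)" using d(8,10) by auto
  \<comment> \<open>Through the bijections of \<open>s\<close>, injectivity of the embedding on its
    boundary becomes injectivity of \<open>f0\<close> around \<open>v\<close>. Hence values of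
    \<open>f0\<close> determine the edges of \<open>G\<close> there.\<close>
  have inj: "inj_on f0 (in_at G v)" "inj_on f0 (out_at G v)"
  proof -
    have "inj_on (f0 \<circ> gi_in s) (gin (gi_graph s))" "inj_on (f0 \<circ> gi_out s) (gout (gi_graph s))"
      using embedding_inj_gin[OF s(2)] S(7,8) by (simp_all cong: inj_on_cong)
    then show "inj_on f0 (in_at G v)" "inj_on f0 (out_at G v)"
      using S(4,6) by (metis bij_betw_def inj_on_imageI)+
  qed
  have "gi_in s = compose (gin (gi_graph s)) (gi_in t) (fst z)"
  proof (rule extensionalityI[OF S(3)])
    fix x assume x: "x \<in> gin (gi_graph s)"
    have zx: "fst z x \<in> gin (gi_graph t)" using Z(6) x by blast
    have "f0 (gi_in s x) = f0 (gi_in t (fst z x))"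
      using S(7)[OF x] T(7)[OF zx] gcomp_apply(1)[OF subsetD[OF sub(1) x], of "gi_map t" z]
      by (simp add: z(2))
    then have "gi_in s x = gi_in t (fst z x)"
      using inj(1) bij_betwE[OF S(4)] bij_betwE[OF T(4)] x zx by (meson inj_onD)
    then show "gi_in s x = compose (gin (gi_graph s)) (gi_in t) (fst z) x" using x by (simp add: compose_def)
  qed (simp add: compose_def)
  moreover have "gi_out s = compose (gout (gi_graph s)) (gi_out t) (fst z)"
  proof (rule extensionalityI[OF S(5)])
    fix x assume x: "x \<in> gout (gi_graph s)"
    have zx: "fst z x \<in> gout (gi_graph t)" using Z(7) x by blast
    have "f0 (gi_out s x) = f0 (gi_out t (fst z x))"
      using S(8)[OF x] T(8)[OF zx] gcomp_apply(1)[OF subsetD[OF sub(2) x], of "gi_map t" z]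
      by (simp add: z(2))
    then have "gi_out s x = gi_out t (fst z x)"
      using inj(2) bij_betwE[OF S(6)] bij_betwE[OF T(6)] x zx by (meson inj_onD)
    then show "gi_out s x = compose (gout (gi_graph s)) (gi_out t) (fst z) x" using x by (simp add: compose_def)
  qed (simp add: compose_def)
  ultimately show ?thesis using z unfolding gen_image_iso_def by blast
qed

lemma gen_image_iso_verts: "gen_image_iso s t \<Longrightarrow> gi_verts s = gi_verts t"
  unfolding gen_image_iso_def gi_verts_def using graph_iso_map_invariants(1) by metis

lemma gen_image_iso_embedding:
  assumes "gen_image_iso s t" and t: "embedding (gi_graph t) G' (gi_map t)"
  shows "embedding (gi_graph s) G' (gi_map s)"
proof -
  obtain z where z: "graph_iso (gi_graph s) (gi_graph t) z" "gi_map s = gcomp (gi_graph s) (gi_map t) z"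
    using assms(1) by (auto simp: gen_image_iso_def)
  show ?thesis unfolding z(2)
    by (rule embedding_gcomp[OF graph_iso_embedding[OF z(1) embeddingD(1)[OF t]] t])
qed

lemma gen_image_iso_refl:
  assumes "gen_image_at G G' f0 v s"
  shows "gen_image_iso s s"
proof -
  note S = gen_image_atD[OF assms]
  note d = directed_graphD[OF local_mapD(1)[OF S(2)]]
  have sub: "gin (gi_graph s) \<subseteq> gE (gi_graph s)" "gout (gi_graph s) \<subseteq> gE (gi_graph s)" using d(8,10) by auto
  have "gi_in s = compose (gin (gi_graph s)) (gi_in s) (fst (graph_id (gi_graph s)))"
    "gi_out s = compose (gout (gi_graph s)) (gi_out s) (fst (graph_id (gi_graph s)))"
    using sub S(3,5) by (auto simp: compose_def graph_id_def extensional_def fun_eq_iff subset_iff)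
  then show ?thesis
    using graph_iso_id[OF local_mapD(1)[OF S(2)]] gcomp_graph_id[OF S(2)]
    unfolding gen_image_iso_def by metis
qed

text \<open>The analogue of \<open>emb_with\<close> for generators. The vertex set is the only free
  invariant, as the images of inputs and outputs are prescribed by \<open>f0\<close>; again the
  types are arbitrary.\<close>

definition embedded_images ::
  "('e, 'v) dgraph \<Rightarrow> ('a, 'b) dgraph \<Rightarrow> ('e \<Rightarrow> 'a) \<Rightarrow> 'v \<Rightarrow> 'b set \<Rightarrow> ('k, 'w, 'e, 'a, 'b) gen_image set"
  where "embedded_images G G' f0 v V =
    {s. gen_image_at G G' f0 v s \<and> embedding (gi_graph s) G' (gi_map s) \<and> gi_verts s = V}"

lemma embedded_images_class:
  fixes s :: "('k, 'w, 'e, 'a, 'b) gen_image"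
  assumes s: "s \<in> embedded_images G G' f0 v V"
  shows "embedded_images G G' f0 v V = gen_image_rel G G' f0 v `` {s}"
proof (intro equalityI subsetI)
  fix t :: "('k, 'w, 'e, 'a, 'b) gen_image"
  assume "t \<in> embedded_images G G' f0 v V"
  then show "t \<in> gen_image_rel G G' f0 v `` {s}"
    using s gen_image_iso_if_verts[of G G' f0 v s t] by (simp add: embedded_images_def gen_image_rel_def)
next
  fix t :: "('k, 'w, 'e, 'a, 'b) gen_image"
  assume "t \<in> gen_image_rel G G' f0 v `` {s}"
  then have t: "gen_image_at G G' f0 v t" "gen_image_iso s t" by (auto simp: gen_image_rel_def)
  then obtain z where z: "graph_iso (gi_graph s) (gi_graph t) z" "gi_map s = gcomp (gi_graph s) (gi_map t) z"
    by (auto simp: gen_image_iso_def)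
  note T = gen_image_atD[OF t(1)] and Z = graph_isoD[OF z(1)]
  have es: "embedding (gi_graph s) G' (gi_map s)" using s by (simp add: embedded_images_def)
  \<comment> \<open>The isomorphism runs from \<open>s\<close> to \<open>t\<close>, so the embedding
    property is pushed forward: a composite with the bijection \<open>snd z\<close> is injective,
    hence so is \<open>gi_map t\<close> on vertices.\<close>
  have "inj_on (snd (gi_map t)) (gV (gi_graph t))"
  proof -
    have "inj_on (snd (gi_map t) \<circ> snd z) (gV (gi_graph s))"
      using embeddingD(4)[OF es] z(2) by (simp add: inj_on_def)
    then show ?thesis using Z(3) by (metis bij_betw_def inj_on_imageI)
  qed
  moreover have "nodeless_loop G'" if "nodeless_loop (gi_graph t)"
  proof -
    have "nodeless_loop (gi_graph s)"
      using that Z(3,6) nodeless_loop_iff[OF T(1)] nodeless_loop_iff[OF embeddingD(1)[OF es]]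
      by (auto simp: bij_betw_def)
    then show ?thesis using embeddingD(5)[OF es] by blast
  qed
  ultimately have "embedding (gi_graph t) G' (gi_map t)"
    using T(1,2) embeddingD(2)[OF es] by (simp add: embedding_def)
  then show "t \<in> embedded_images G G' f0 v V"
    using s t gen_image_iso_verts[OF t(2)] by (simp add: embedded_images_def)
qed

text \<open>For a map of wheeled properads the members of \<open>snd f v\<close> are isomorphic over
  the codomain, so the union is over equal sets and no representative has to be chosen.\<close>

definition wp_verts :: "('e, 'v) wp_map \<Rightarrow> 'v \<Rightarrow> 'v set" where
  "wp_verts f v = (\<Union>s\<in>snd f v. gi_verts s)"

section \<open>Graphical maps on generators\<close>

locale wheeled_map =
  fixes G G' :: "('e::infinite, 'v::infinite) dgraph" and f :: "('e, 'v) wp_map"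
  assumes G: "connected_graph G" and G': "connected_graph G'" and f_wp: "f \<in> wp_maps G G'"
begin

lemma f0: "fst f \<in> gE G \<rightarrow>\<^sub>E gE G'"
  using f_wp by (auto simp: wp_maps_def)

lemma f1_ext: "snd f \<in> extensional (gV G)"
  using f_wp by (auto simp: wp_maps_def PiE_iff)

lemma f1_class:
  assumes "v \<in> gV G"
  obtains s where "gen_image_at G G' (fst f) v s" "snd f v = gen_image_rel G G' (fst f) v `` {s}"
    "s \<in> snd f v"
proof -
  have "snd f v \<in> {r. gen_image_at G G' (fst f) v r} // gen_image_rel G G' (fst f) v"
    using f_wp assms by (auto simp: wp_maps_def PiE_iff)
  then obtain s where s: "gen_image_at G G' (fst f) v s" "snd f v = gen_image_rel G G' (fst f) v `` {s}"
    by (auto simp: quotient_def)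
  then show thesis using that gen_image_iso_refl[OF s(1)] by (simp add: gen_image_rel_def)
qed

lemma f1_at: "v \<in> gV G \<Longrightarrow> s \<in> snd f v \<Longrightarrow> gen_image_at G G' (fst f) v s"
  by (erule f1_class) (auto simp: gen_image_rel_def)

lemma family:
  obtains r where "\<forall>v\<in>gV G. r v \<in> snd f v"
proof -
  have "\<forall>v\<in>gV G. \<exists>s. s \<in> snd f v" using f1_class by metis
  then show thesis using that by metis
qed

lemma induced:
  assumes "embedding H G h" "\<forall>v\<in>gV G. r v \<in> snd f v"
  shows "induced H h G G' (fst f) r"
  using embeddingD(1,3)[OF assms(1)] assms(2) f0 f1_at connected_graph_directed[OF G']
  by unfold_locales auto

end

locale graphical_map = wheeled_map G G' f
  for G G' :: "('e::infinite, 'v::infinite) dgraph" and f +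
  assumes graphical: "\<And>(H :: ('e, 'v) dgraph) h r. embedding H G h \<Longrightarrow> \<forall>v\<in>gV G. r v \<in> snd f v \<Longrightarrow>
       embedding (ind_graph H h r) G' (ind_map H h (fst f) r)"

lemma graphical_map_iff:
  "connected_graph G \<Longrightarrow> connected_graph G' \<Longrightarrow> f \<in> graphical_maps G G' \<longleftrightarrow> graphical_map G G' f"
  by (auto simp: graphical_maps_def graphical_map_def wheeled_map_def graphical_map_axioms_def)

context graphical_map
begin

text \<open>The graphical condition is applied to the identity embedding of \<open>G\<close>: its
  induced map puts all the generator images side by side, and injectivity there gives both
  injectivity on each of them and their disjointness.\<close>

lemma f1_inj:
  assumes r: "\<forall>v\<in>gV G. r v \<in> snd f v"
    and v: "v \<in> gV G" "w \<in> gV (gi_graph (r v))" "v' \<in> gV G" "w' \<in> gV (gi_graph (r v'))"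
    and eq: "snd (gi_map (r v)) w = snd (gi_map (r v')) w'"
  shows "v = v' \<and> w = w'"
proof -
  note id = embedding_graph_id[OF G]
  interpret I: induced G "graph_id G" G G' "fst f" r using induced[OF id r] .
  have i: "snd (graph_id G) v = v" if "v \<in> gV G" for v using that by (simp add: graph_id_def)
  have "inj_on (snd (ind_map G (graph_id G) (fst f) r)) (gV I.S)"
    using embeddingD(4)[OF graphical[OF id r]] by (simp add: I.ind_graph_S)
  moreover have "(v, w) \<in> gV I.S" "(v', w') \<in> gV I.S"
    using v i by (simp_all add: I.S_simps(2) ind_graph_of_def)
  moreover have "snd (ind_map G (graph_id G) (fst f) r) (v, w) = snd (ind_map G (graph_id G) (fst f) r) (v', w')"
    using I.ind_map_vert v i eq by simp
  ultimately show ?thesis by (auto dest: inj_onD)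
qed

text \<open>Injectivity comes from \<open>f1_inj\<close>. If the image of the generator is a
  nodeless loop, then \<open>v\<close> has no flags, \<open>G\<close> is an isolated vertex and
  substitution into \<open>G\<close> yields a nodeless loop; the graphical condition passes this on
  to \<open>G'\<close>.\<close>

lemma f1_embedding:
  assumes v: "v \<in> gV G" and s: "s \<in> snd f v"
  shows "embedding (gi_graph s) G' (gi_map s)"
proof -
  note id = embedding_graph_id[OF G]
  obtain r0 where r0: "\<forall>v\<in>gV G. r0 v \<in> snd f v" using family .
  \<comment> \<open>The graphical condition concerns whole families of representatives; this one has
    the given \<open>s\<close> at \<open>v\<close>.\<close>
  define r where "r = r0(v := s)"
  have r: "\<forall>v\<in>gV G. r v \<in> snd f v" and rv: "r v = s" using r0 s by (simp_all add: r_def)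
  note S = gen_image_atD[OF f1_at[OF v s]]
  have "inj_on (snd (gi_map s)) (gV (gi_graph s))"
    using f1_inj[OF r v _ v] rv by (auto simp: inj_on_def)
  moreover have "nodeless_loop G'" if l: "nodeless_loop (gi_graph s)"
  proof -
    interpret I: induced G "graph_id G" G G' "fst f" r using induced[OF id r] .
    have io: "gV (gi_graph s) = {}" "gin (gi_graph s) = {}" "gout (gi_graph s) = {}"
      using l by (auto simp: nodeless_loop_def)
    have at: "in_at G v = {}" "out_at G v = {}" using S(4,6) io by (auto simp: bij_betw_def)
    \<comment> \<open>No edge touches \<open>v\<close>, so colouring \<open>v\<close> alone is
      admissible and connectedness leaves nothing else in \<open>G\<close>.\<close>
    have "(\<forall>e\<in>gE G. False) \<and> (\<forall>u\<in>gV G. u = v) \<or> (\<forall>e\<in>gE G. \<not> False) \<and> (\<forall>u\<in>gV G. u \<noteq> v)"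
      by (rule connected_graph_colour[OF G, of "\<lambda>_. False" "\<lambda>u. u = v"])
        (use at in \<open>auto simp: in_at_def out_at_def\<close>)
    then have GE: "gE G = {}" "gV G = {v}" using v by auto
    have "ind_graph_of (graph_id G) r v = gi_graph s"
      using v rv by (simp add: ind_graph_of_def graph_id_def)
    moreover have "gin G = {}"
      using GE(1) directed_graphD(8)[OF connected_graph_directed[OF G]] by simp
    ultimately have "gV I.S = {}" "gin I.S = {}"
      unfolding I.S_simps GE(2) using io(1) by auto
    then have "nodeless_loop I.S" using nodeless_loop_iff[OF I.connected_S] by blast
    then show ?thesis using embeddingD(5)[OF graphical[OF id r]] by (simp add: I.ind_graph_S)
  qed
  ultimately show ?thesis using S(1,2) G' by (simp add: embedding_def)
qed

lemma f1_eq: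
  assumes v: "v \<in> gV G"
  shows "snd f v = embedded_images G G' (fst f) v (wp_verts f v)" "wp_verts f v \<subseteq> gV G'"
proof -
  obtain s where s: "gen_image_at G G' (fst f) v s" "snd f v = gen_image_rel G G' (fst f) v `` {s}"
    "s \<in> snd f v" using f1_class[OF v] .
  have "gi_verts t = gi_verts s" if "t \<in> snd f v" for t
    using that s(2) gen_image_iso_verts[of s t] by (simp add: gen_image_rel_def)
  then have w: "wp_verts f v = gi_verts s" unfolding wp_verts_def using s(3) by blast
  have "s \<in> embedded_images G G' (fst f) v (wp_verts f v)"
    using s(1) f1_embedding[OF v s(3)] w by (simp add: embedded_images_def)
  from embedded_images_class[OF this] s(2)
  show "snd f v = embedded_images G G' (fst f) v (wp_verts f v)" by simp
  show "wp_verts f v \<subseteq> gV G'"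
    unfolding w gi_verts_def map_verts_def using local_mapD(4)[OF gen_image_atD(2)[OF s(1)]] by auto
qed

lemma gi_verts_f1: "v \<in> gV G \<Longrightarrow> s \<in> snd f v \<Longrightarrow> gi_verts s = wp_verts f v"
  using f1_eq(1) by (auto simp: embedded_images_def)

lemma f1_disjoint:
  assumes "u \<in> gV G" "v \<in> gV G" "u \<noteq> v"
  shows "wp_verts f u \<inter> wp_verts f v = {}"
proof -
  obtain r where r: "\<forall>v\<in>gV G. r v \<in> snd f v" using family .
  then have "wp_verts f u = gi_verts (r u)" "wp_verts f v = gi_verts (r v)"
    using gi_verts_f1 assms by simp_all
  then show ?thesis using f1_inj[OF r] assms by (auto simp: gi_verts_def map_verts_def)
qed

end

section \<open>The pair of a graphical map\<close>

lemma emb_verts_subset: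
  fixes G :: "('e::infinite, 'v::infinite) dgraph"
  assumes "X \<in> Emb G"
  shows "emb_verts X \<subseteq> gV G"
proof -
  obtain H :: "('e, 'v) dgraph" and h where h: "embedding H G h" "X = emb_class G H h"
    using EmbE[OF assms] .
  then show ?thesis
    using local_mapD(4)[OF embeddingD(3)[OF h(1)]] by (auto simp: emb_verts_class map_verts_def)
qed

text \<open>The value is described by the invariants that the induced map must have, which avoids
  choices. For a graphical map, \<open>pair_of_class\<close> identifies it with the class of the
  substituted graph.\<close>

definition pair_of ::
  "('e, 'v) dgraph \<Rightarrow> ('e, 'v) dgraph \<Rightarrow> ('e, 'v) wp_map \<Rightarrow> ('e, 'v) fpair" where
  "pair_of G G' f = (fst f,
     \<lambda>X\<in>Emb G. emb_with G' (\<Union>v\<in>emb_verts X. wp_verts f v) (image_mset (fst f) (emb_in X)))"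

context graphical_map
begin

lemma pair_of_class:
  assumes h: "embedding H G h" and r: "\<forall>v\<in>gV G. r v \<in> snd f v"
  shows "snd (pair_of G G' f) (emb_class G H h) =
    emb_class G' (ind_graph H h r) (ind_map H h (fst f) r)"
proof -
  interpret I: induced H h G G' "fst f" r using induced[OF h r] .
  have "map_verts H h \<subseteq> gV G" using local_mapD(4)[OF I.h] by (auto simp: map_verts_def)
  then have "(\<Union>u\<in>map_verts H h. gi_verts (r u)) = (\<Union>u\<in>map_verts H h. wp_verts f u)"
    using r by (intro SUP_cong refl gi_verts_f1) auto
  then show ?thesis
    using emb_class_in_Emb[OF h] emb_verts_class[OF h] emb_in_class[OF h]
      I.map_verts_ind I.map_in_ind
    by (simp add: pair_of_def emb_class_def[of G'] I.ind_graph_S)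
qed

lemma pair_of_Emb:
  assumes X: "X \<in> Emb G"
  shows "snd (pair_of G G' f) X \<in> Emb G'"
    "emb_verts (snd (pair_of G G' f) X) = (\<Union>v\<in>emb_verts X. wp_verts f v)"
    "emb_in (snd (pair_of G G' f) X) = image_mset (fst f) (emb_in X)"
    "emb_out (snd (pair_of G G' f) X) = image_mset (fst f) (emb_out X)"
proof -
  obtain r where r: "\<forall>v\<in>gV G. r v \<in> snd f v" using family .
  obtain H :: "('e, 'v) dgraph" and h where h: "embedding H G h" "X = emb_class G H h" using EmbE[OF X] .
  interpret I: induced H h G G' "fst f" r using induced[OF h(1) r] .
  note e = graphical[OF h(1) r]
  have "map_verts H h \<subseteq> gV G" using local_mapD(4)[OF I.h] by (auto simp: map_verts_def)
  then have "(\<Union>u\<in>map_verts H h. gi_verts (r u)) = (\<Union>u\<in>map_verts H h. wp_verts f u)"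
    using r by (intro SUP_cong refl gi_verts_f1) auto
  then show "snd (pair_of G G' f) X \<in> Emb G'"
    "emb_verts (snd (pair_of G G' f) X) = (\<Union>v\<in>emb_verts X. wp_verts f v)"
    "emb_in (snd (pair_of G G' f) X) = image_mset (fst f) (emb_in X)"
    "emb_out (snd (pair_of G G' f) X) = image_mset (fst f) (emb_out X)"
    unfolding h(2) pair_of_class[OF h(1) r] using emb_class_in_Emb[OF e] emb_verts_class[OF e]
      emb_in_class[OF e] emb_out_class[OF e] emb_verts_class[OF h(1)] emb_in_class[OF h(1)]
      emb_out_class[OF h(1)] I.map_verts_ind I.map_in_ind I.map_out_ind
    by (simp_all add: I.ind_graph_S)
qed

lemma pair_of_mono:
  assumes X: "X \<in> Emb G" and Y: "Y \<in> Emb G" and le: "emb_le X Y"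
  shows "emb_le (snd (pair_of G G' f) X) (snd (pair_of G G' f) Y)"
proof -
  obtain r where r: "\<forall>v\<in>gV G. r v \<in> snd f v" using family .
  obtain H K :: "('e, 'v) dgraph" and h k j where h: "embedding H G h" "X = emb_class G H h"
    and k: "embedding K G k" "Y = emb_class G K k" and j: "embedding H K j" "h = gcomp H k j"
    using emb_leD[OF le X Y] .
  note eh = graphical[OF h(1) r] and ek = graphical[OF k(1) r]
  obtain i where "embedding (ind_graph H h r) (ind_graph K k r) i"
    "ind_map H h (fst f) r = gcomp (ind_graph H h r) (ind_map K k (fst f) r) i"
    using ind_map_mono[OF induced[OF h(1) r] induced[OF k(1) r] j eh] .
  then show ?thesis
    unfolding h(2) k(2) pair_of_class[OF h(1) r] pair_of_class[OF k(1) r]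
    by (rule emb_leI[OF eh ek])
qed

lemma pair_of_in_pair_maps: "pair_of G G' f \<in> pair_maps G G'"
proof -
  let ?p = "snd (pair_of G G' f)"
  have "?p \<in> Emb G \<rightarrow>\<^sub>E Emb G'"
    using pair_of_Emb(1) by (auto simp: PiE_iff) (simp add: pair_of_def)
  moreover have "emb_is_edge (?p X)" if X: "X \<in> Emb G" "emb_is_edge X" for X
    using X emb_is_edge_iff[OF X(1)] emb_is_edge_iff[OF pair_of_Emb(1)[OF X(1)]] pair_of_Emb(2,3)[OF X(1)]
    by simp
  moreover have "emb_union (?p L) (?p H) (?p K)"
    if "L \<in> Emb G" "H \<in> Emb G" "K \<in> Emb G" "emb_union L H K" for L H K
    using that pair_of_mono pair_of_Emb(2) by (auto simp: emb_union_def)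
  moreover have "emb_disjoint (?p H) (?p K)" if "H \<in> Emb G" "K \<in> Emb G" "emb_disjoint H K" for H K
  proof -
    have "u \<noteq> v" if "u \<in> emb_verts H" "v \<in> emb_verts K" for u v
      using that \<open>emb_disjoint H K\<close> by (auto simp: emb_disjoint_def)
    then have "wp_verts f u \<inter> wp_verts f v = {}" if "u \<in> emb_verts H" "v \<in> emb_verts K" for u v
      using that f1_disjoint emb_verts_subset \<open>H \<in> Emb G\<close> \<open>K \<in> Emb G\<close> by blast
    then show ?thesis using pair_of_Emb(2) that(1,2) by (auto simp: emb_disjoint_def)
  qed
  moreover have "fst (pair_of G G' f) = fst f" by (simp add: pair_of_def)
  ultimately show ?thesis
    using f0 pair_of_Emb(3,4) unfolding pair_maps_def by (simp add: case_prod_unfold)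
qed

lemma wp_verts_star:
  "v \<in> gV G \<Longrightarrow> wp_verts f v = emb_verts (snd (pair_of G G' f) (star_class G v))"
  using pair_of_Emb(2)[OF star_class(1)[OF G]] star_class(2)[OF G] by simp

end

lemma pair_of_inj:
  fixes G G' :: "('e::infinite, 'v::infinite) dgraph"
  assumes G: "connected_graph G" "connected_graph G'"
  shows "inj_on (pair_of G G') (graphical_maps G G')"
proof (rule inj_onI)
  fix f g assume fg: "f \<in> graphical_maps G G'" "g \<in> graphical_maps G G'" "pair_of G G' f = pair_of G G' g"
  interpret f: graphical_map G G' f using fg(1) graphical_map_iff[OF G] by blast
  interpret g: graphical_map G G' g using fg(2) graphical_map_iff[OF G] by blast
  have 0: "fst f = fst g" using fg(3) by (simp add: pair_of_def)
  moreover have "snd f = snd g"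
  proof (rule extensionalityI[OF f.f1_ext g.f1_ext])
    fix v assume v: "v \<in> gV G"
    show "snd f v = snd g v"
      using f.f1_eq(1)[OF v] g.f1_eq(1)[OF v] f.wp_verts_star[OF v] g.wp_verts_star[OF v] fg(3) 0 by simp
  qed
  ultimately show "f = g" by (rule prod_eqI)
qed

section \<open>From pairs to graphical maps\<close>

lemma map_gcomp:
  assumes "directed_graph H"
  shows "map_verts H (gcomp H k f) = snd k ` map_verts H f"
    "map_in H (gcomp H k f) = image_mset (fst k) (map_in H f)"
proof -
  note d = directed_graphD[OF assms]
  show "map_verts H (gcomp H k f) = snd k ` map_verts H f"
    by (simp add: map_verts_def image_image cong: image_cong)
  show "map_in H (gcomp H k f) = image_mset (fst k) (map_in H f)"
    unfolding map_in_def multiset.map_comp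
    using d(8,12) by (intro image_mset_cong) (auto simp: subset_iff)
qed

text \<open>The star of \<open>H\<close> at \<open>v\<close>, composed with \<open>h\<close>, has
  the same vertex and the same inputs as the star of \<open>G\<close> at the image of
  \<open>v\<close>, so the two classes coincide.\<close>

lemma star_le:
  fixes G :: "('e::infinite, 'v::infinite) dgraph"
  assumes h: "embedding H G h" and v: "v \<in> gV H"
  shows "emb_le (star_class G (snd h v)) (emb_class G H h)"
proof -
  note lh = embeddingD(3)[OF h]
  note dH = local_mapD(1)[OF lh] and dG = local_mapD(2)[OF lh]
  note s = embedding_star[OF embeddingD(1)[OF h] v]
  note ds = local_mapD(1)[OF embeddingD(3)[OF s]]
  have "image_mset (fst h) (mset_set (in_at H v)) = mset_set (in_at G (snd h v))"
    using local_mapD(7)[OF lh v] by (simp add: bij_betw_def image_mset_mset_set)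
  then have "emb_class G (star H v) (gcomp (star H v) h (star_map H v)) = star_class G (snd h v)"
    unfolding star_class_def
    by (intro emb_class_eq) (simp_all add: map_gcomp[OF ds] star_invariants[OF dH] star_invariants[OF dG])
  then show ?thesis using emb_leI[OF embedding_gcomp[OF s h] h s refl] by simp
qed

section \<open>Full subgraphs\<close>

lemma local_map_incl:
  assumes F: "directed_graph F" and K: "directed_graph K" and sub: "gE F \<subseteq> gE K" "gV F \<subseteq> gV K"
    and at: "\<And>v. v \<in> gV F \<Longrightarrow> in_at F v = in_at K v" "\<And>v. v \<in> gV F \<Longrightarrow> out_at F v = out_at K v"
  shows "local_map F K (graph_id F)"
proof -
  have bij: "bij_betw (fst (graph_id F)) A A" if "A \<subseteq> gE F" for A
    using that by (intro bij_betw_byWitness[where f' = id]) (auto simp: graph_id_def)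
  have "bij_betw (fst (graph_id F)) (in_at F v) (in_at K (snd (graph_id F) v))"
    "bij_betw (fst (graph_id F)) (out_at F v) (out_at K (snd (graph_id F) v))" if "v \<in> gV F" for v
    using bij[OF in_at_subset[OF F, of v]] bij[OF out_at_subset[OF F, of v]] at that
    by (simp_all add: graph_id_def)
  moreover have "fst (graph_id F) \<in> gE F \<rightarrow>\<^sub>E gE K" "snd (graph_id F) \<in> gV F \<rightarrow>\<^sub>E gV K"
    using sub by (auto simp: graph_id_def)
  ultimately show ?thesis using F K by (simp add: local_map_iff)
qed

text \<open>Edges between vertices of \<open>W\<close> stay joined, so even for a single vertex this
  differs from the star when there are loops at it. The boundary is the one that
  \<open>connected_graph_vertices\<close> forces on a connected graph with vertices.\<close>

definition full_subgraph :: "('e, 'v) dgraph \<Rightarrow> 'v set \<Rightarrow> ('e, 'v) dgraph" where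
  "full_subgraph H W = (let I = {e \<in> gI H. tgt H e \<in> W}; J = {e \<in> gO H. src H e \<in> W}
     in \<lparr>gE = I \<union> J, gI = I, gV = W, gO = J, tgt = restrict (tgt H) I, src = restrict (src H) J,
         gin = I - J, gout = J - I\<rparr>)"

lemma full_subgraph_simps [simp]:
  "gE (full_subgraph H W) = {e \<in> gI H. tgt H e \<in> W} \<union> {e \<in> gO H. src H e \<in> W}"
  "gI (full_subgraph H W) = {e \<in> gI H. tgt H e \<in> W}" "gV (full_subgraph H W) = W"
  "gO (full_subgraph H W) = {e \<in> gO H. src H e \<in> W}"
  "e \<in> gI H \<Longrightarrow> tgt H e \<in> W \<Longrightarrow> tgt (full_subgraph H W) e = tgt H e"
  "e \<in> gO H \<Longrightarrow> src H e \<in> W \<Longrightarrow> src (full_subgraph H W) e = src H e"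
  by (simp_all add: full_subgraph_def Let_def)

lemma full_subgraph_directed:
  assumes H: "directed_graph H" and W: "W \<subseteq> gV H"
  shows "directed_graph (full_subgraph H W)"
proof -
  note d = directed_graphD[OF H]
  have "finite (gI H)" "finite (gO H)" using d(1,3,4) by (auto intro: finite_subset)
  then show ?thesis
    using finite_subset[OF W d(2)] by (auto simp: directed_graph_def full_subgraph_def Let_def)
qed

lemma full_subgraph_at:
  "v \<in> W \<Longrightarrow> in_at (full_subgraph H W) v = in_at H v"
  "v \<in> W \<Longrightarrow> out_at (full_subgraph H W) v = out_at H v"
  by (auto simp: in_at_def out_at_def)

lemma full_subgraph_all:
  assumes c: "connected_graph H" and V: "gV H \<noteq> {}"
  shows "full_subgraph H (gV H) = H"
proof -
  note d = directed_graphD[OF connected_graph_directed[OF c]]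
  have I: "{e \<in> gI H. tgt H e \<in> gV H} = gI H" and J: "{e \<in> gO H. src H e \<in> gV H} = gO H"
    using d(5,6) by auto
  have "restrict (tgt H) (gI H) = tgt H" "restrict (src H) (gO H) = src H"
    using connected_graph_directed[OF c] by (simp_all add: directed_graph_def PiE_iff extensional_restrict)
  then show ?thesis
    unfolding full_subgraph_def Let_def I J
    using connected_graph_vertices[OF c V] by (intro dgraph.equality) simp_all
qed

lemma embedding_full_subgraph:
  assumes H: "directed_graph H" and W: "W \<subseteq> W'" "W' \<subseteq> gV H" "W \<noteq> {}"
    and c: "connected_graph (full_subgraph H W)" "connected_graph (full_subgraph H W')"
  shows "embedding (full_subgraph H W) (full_subgraph H W') (graph_id (full_subgraph H W))"
proof -
  have "local_map (full_subgraph H W) (full_subgraph H W') (graph_id (full_subgraph H W))"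
    using W by (intro local_map_incl full_subgraph_directed[OF H]) (auto simp: full_subgraph_at subset_iff)
  then show ?thesis
    using c W(3) by (auto simp: embedding_def nodeless_loop_def inj_on_def graph_id_def)
qed

lemma embedding_full_subgraph_all:
  assumes c: "connected_graph H" and W: "W \<subseteq> gV H" "W \<noteq> {}" "connected_graph (full_subgraph H W)"
  shows "embedding (full_subgraph H W) H (graph_id (full_subgraph H W))"
proof -
  have "gV H \<noteq> {}" using W by blast
  then show ?thesis
    using embedding_full_subgraph[OF connected_graph_directed[OF c] W(1) subset_refl W(2,3)] c
    by (simp add: full_subgraph_all)
qed

lemma connected_full_subgraph_single:
  assumes H: "directed_graph H" and v: "v \<in> gV H"
  shows "connected_graph (full_subgraph H {v})"
  unfolding connected_graph_iff using full_subgraph_directed[OF H, of "{v}"] v by auto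

lemma connected_full_subgraph_insert:
  assumes H: "directed_graph H" and W: "W \<subseteq> gV H" "connected_graph (full_subgraph H W)"
    and u: "u \<in> gV H" and e: "e \<in> gI H" "e \<in> gO H"
    and adj: "tgt H e \<in> W \<and> src H e = u \<or> src H e \<in> W \<and> tgt H e = u"
  shows "connected_graph (full_subgraph H (insert u W))"
  unfolding connected_graph_iff
proof (intro conjI allI impI)
  let ?F = "full_subgraph H (insert u W)"
  show "directed_graph ?F" using full_subgraph_directed[OF H] W(1) u by simp
  show "gE ?F \<noteq> {} \<or> gV ?F \<noteq> {}" by simp
  fix P :: "'a \<Rightarrow> bool" and Q :: "'b \<Rightarrow> bool"
  assume "\<forall>e\<in>gI ?F. P e = Q (tgt ?F e)" "\<forall>e\<in>gO ?F. P e = Q (src ?F e)"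
  then have t: "\<And>e. e \<in> gI H \<Longrightarrow> tgt H e \<in> insert u W \<Longrightarrow> P e = Q (tgt H e)"
    and s: "\<And>e. e \<in> gO H \<Longrightarrow> src H e \<in> insert u W \<Longrightarrow> P e = Q (src H e)"
    by simp_all
  have "(\<forall>e\<in>gE (full_subgraph H W). P e) \<and> (\<forall>v\<in>gV (full_subgraph H W). Q v) \<or>
      (\<forall>e\<in>gE (full_subgraph H W). \<not> P e) \<and> (\<forall>v\<in>gV (full_subgraph H W). \<not> Q v)"
    by (rule connected_graph_colour[OF W(2)]) (auto simp: t s)
  then obtain c where c: "\<And>v. v \<in> W \<Longrightarrow> Q v = c" by auto
  have "Q u = c" using adj c t[OF e(1)] s[OF e(2)] by auto
  then have Q: "Q v = c" if "v \<in> insert u W" for v using c that by auto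
  moreover have "P e = c" if "e \<in> gE ?F" for e using that t s Q by auto
  ultimately show "(\<forall>e\<in>gE ?F. P e) \<and> (\<forall>v\<in>gV ?F. Q v) \<or> (\<forall>e\<in>gE ?F. \<not> P e) \<and> (\<forall>v\<in>gV ?F. \<not> Q v)"
    unfolding full_subgraph_simps(3) by (cases c) blast+
qed

text \<open>If no edge joins \<open>W\<close> to its complement, membership in \<open>W\<close> for
  vertices and in the full subgraph on \<open>W\<close> for edges is a nonconstant admissible
  colouring.\<close>

lemma exists_edge_leaving:
  assumes c: "connected_graph H" and W: "W \<subseteq> gV H" "W \<noteq> {}" "W \<noteq> gV H"
  obtains u e where "u \<in> gV H - W" "e \<in> gI H" "e \<in> gO H"
    "tgt H e \<in> W \<and> src H e = u \<or> src H e \<in> W \<and> tgt H e = u"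
proof (rule ccontr)
  assume n: "\<not> thesis"
  note leave = that and d = directed_graphD[OF connected_graph_directed[OF c]]
  have no: "tgt H e \<in> W \<longleftrightarrow> src H e \<in> W" if "e \<in> gI H" "e \<in> gO H" for e
    using n leave[of "src H e" e] leave[of "tgt H e" e] d(5)[OF that(1)] d(6)[OF that(2)] that by blast
  let ?F = "full_subgraph H W"
  have "(\<forall>e\<in>gE H. e \<in> gE ?F) \<and> (\<forall>v\<in>gV H. v \<in> W) \<or> (\<forall>e\<in>gE H. e \<notin> gE ?F) \<and> (\<forall>v\<in>gV H. v \<notin> W)"
    by (rule connected_graph_colour[OF c]) (use no in auto)
  then show False using W by blast
qed

text \<open>Here it matters that (4) compares multisets and not sets: the left side has no
  repetitions, so \<open>c\<close> is injective on \<open>B\<close>. The bijections that a generator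
  image must carry arise in this way.\<close>

lemma mset_bijection:
  assumes k: "inj_on k A" "finite B"
    and eq: "image_mset k (mset_set A) = image_mset c (mset_set B)" "finite A"
  shows "bij_betw (\<lambda>x\<in>A. inv_into B c (k x)) A B" "\<And>x. x \<in> A \<Longrightarrow> k x = c (inv_into B c (k x))"
proof -
  have m: "image_mset c (mset_set B) = mset_set (k ` A)" using k(1) eq(1) by (simp add: image_mset_mset_set)
  have im: "c ` B = k ` A" using arg_cong[OF m, of set_mset] k(2) eq(2) by simp
  have "card B = card (c ` B)" using arg_cong[OF m, of size] im by simp
  then have "inj_on c B" using k(2) by (simp add: eq_card_imp_inj_on)
  then have "bij_betw c B (k ` A)" using im by (simp add: bij_betw_def)
  then have "bij_betw (inv_into B c \<circ> k) A B"
    using bij_betw_trans[OF inj_on_imp_bij_betw[OF k(1)] bij_betw_inv_into] by blast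
  then show "bij_betw (\<lambda>x\<in>A. inv_into B c (k x)) A B" by (simp add: comp_def cong: bij_betw_cong)
  show "k x = c (inv_into B c (k x))" if "x \<in> A" for x
    using that im by (simp add: f_inv_into_f)
qed

section \<open>Reconstruction of a graphical map from a pair\<close>

locale pair_map =
  fixes G G' :: "('e::infinite, 'v::infinite) dgraph" and p0 and p
  assumes G: "connected_graph G" and G': "connected_graph G'" and pair: "(p0, p) \<in> pair_maps G G'"
begin

lemma
  shows p0: "p0 \<in> gE G \<rightarrow>\<^sub>E gE G'"
    and p: "p \<in> Emb G \<rightarrow>\<^sub>E Emb G'"
    and p_Emb: "X \<in> Emb G \<Longrightarrow> p X \<in> Emb G'"
    and p_edge: "X \<in> Emb G \<Longrightarrow> emb_is_edge X \<Longrightarrow> emb_is_edge (p X)"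
    and p_union: "L \<in> Emb G \<Longrightarrow> X \<in> Emb G \<Longrightarrow> Y \<in> Emb G \<Longrightarrow> emb_union L X Y \<Longrightarrow>
      emb_union (p L) (p X) (p Y)"
    and p_disjoint: "X \<in> Emb G \<Longrightarrow> Y \<in> Emb G \<Longrightarrow> emb_disjoint X Y \<Longrightarrow> emb_disjoint (p X) (p Y)"
    and p_in: "X \<in> Emb G \<Longrightarrow> emb_in (p X) = image_mset p0 (emb_in X)"
    and p_out: "X \<in> Emb G \<Longrightarrow> emb_out (p X) = image_mset p0 (emb_out X)"
  using pair by (auto simp: pair_maps_def)

lemma p_verts_union:
  assumes "L \<in> Emb G" "X \<in> Emb G" "Y \<in> Emb G" "emb_le X L" "emb_le Y L"
    "emb_verts L = emb_verts X \<union> emb_verts Y"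
  shows "emb_verts (p L) = emb_verts (p X) \<union> emb_verts (p Y)"
  using p_union[OF assms(1-3)] assms(4-6) by (simp add: emb_union_def)

text \<open>A connected graph is built by adding one vertex at a time to a full subgraph, and each
  step is a union with a star.\<close>

lemma p_verts_grow:
  assumes h: "embedding H G h" and W: "W \<subseteq> gV H" "W \<noteq> {}" "connected_graph (full_subgraph H W)"
    and verts: "emb_verts (p (emb_class G (full_subgraph H W)
        (gcomp (full_subgraph H W) h (graph_id (full_subgraph H W))))) =
      (\<Union>v\<in>W. emb_verts (p (star_class G (snd h v))))"
  shows "emb_verts (p (emb_class G H h)) = (\<Union>v\<in>gV H. emb_verts (p (star_class G (snd h v))))"
  using W verts
proof (induction "card (gV H - W)" arbitrary: W rule: less_induct)
  case less
  note c = embeddingD(1)[OF h] and lh = embeddingD(3)[OF h]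
  note dH = connected_graph_directed[OF c]
  let ?F = "full_subgraph H" and ?i = "\<lambda>W. graph_id (full_subgraph H W)"
  show ?case
  proof (cases "W = gV H")
    case True
    then have F: "?F W = H" using full_subgraph_all[OF c] less.prems(2) by simp
    have "gcomp H h (graph_id H) = h" using gcomp_graph_id[OF lh] .
    then show ?thesis using less.prems(4) True unfolding F by simp
  next
    case False
    obtain u e where u: "u \<in> gV H - W" and e: "e \<in> gI H" "e \<in> gO H"
      "tgt H e \<in> W \<and> src H e = u \<or> src H e \<in> W \<and> tgt H e = u"
      using exists_edge_leaving[OF c less.prems(1,2) False] .
    define W' where "W' = insert u W"
    have W': "W' \<subseteq> gV H" "W' \<noteq> {}" "W \<subseteq> W'" using u less.prems(1) by (auto simp: W'_def)
    have cF: "connected_graph (?F W')"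
      unfolding W'_def using connected_full_subgraph_insert[OF dH less.prems(1,3) _ e] u by blast
    note i = embedding_full_subgraph_all[OF c less.prems(1-3)]
      and i' = embedding_full_subgraph_all[OF c W'(1,2) cF]
      and j = embedding_full_subgraph[OF dH W'(3,1) less.prems(2,3) cF]
    note hi = embedding_gcomp[OF i h] and hi' = embedding_gcomp[OF i' h]
    let ?L = "emb_class G (?F W') (gcomp (?F W') h (?i W'))"
    let ?X = "emb_class G (?F W) (gcomp (?F W) h (?i W))"
    have hu: "snd h u \<in> gV G" using local_mapD(4)[OF lh] u by blast
    have i_vert: "snd (?i W) v = v" if "v \<in> W" for W v using that by (simp add: graph_id_def)
    have "gcomp (?F W) h (?i W) = gcomp (?F W) (gcomp (?F W') h (?i W')) (?i W)"
      using W'(3) by (intro local_map_eqI[OF embeddingD(3)[OF hi] local_map_gcomp[OF embeddingD(3)[OF j] embeddingD(3)[OF hi']]])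
        (auto simp: graph_id_def)
    then have le: "emb_le ?X ?L" by (rule emb_leI[OF hi hi' j])
    have "snd (gcomp (?F W') h (?i W')) u = snd h u" using i_vert[of u W'] by (simp add: W'_def)
    then have le': "emb_le (star_class G (snd h u)) ?L"
      using star_le[OF hi', of u] by (simp add: W'_def)
    have V: "map_verts (?F W) (gcomp (?F W) h (?i W)) = snd h ` W" for W
      by (simp add: map_verts_def i_vert cong: image_cong)
    have "emb_verts ?L = emb_verts ?X \<union> emb_verts (star_class G (snd h u))"
      unfolding emb_verts_class[OF hi] emb_verts_class[OF hi'] V star_class(2)[OF G hu]
      by (auto simp: W'_def)
    then have "emb_verts (p ?L) = emb_verts (p ?X) \<union> emb_verts (p (star_class G (snd h u)))"
      using p_verts_union[OF emb_class_in_Emb[OF hi'] emb_class_in_Emb[OF hi] star_class(1)[OF G hu] le le']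
      by blast
    then have "emb_verts (p ?L) = (\<Union>v\<in>W'. emb_verts (p (star_class G (snd h v))))"
      using less.prems(4) by (auto simp: W'_def)
    moreover have "card (gV H - W') < card (gV H - W)"
      using u directed_graphD(2)[OF dH] by (intro psubset_card_mono) (auto simp: W'_def)
    ultimately show ?thesis using less.hyps[OF _ W'(1,2) cF] by blast
  qed
qed

text \<open>With \<open>p_verts_grow\<close> at hand, only the base cases need work: graphs without
  vertices, where (1) speaks of edges but not of nodeless loops, and a single vertex, where the full
  subgraph need not be the star.\<close>

lemma p_verts_class:
  fixes H :: "('e, 'v) dgraph"
  assumes h: "embedding H G h"
  shows "emb_verts (p (emb_class G H h)) = (\<Union>v\<in>gV H. emb_verts (p (star_class G (snd h v))))"
proof -
  note c = embeddingD(1)[OF h] and lh = embeddingD(3)[OF h]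
  note dH = connected_graph_directed[OF c]
  show ?thesis
  proof (cases "gV H = {}")
    case True
    obtain e where e: "gE H = {e}" "gI H = {}" "gO H = {}" "gout H = gin H"
      using connected_graph_no_vertices[OF c True] .
    \<comment> \<open>The edge graph with the same underlying diagram as \<open>H\<close>; it embeds
      in \<open>H\<close> even if \<open>H\<close> is a nodeless loop.\<close>
    define P where "P = H\<lparr>gin := {e}, gout := {e}\<rparr>"
    have P: "gE P = {e}" "gI P = {}" "gO P = {}" "gV P = {}" "gin P = {e}" "gout P = {e}"
      using e True by (simp_all add: P_def)
    have "directed_graph P" using dH e P by (auto simp: directed_graph_def P_def)
    then have "edge_graph P" using P by (auto simp: edge_graph_def)
    then have cP: "connected_graph P" by (rule edge_graph_connected)
    have "local_map P H (graph_id P)"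
      using P e cP dH by (intro local_map_incl) (auto simp: connected_graph_directed)
    then have j: "embedding P H (graph_id P)"
      using cP c P by (auto simp: embedding_def nodeless_loop_def)
    note hj = embedding_gcomp[OF j h]
    let ?X = "emb_class G P (gcomp P h (graph_id P))"
    note X = emb_class_in_Emb[OF hj]
    have V: "emb_verts ?X = {}" "emb_verts (emb_class G H h) = {}"
      using P True by (simp_all add: emb_verts_class[OF hj] emb_verts_class[OF h])
    have "emb_in ?X \<noteq> {#}"
      using P(5) by (simp add: emb_in_class[OF hj] map_in_def)
    then have "emb_is_edge ?X" using emb_is_edge_iff[OF X] V by simp
    then have "emb_verts (p ?X) = {}" using p_edge[OF X] emb_is_edge_iff[OF p_Emb[OF X]] by blast
    \<comment> \<open>With no vertices on either side, the class of \<open>H\<close> is a union of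
      the edge class with itself. By (2) its image has no vertices, even if \<open>H\<close> is a
      nodeless loop.\<close>
    moreover have "emb_verts (p (emb_class G H h)) = emb_verts (p ?X) \<union> emb_verts (p ?X)"
      using p_verts_union[OF emb_class_in_Emb[OF h] X X] emb_leI[OF hj h j refl] V by simp
    ultimately show ?thesis using True by simp
  next
    case False
    then obtain v where v: "v \<in> gV H" by blast
    let ?F = "full_subgraph H {v}"
    have vW: "{v} \<subseteq> gV H" using v by simp
    have cF: "connected_graph ?F" using connected_full_subgraph_single[OF dH v] .
    note hi = embedding_gcomp[OF embedding_full_subgraph_all[OF c vW _ cF] h]
    let ?X = "emb_class G ?F (gcomp ?F h (graph_id ?F))"
    have hv: "snd h v \<in> gV G" using local_mapD(4)[OF lh v] .
    have hiv: "snd (gcomp ?F h (graph_id ?F)) v = snd h v" by (simp add: graph_id_def)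
    have X: "?X \<in> Emb G" using emb_class_in_Emb hi by blast
    have le: "emb_le (star_class G (snd h v)) ?X"
      using star_le[OF hi, of v] hiv by simp
    have "emb_verts ?X = {snd h v}"
      using emb_verts_class[OF hi] hiv by (simp add: map_verts_def)
    \<comment> \<open>\<open>?X\<close> may join loops at \<open>v\<close> that the star cuts, so
      the classes can differ. But \<open>?X\<close> is a union of the star with itself, which is
      enough to compare the vertices of the images.\<close>
    then have "emb_verts (p ?X) = emb_verts (p (star_class G (snd h v)))"
      using p_verts_union[OF X star_class(1)[OF G hv] star_class(1)[OF G hv] le le] star_class(2)[OF G hv]
      by simp
    then show ?thesis using p_verts_grow[OF h vW _ cF] by simp
  qed
qed

lemma p_verts:
  assumes X: "X \<in> Emb G"
  shows "emb_verts (p X) = (\<Union>v\<in>emb_verts X. emb_verts (p (star_class G v)))"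
proof -
  obtain H :: "('e, 'v) dgraph" and h where h: "embedding H G h" "X = emb_class G H h" using EmbE[OF X] .
  show ?thesis unfolding h(2) p_verts_class[OF h(1)] emb_verts_class[OF h(1)] by (simp add: map_verts_def)
qed

definition gens :: "'v \<Rightarrow> ('e, 'v, 'e, 'e, 'v) gen_image set" where
  "gens v = embedded_images G G' p0 v (emb_verts (p (star_class G v)))"

lemma gens_nonempty:
  assumes v: "v \<in> gV G"
  obtains s where "s \<in> gens v"
proof -
  note st = star_class[OF G v]
  obtain K :: "('e, 'v) dgraph" and k where k: "embedding K G' k" "p (star_class G v) = emb_class G' K k"
    using EmbE[OF p_Emb[OF st(1)]] .
  note dK = directed_graphD[OF connected_graph_directed[OF embeddingD(1)[OF k(1)]]]
  have m_in: "image_mset (fst k) (mset_set (gin K)) = image_mset p0 (mset_set (in_at G v))"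
    using p_in[OF st(1)] unfolding k(2) emb_in_class[OF k(1)] st(3) by (simp add: map_in_def)
  have m_out: "image_mset (fst k) (mset_set (gout K)) = image_mset p0 (mset_set (out_at G v))"
    using p_out[OF st(1)] unfolding k(2) emb_out_class[OF k(1)] st(4) by (simp add: map_out_def)
  note dG = connected_graph_directed[OF G]
  have fin: "finite (in_at G v)" "finite (out_at G v)"
    using in_at_subset[OF dG] out_at_subset[OF dG] directed_graphD(1)[OF dG] by (meson finite_subset)+
  define s where "s = \<lparr>gi_graph = K, gi_map = k,
    gi_in = (\<lambda>x\<in>gin K. inv_into (in_at G v) p0 (fst k x)),
    gi_out = (\<lambda>x\<in>gout K. inv_into (out_at G v) p0 (fst k x))\<rparr>"
  have "gen_image_at G G' p0 v s"
    using embeddingD(1,3)[OF k(1)]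
      mset_bijection[OF embedding_inj_gin(1)[OF k(1)] fin(1) m_in dK(12)]
      mset_bijection[OF embedding_inj_gin(2)[OF k(1)] fin(2) m_out dK(13)]
    by (simp add: gen_image_at_def s_def)
  moreover have "gi_verts s = emb_verts (p (star_class G v))"
    unfolding k(2) emb_verts_class[OF k(1)] by (simp add: gi_verts_def s_def)
  ultimately have "s \<in> gens v" using k(1) by (simp add: gens_def embedded_images_def s_def)
  then show thesis using that by blast
qed

definition wp_of_pair :: "('e, 'v) wp_map" where
  "wp_of_pair = (p0, \<lambda>v\<in>gV G. gens v)"

lemma wp_of_pair_wp: "wp_of_pair \<in> wp_maps G G'"
proof -
  have "gens v \<in> {r. gen_image_at G G' p0 v r} // gen_image_rel G G' p0 v" if v: "v \<in> gV G" for v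
  proof -
    obtain s where s: "s \<in> gens v" using gens_nonempty[OF v] .
    have "gens v = gen_image_rel G G' p0 v `` {s}" "s \<in> {r. gen_image_at G G' p0 v r}"
      using s embedded_images_class[of s G G' p0 v] by (simp_all add: gens_def embedded_images_def)
    then show ?thesis by (simp only: quotientI)
  qed
  then show ?thesis using p0 by (simp add: wp_maps_def wp_of_pair_def)
qed

lemma wheeled: "wheeled_map G G' wp_of_pair"
  using G G' wp_of_pair_wp by (simp add: wheeled_map_def)

lemma wp_verts_wp_of_pair:
  assumes v: "v \<in> gV G"
  shows "wp_verts wp_of_pair v = emb_verts (p (star_class G v))"
proof -
  have "gens v \<noteq> {}" using gens_nonempty[OF v] by blast
  then have "(\<Union>s\<in>gens v. gi_verts s) = emb_verts (p (star_class G v))"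
    by (rule SUP_eq_const) (simp add: gens_def embedded_images_def)
  then show ?thesis using v by (simp add: wp_verts_def wp_of_pair_def)
qed

text \<open>Two vertices of the substituted graph with the same image come from one generator, since
  (3) makes images of distinct stars disjoint, and then coincide, since the image of a star is an
  embedding.\<close>

lemma graphical_wp_of_pair: "graphical_map G G' wp_of_pair"
proof -
  interpret w: wheeled_map G G' wp_of_pair by (rule wheeled)
  have fst: "fst wp_of_pair = p0" by (simp add: wp_of_pair_def)
  have "embedding (ind_graph H h r) G' (ind_map H h (fst wp_of_pair) r)"
    if h: "embedding H G h" and r: "\<forall>v\<in>gV G. r v \<in> snd wp_of_pair v"
    for H :: "('e, 'v) dgraph" and h r
  proof -
    interpret I: induced H h G G' "fst wp_of_pair" r using w.induced[OF h r] .
    have r': "embedding (gi_graph (r u)) G' (gi_map (r u))" "gi_verts (r u) = emb_verts (p (star_class G u))"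
      if "u \<in> gV G" for u
      using r that by (auto simp: wp_of_pair_def gens_def embedded_images_def)
    have "inj_on (snd (ind_map H h (fst wp_of_pair) r)) (gV I.S)"
    proof (rule inj_onI, clarify)
      fix v w v' w' assume vw: "(v, w) \<in> gV I.S" "(v', w') \<in> gV I.S"
        and "snd (ind_map H h (fst wp_of_pair) r) (v, w) = snd (ind_map H h (fst wp_of_pair) r) (v', w')"
      then have v: "v \<in> gV H" "w \<in> gV (gi_graph (r (snd h v)))"
        and v': "v' \<in> gV H" "w' \<in> gV (gi_graph (r (snd h v')))"
        and eq: "snd (gi_map (r (snd h v))) w = snd (gi_map (r (snd h v'))) w'"
        using I.ind_map_vert by (auto simp: I.S_simps(2) ind_graph_of_def)
      note hv = I.h_vert[OF v(1)] and hv' = I.h_vert[OF v'(1)]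
      have "snd h v = snd h v'"
      proof (rule ccontr)
        assume "snd h v \<noteq> snd h v'"
        then have "emb_disjoint (star_class G (snd h v)) (star_class G (snd h v'))"
          by (simp add: emb_disjoint_def star_class(2)[OF G hv] star_class(2)[OF G hv'])
        then have "gi_verts (r (snd h v)) \<inter> gi_verts (r (snd h v')) = {}"
          using p_disjoint[OF star_class(1)[OF G hv] star_class(1)[OF G hv']] r'(2)[OF hv] r'(2)[OF hv']
          by (simp add: emb_disjoint_def)
        then show False using v(2) v'(2) eq unfolding gi_verts_def map_verts_def
          by (metis IntI empty_iff imageI)
      qed
      then have "v = v'" using embeddingD(4)[OF h] v(1) v'(1) by (auto dest: inj_onD)
      then show "v = v' \<and> w = w'"
        using embeddingD(4)[OF r'(1)[OF hv]] v v' eq by (auto dest: inj_onD)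
    qed
    \<comment> \<open>The embedding that represents the value of \<open>p\<close> at
      \<open>h\<close> has the vertices and inputs of the induced map. So its domain is a nodeless
      loop too, and being an embedding it passes this on to \<open>G'\<close>.\<close>
    moreover have "nodeless_loop G'" if l: "nodeless_loop I.S"
    proof -
      let ?X = "emb_class G H h"
      note X = emb_class_in_Emb[OF h]
      obtain K :: "('e, 'v) dgraph" and k where k: "embedding K G' k" "p ?X = emb_class G' K k"
        using EmbE[OF p_Emb[OF X]] .
      have S0: "map_verts I.S (ind_map H h (fst wp_of_pair) r) = {}" "map_in I.S (ind_map H h (fst wp_of_pair) r) = {#}"
        using l nodeless_loop_iff_map[OF I.connected_S, of "ind_map H h (fst wp_of_pair) r"] by simp_all
      have "gi_verts (r (snd h v)) = emb_verts (p (star_class G (snd h v)))" if "v \<in> gV H" for v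
        using r'(2)[OF I.h_vert[OF that]] .
      then have "emb_verts (p ?X) = {}"
        using S0(1) unfolding I.map_verts_ind p_verts_class[OF h] by (simp add: map_verts_def)
      moreover have "emb_in (p ?X) = {#}"
        using S0(2) I.map_in_ind p_in[OF X] emb_in_class[OF h] fst by simp
      ultimately have "nodeless_loop K"
        unfolding k(2) emb_verts_class[OF k(1)] emb_in_class[OF k(1)]
        using nodeless_loop_iff_map[OF embeddingD(1)[OF k(1)], of k] by simp
      then show ?thesis using embeddingD(5)[OF k(1)] by blast
    qed
    ultimately show ?thesis
      using I.local_map_ind_map I.connected_S G' by (simp add: embedding_def I.ind_graph_S)
  qed
  then show ?thesis using wheeled by (simp add: graphical_map_def graphical_map_axioms_def)
qed

lemma pair_of_wp_of_pair: "pair_of G G' wp_of_pair = (p0, p)"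
proof -
  interpret w: graphical_map G G' wp_of_pair by (rule graphical_wp_of_pair)
  have fst: "fst wp_of_pair = p0" by (simp add: wp_of_pair_def)
  have "snd (pair_of G G' wp_of_pair) X = p X" if X: "X \<in> Emb G" for X
  proof (rule Emb_eqI[OF w.pair_of_Emb(1)[OF X] p_Emb[OF X]])
    have "(\<Union>v\<in>emb_verts X. wp_verts wp_of_pair v) = (\<Union>v\<in>emb_verts X. emb_verts (p (star_class G v)))"
      using emb_verts_subset[OF X] by (intro SUP_cong refl wp_verts_wp_of_pair) auto
    then show "emb_verts (snd (pair_of G G' wp_of_pair) X) = emb_verts (p X)"
      using w.pair_of_Emb(2)[OF X] p_verts[OF X] by simp
    show "emb_in (snd (pair_of G G' wp_of_pair) X) = emb_in (p X)"
      using w.pair_of_Emb(3)[OF X] p_in[OF X] fst by simp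
  qed
  moreover have "snd (pair_of G G' wp_of_pair) \<in> extensional (Emb G)" by (simp add: pair_of_def)
  moreover have "p \<in> extensional (Emb G)" using p by (simp add: PiE_iff)
  ultimately have "snd (pair_of G G' wp_of_pair) = p" by (intro extensionalityI)
  moreover have "fst (pair_of G G' wp_of_pair) = p0" by (simp add: pair_of_def fst)
  ultimately show ?thesis by (metis prod.collapse)
qed

end

lemma bij_betw_pair_of:
  fixes G G' :: "('e::infinite, 'v::infinite) dgraph"
  assumes G: "connected_graph G" "connected_graph G'"
  shows "bij_betw (pair_of G G') (graphical_maps G G') (pair_maps G G')"
  unfolding bij_betw_def
proof (intro conjI equalityI subsetI pair_of_inj[OF G])
  fix x assume "x \<in> pair_of G G' ` graphical_maps G G'"
  then show "x \<in> pair_maps G G'"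
    using graphical_map.pair_of_in_pair_maps graphical_map_iff[OF G] by blast
next
  fix x assume x: "x \<in> pair_maps G G'"
  obtain p0 p where "x = (p0, p)" by (cases x)
  then interpret pair_map G G' p0 p using G x by unfold_locales auto
  have "wp_of_pair \<in> graphical_maps G G'"
    using graphical_map_iff[OF assms] graphical_wp_of_pair by blast
  then show "x \<in> pair_of G G' ` graphical_maps G G'"
    using pair_of_wp_of_pair \<open>x = (p0, p)\<close> by (metis imageI)
qed

section \<open>Composition\<close>

lemma emb_in_subset:
  fixes G :: "('e::infinite, 'v::infinite) dgraph"
  assumes X: "X \<in> Emb G"
  shows "set_mset (emb_in X) \<subseteq> gE G" "set_mset (emb_out X) \<subseteq> gE G"
proof -
  obtain H :: "('e, 'v) dgraph" and h where h: "embedding H G h" "X = emb_class G H h" using EmbE[OF X] .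
  note lh = embeddingD(3)[OF h(1)]
  note d = directed_graphD[OF local_mapD(1)[OF lh]]
  have "fst h ` gE H \<subseteq> gE G" using local_mapD(3)[OF lh] by blast
  then show "set_mset (emb_in X) \<subseteq> gE G" "set_mset (emb_out X) \<subseteq> gE G"
    unfolding h(2) emb_in_class[OF h(1)] emb_out_class[OF h(1)]
      set_mset_map_in[OF local_mapD(1)[OF lh]] set_mset_map_out[OF local_mapD(1)[OF lh]]
    using d(8,10) by blast+
qed

lemma pair_comp_in_pair_maps:
  fixes G G' G'' :: "('e::infinite, 'v::infinite) dgraph"
  assumes P: "P \<in> pair_maps G G'" and Q: "Q \<in> pair_maps G' G''"
  shows "pair_comp G Q P \<in> pair_maps G G''"
proof -
  obtain p0 p q0 q where P': "P = (p0, p)" and Q': "Q = (q0, q)" by (cases P, cases Q)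
  have p: "p0 \<in> gE G \<rightarrow>\<^sub>E gE G'" "p \<in> Emb G \<rightarrow>\<^sub>E Emb G'"
    "\<And>X. X \<in> Emb G \<Longrightarrow> emb_is_edge X \<Longrightarrow> emb_is_edge (p X)"
    "\<And>L X Y. L \<in> Emb G \<Longrightarrow> X \<in> Emb G \<Longrightarrow> Y \<in> Emb G \<Longrightarrow> emb_union L X Y \<Longrightarrow> emb_union (p L) (p X) (p Y)"
    "\<And>X Y. X \<in> Emb G \<Longrightarrow> Y \<in> Emb G \<Longrightarrow> emb_disjoint X Y \<Longrightarrow> emb_disjoint (p X) (p Y)"
    "\<And>X. X \<in> Emb G \<Longrightarrow> emb_in (p X) = image_mset p0 (emb_in X)"
    "\<And>X. X \<in> Emb G \<Longrightarrow> emb_out (p X) = image_mset p0 (emb_out X)"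
    using P by (auto simp: pair_maps_def P')
  have q: "q0 \<in> gE G' \<rightarrow>\<^sub>E gE G''" "q \<in> Emb G' \<rightarrow>\<^sub>E Emb G''"
    "\<And>X. X \<in> Emb G' \<Longrightarrow> emb_is_edge X \<Longrightarrow> emb_is_edge (q X)"
    "\<And>L X Y. L \<in> Emb G' \<Longrightarrow> X \<in> Emb G' \<Longrightarrow> Y \<in> Emb G' \<Longrightarrow> emb_union L X Y \<Longrightarrow> emb_union (q L) (q X) (q Y)"
    "\<And>X Y. X \<in> Emb G' \<Longrightarrow> Y \<in> Emb G' \<Longrightarrow> emb_disjoint X Y \<Longrightarrow> emb_disjoint (q X) (q Y)"
    "\<And>X. X \<in> Emb G' \<Longrightarrow> emb_in (q X) = image_mset q0 (emb_in X)"
    "\<And>X. X \<in> Emb G' \<Longrightarrow> emb_out (q X) = image_mset q0 (emb_out X)"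
    using Q by (auto simp: pair_maps_def Q')
  have pE: "p X \<in> Emb G'" if "X \<in> Emb G" for X using p(2) that by blast
  \<comment> \<open>\<open>compose\<close> is undefined off \<open>gE G\<close>, so the equation
    needs multisets supported there; \<open>emb_in_subset\<close> supplies this for inputs and
    outputs.\<close>
  have cong: "image_mset q0 (image_mset p0 M) = image_mset (compose (gE G) q0 p0) M" if "set_mset M \<subseteq> gE G" for M
    unfolding multiset.map_comp using that by (intro image_mset_cong) (auto simp: compose_def)
  have "compose (gE G) q0 p0 \<in> gE G \<rightarrow>\<^sub>E gE G''" "compose (Emb G) q p \<in> Emb G \<rightarrow>\<^sub>E Emb G''"
    using p(1,2) q(1,2) by (auto simp: compose_def)
  then show ?thesis
    using p(3-7) q(3-7) pE cong emb_in_subset[of _ G] by (simp add: pair_maps_def pair_comp_def P' Q' compose_def)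
qed

context graphical_map
begin

text \<open>The vertex set on the right does not mention \<open>r\<close> or \<open>k\<close>. This
  shows that the composite on generators is independent of the representatives, and it is all that
  is needed to identify it.\<close>

lemma comp_rep_image:
  fixes G'' :: "('e, 'v) dgraph" and r :: "'v \<Rightarrow> ('e, 'v, 'e, 'e, 'v) gen_image"
  assumes g: "graphical_map G' G'' g" and v: "v \<in> gV G" and k: "k \<in> snd f v"
    and r: "\<forall>u\<in>gV G'. r u \<in> snd g u"
  shows "comp_rep (fst g) r k \<in>
    embedded_images G G'' (compose (gE G) (fst g) (fst f)) v (\<Union>u\<in>wp_verts f v. wp_verts g u)"
proof -
  interpret g: graphical_map G' G'' g by (rule g)
  note K = gen_image_atD[OF f1_at[OF v k]] and e = f1_embedding[OF v k]
  interpret I: induced "gi_graph k" "gi_map k" G' G'' "fst g" r using g.induced[OF e r] .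
  define c where "c = comp_rep (fst g) r k"
  have c: "gi_graph c = I.S" "gi_map c = ind_map (gi_graph k) (gi_map k) (fst g) r"
    "gi_in c = (\<lambda>x\<in>gin I.S. the_elem (gi_in k ` {e \<in> gin (gi_graph k). I.q (Inl e) = x}))"
    "gi_out c = (\<lambda>x\<in>gout I.S. the_elem (gi_out k ` {e \<in> gout (gi_graph k). I.q (Inl e) = x}))"
    by (simp_all add: c_def comp_rep_def Let_def I.ind_graph_S ind_class_def)
  have gi_in: "gi_in c (I.q (Inl e)) = gi_in k e" if e: "e \<in> gin (gi_graph k)" for e
  proof -
    have "{e' \<in> gin (gi_graph k). I.q (Inl e') = I.q (Inl e)} = {e}"
      using I.inj_gin e by (auto dest: inj_onD)
    then show ?thesis using e by (simp add: c(3) I.S_simps(5))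
  qed
  have gi_out: "gi_out c (I.q (Inl e)) = gi_out k e" if e: "e \<in> gout (gi_graph k)" for e
  proof -
    have "{e' \<in> gout (gi_graph k). I.q (Inl e') = I.q (Inl e)} = {e}"
      using I.inj_gout e by (auto dest: inj_onD)
    then show ?thesis using e by (simp add: c(4) I.S_simps(6))
  qed
  note dG = connected_graph_directed[OF G]
  have "bij_betw (gi_in c) (gin I.S) (in_at G v)"
  proof -
    have "bij_betw (gi_in c \<circ> (\<lambda>e. I.q (Inl e))) (gin (gi_graph k)) (in_at G v)"
      using K(4) gi_in by (simp cong: bij_betw_cong)
    moreover have "bij_betw (\<lambda>e. I.q (Inl e)) (gin (gi_graph k)) (gin I.S)"
      using I.inj_gin by (simp add: bij_betw_def I.S_simps(5))
    ultimately show ?thesis by (simp add: bij_betw_comp_iff)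
  qed
  moreover have "bij_betw (gi_out c) (gout I.S) (out_at G v)"
  proof -
    have "bij_betw (gi_out c \<circ> (\<lambda>e. I.q (Inl e))) (gout (gi_graph k)) (out_at G v)"
      using K(6) gi_out by (simp cong: bij_betw_cong)
    moreover have "bij_betw (\<lambda>e. I.q (Inl e)) (gout (gi_graph k)) (gout I.S)"
      using I.inj_gout by (simp add: bij_betw_def I.S_simps(6))
    ultimately show ?thesis by (simp add: bij_betw_comp_iff)
  qed
  moreover have "fst (gi_map c) x = compose (gE G) (fst g) (fst f) (gi_in c x)" if x: "x \<in> gin I.S" for x
  proof -
    obtain e where e: "e \<in> gin (gi_graph k)" "x = I.q (Inl e)" using x by (auto simp: I.S_simps(5))
    have "gi_in k e \<in> gE G" using bij_betwE[OF K(4)] e(1) in_at_subset[OF dG] by blast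
    then show ?thesis
      using e gi_in[OF e(1)] K(7)[OF e(1)] I.ind_map_q[of "Inl e"] I.H_subset(1)
      by (simp add: c(2) compose_def)
  qed
  moreover have "fst (gi_map c) x = compose (gE G) (fst g) (fst f) (gi_out c x)" if x: "x \<in> gout I.S" for x
  proof -
    obtain e where e: "e \<in> gout (gi_graph k)" "x = I.q (Inl e)" using x by (auto simp: I.S_simps(6))
    have "gi_out k e \<in> gE G" using bij_betwE[OF K(6)] e(1) out_at_subset[OF dG] by blast
    then show ?thesis
      using e gi_out[OF e(1)] K(8)[OF e(1)] I.ind_map_q[of "Inl e"] I.H_subset(2)
      by (simp add: c(2) compose_def)
  qed
  moreover have "gi_in c \<in> extensional (gin I.S)" "gi_out c \<in> extensional (gout I.S)" by (simp_all add: c(3,4))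
  ultimately have "gen_image_at G G'' (compose (gE G) (fst g) (fst f)) v c"
    using I.connected_S I.local_map_ind_map by (simp add: gen_image_at_def c(1,2))
  \<comment> \<open>The representative \<open>k\<close> is itself an embedding into
    \<open>G'\<close>, so the graphical condition on \<open>g\<close> can be applied to it.\<close>
  moreover have "embedding (gi_graph c) G'' (gi_map c)"
    using g.graphical[OF e r] by (simp add: c I.ind_graph_S)
  moreover have "gi_verts c = (\<Union>u\<in>wp_verts f v. wp_verts g u)"
  proof -
    have "gi_verts c = (\<Union>u\<in>gi_verts k. gi_verts (r u))"
      using I.map_verts_ind by (simp add: gi_verts_def c)
    also have "\<dots> = (\<Union>u\<in>wp_verts f v. wp_verts g u)"
      unfolding gi_verts_f1[OF v k] using f1_eq(2)[OF v] r
      by (intro SUP_cong refl g.gi_verts_f1) auto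
    finally show ?thesis .
  qed
  ultimately show ?thesis by (simp add: embedded_images_def c_def)
qed

end

text \<open>The argument runs backwards: the composite pair is already a pair, so it comes from a
  graphical map, and \<open>wp_comp\<close> is shown to be that map. On each generator both consist
  of the embedded images with one and the same vertex set.\<close>

lemma pair_of_wp_comp:
  fixes G G' G'' :: "('e::infinite, 'v::infinite) dgraph"
  assumes conn: "connected_graph G" "connected_graph G'" "connected_graph G''"
    and f: "f \<in> graphical_maps G G'" and g: "g \<in> graphical_maps G' G''"
  shows "wp_comp G G' G'' g f \<in> graphical_maps G G''"
    "pair_of G G'' (wp_comp G G' G'' g f) = pair_comp G (pair_of G' G'' g) (pair_of G G' f)"
proof -
  interpret f: graphical_map G G' f using f graphical_map_iff[OF conn(1,2)] by blast
  interpret g: graphical_map G' G'' g using g graphical_map_iff[OF conn(2,3)] by blast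
  define P where "P = pair_comp G (pair_of G' G'' g) (pair_of G G' f)"
  have "P \<in> pair_maps G G''"
    unfolding P_def by (rule pair_comp_in_pair_maps[OF f.pair_of_in_pair_maps g.pair_of_in_pair_maps])
  moreover have fstP: "fst P = compose (gE G) (fst g) (fst f)"
    by (simp add: P_def pair_comp_def pair_of_def)
  ultimately interpret P: pair_map G G'' "compose (gE G) (fst g) (fst f)" "snd P"
    using conn by unfold_locales (metis prod.collapse)+
  have verts: "emb_verts (snd P (star_class G v)) = (\<Union>u\<in>wp_verts f v. wp_verts g u)" if v: "v \<in> gV G" for v
  proof -
    note st = star_class[OF conn(1) v]
    have "snd P (star_class G v) = snd (pair_of G' G'' g) (snd (pair_of G G' f) (star_class G v))"
      using st(1) by (simp add: P_def pair_comp_def compose_def)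
    then show ?thesis
      using g.pair_of_Emb(2)[OF f.pair_of_Emb(1)[OF st(1)]] f.pair_of_Emb(2)[OF st(1)] st(2) by simp
  qed
  have "snd (wp_comp G G' G'' g f) v = P.gens v" if v: "v \<in> gV G" for v
  proof -
    let ?V = "\<Union>u\<in>wp_verts f v. wp_verts g u"
    let ?h0 = "compose (gE G) (fst g) (fst f)"
    have c: "comp_rep (fst g) r k \<in> embedded_images G G'' ?h0 v ?V"
      if "k \<in> snd f v" "\<forall>u\<in>gV G'. r u \<in> snd g u" for k r
      using f.comp_rep_image[OF g.graphical_map_axioms v that] .
    obtain k where k: "k \<in> snd f v" using f.f1_class[OF v] by blast
    obtain r where r: "\<forall>u\<in>gV G'. r u \<in> snd g u" using g.family .
    have "snd (wp_comp G G' G'' g f) v = embedded_images G G'' ?h0 v ?V"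
    proof (intro equalityI subsetI)
      fix s assume "s \<in> snd (wp_comp G G' G'' g f) v"
      then obtain k' r' where s: "gen_image_at G G'' ?h0 v s" "k' \<in> snd f v" "\<forall>u\<in>gV G'. r' u \<in> snd g u"
        "gen_image_iso s (comp_rep (fst g) r' k')"
        using v by (auto simp: wp_comp_def)
      then show "s \<in> embedded_images G G'' ?h0 v ?V"
        using c[OF s(2,3)] gen_image_iso_embedding[OF s(4)] gen_image_iso_verts[OF s(4)]
        by (simp add: embedded_images_def)
    next
      fix s :: "('e, 'v, 'e, 'e, 'v) gen_image"
      assume s: "s \<in> embedded_images G G'' ?h0 v ?V"
      \<comment> \<open>One fixed choice of \<open>k\<close> and \<open>r\<close> serves every
        \<open>s\<close>, since embedded images with equal vertices are isomorphic.\<close>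
      then have "gen_image_iso s (comp_rep (fst g) r k)"
        using c[OF k r] gen_image_iso_if_verts[of G G'' ?h0 v s "comp_rep (fst g) r k"]
        by (simp add: embedded_images_def)
      then show "s \<in> snd (wp_comp G G' G'' g f) v"
        using s k r v by (auto simp: wp_comp_def embedded_images_def)
    qed
    then show ?thesis using verts[OF v] by (simp add: P.gens_def)
  qed
  then have "snd (wp_comp G G' G'' g f) = snd P.wp_of_pair"
    by (intro extensionalityI[of _ "gV G"]) (simp_all add: wp_comp_def P.wp_of_pair_def)
  then have w: "wp_comp G G' G'' g f = P.wp_of_pair"
    by (intro prod_eqI) (simp_all add: wp_comp_def P.wp_of_pair_def)
  show "wp_comp G G' G'' g f \<in> graphical_maps G G''"
    unfolding w using P.graphical_wp_of_pair graphical_map_iff[OF conn(1,3)] by blast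
  show "pair_of G G'' (wp_comp G G' G'' g f) = pair_comp G (pair_of G' G'' g) (pair_of G G' f)"
    unfolding w P.pair_of_wp_of_pair P_def[symmetric] by (simp add: prod_eq_iff fstP)
qed

theorem theorem1:
  fixes Ob :: "('e::infinite, 'v::infinite) dgraph set"
  assumes "Ob = {G. connected_graph G} \<or> Ob = {G. connected_graph G \<and> \<not> nodeless_loop G}"
  shows "\<exists>\<Phi> :: ('e, 'v) dgraph \<Rightarrow> ('e, 'v) dgraph \<Rightarrow> ('e, 'v) wp_map \<Rightarrow> ('e, 'v) fpair.
    (\<forall>G\<in>Ob. \<forall>G'\<in>Ob.
        bij_betw (\<Phi> G G') (graphical_maps G G') (pair_maps G G') \<and>
        (\<forall>f\<in>graphical_maps G G'. fst (\<Phi> G G' f) = fst f)) \<and>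
    (\<forall>G\<in>Ob. \<forall>G'\<in>Ob. \<forall>G''\<in>Ob. \<forall>f\<in>graphical_maps G G'. \<forall>g\<in>graphical_maps G' G''.
        wp_comp G G' G'' g f \<in> graphical_maps G G'' \<and>
        \<Phi> G G'' (wp_comp G G' G'' g f) = pair_comp G (\<Phi> G' G'' g) (\<Phi> G G' f))"
proof -
  \<comment> \<open>Excluding nodeless loops means passing to a full subcategory: the sets of
    morphisms and of pairs between the remaining objects are unchanged, and \<open>pair_of\<close>
    serves both versions.\<close>
  have Ob: "connected_graph G" if "G \<in> Ob" for G using assms that by auto
  have "fst (pair_of G G' f) = fst f" for G G' :: "('e, 'v) dgraph" and f by (simp add: pair_of_def)
  then show ?thesis
    using bij_betw_pair_of[OF Ob Ob] pair_of_wp_comp[OF Ob Ob Ob]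
    by (intro exI[of _ pair_of] conjI ballI) simp_all
qed

end
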